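(* Let $p,\hat k\in\mathbb Z^2\setminus\{0\}$ and $\Gamma\in\mathbb C$ be such that $a=\frac12|\Gamma|(p_1\hat k_2-p_2\hat k_1)\ne0$. Let $\mathcal L_A$ be the bounded linear operator on $\ell_2$ given, for $z=(z_1,z_2,\dots)$, by $$(\mathcal L_Az)_1=ia[\rho_1z_2+\rho_{-1}z_3],\qquad(\mathcal L_Az)_2=ia[\rho_0z_1+\rho_2z_4],$$ $$(\mathcal L_Az)_{2n}=ia[\rho_{n-1}z_{2(n-1)}+\rho_{n+1}z_{2(n+1)}]\ (n\ge2),\qquad(\mathcal L_Az)_{2n+1}=ia[\rho_{-n+1}z_{2(n-1)+1}+\rho_{-n-1}z_{2(n+1)+1}]\ (n\ge1),$$ and let $C_B=\{\,i2b\cos2\theta:\theta\in[0,2\pi)\,\}$ with $b=-a|p|^{-2}$. Then: 1. If $\Sigma_{\hat k}\cap\bar D_{|p|}=\emptyset$, then the entire $\ell_2$ spectrum of $\mathcal L_A$ is its continuous spectrum, which is $C_B$: $\sigma(\mathcal L_A)=\sigma_c(\mathcal L_A)=C_B$. 2. If $\Sigma_{\hat k}\cap\bar D_{|p|}\ne\emptyset$, then the entire essential $\ell_2$ spectrum of $\mathcal L_A$ is its continuous spectrum, which is $C_B$: $\sigma_{\rm ess}(\mathcal L_A)=\sigma_c(\mathcal L_A)=C_B$. That is, the residual spectrum of $\mathcal L_A$ is empty, $\sigma_r(\mathcal L_A)=\emptyset$. The point spectrum of $\mathcal L_A$ is symmetric with respect to both the real and imaginary axes.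
   Context: Notation: $\rho_n=|\hat k+np|^{-2}-|p|^{-2}$ for $n\in\mathbb Z$; $\Sigma_{\hat k}=\{\hat k+np\in\mathbb Z^2\setminus\{0\}:n\in\mathbb Z\}$; $\bar D_{|p|}=\{k\in\mathbb Z^2\setminus\{0\}:|k|\le|p|\}$; $\ell_2$ is the space of complex square-summable sequences indexed by $1,2,\dots$. For a linear operator $\mathcal L$ on $\ell_2$: the point spectrum $\sigma_p(\mathcal L)$ is the set of $\lambda\in\mathbb C$ for which $\mathcal L-\lambda I$ is not injective; $\sigma_r(\mathcal L)$ (residual) is the set of $\lambda$ for which $(\mathcal L-\lambda I)^{-1}$ exists with domain (the range of $\mathcal L-\lambda I$) not dense; $\sigma_c(\mathcal L)$ (continuous) is the set of $\lambda$ for which $(\mathcal L-\lambda I)^{-1}$ exists, is unbounded, and has dense domain; $\sigma(\mathcal L)=\sigma_p\cup\sigma_r\cup\sigma_c$. The essential spectrum $\sigma_{\rm ess}(\mathcal L)$ is (following Reed–Simon) $\sigma(\mathcal L)$ minus the discrete spectrum, i.e. minus the isolated points of the spectrum that are eigenvalues of finite algebraic multiplicity.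
   Formalization: In item 2, if some k in Σ_k̂ has |k|=|p|, then some ρ_n=0, so 0 is an eigenvalue and σ_c(L_A)=C_B fails; the formal statement gives σ_c(L_A)=C_B∖{0} in that case and σ_c(L_A)=C_B otherwise; all other claims are unchanged. *)

theory Defs
  imports "HOL-Complex_Analysis.Complex_Analysis"
begin

section \<open>The space of square-summable sequences indexed by 1, 2, ...\<close>

text \<open>The unused entry at index 0 is pinned to 0, so that equality of functions on
  \<^term>\<open>ell2\<close> is equality of sequences.\<close>

definition ell2 :: "(nat \<Rightarrow> complex) set" where
  "ell2 = {z. z 0 = 0 \<and> summable (\<lambda>n. (cmod (z n))\<^sup>2)}"

definition ell2_norm :: "(nat \<Rightarrow> complex) \<Rightarrow> real" where
  "ell2_norm z = sqrt (\<Sum>n. (cmod (z n))\<^sup>2)"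

definition ell2_dense :: "(nat \<Rightarrow> complex) set \<Rightarrow> bool" where
  "ell2_dense D \<longleftrightarrow> (\<forall>z\<in>ell2. \<forall>e>0. \<exists>w\<in>D. ell2_norm (\<lambda>n. w n - z n) < e)"

definition finite_dimensional :: "(nat \<Rightarrow> complex) set \<Rightarrow> bool" where
  "finite_dimensional V \<longleftrightarrow>
     (\<exists>B. finite B \<and> (\<forall>v\<in>V. \<exists>c. v = (\<lambda>n. \<Sum>u\<in>B. c u * u n)))"


section \<open>Spectra of operators on \<open>\<ell>\<^sub>2\<close>\<close>

text \<open>An operator is a map of sequences, of which only the action on \<^term>\<open>ell2\<close> is used;
  it is meant to map \<^term>\<open>ell2\<close> to itself.\<close>

type_synonym seq_op = "(nat \<Rightarrow> complex) \<Rightarrow> (nat \<Rightarrow> complex)"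

definition shifted :: "seq_op \<Rightarrow> complex \<Rightarrow> seq_op" where
  "shifted T \<mu> = (\<lambda>z n. T z n - \<mu> * z n)"

definition resolvent_op :: "seq_op \<Rightarrow> complex \<Rightarrow> seq_op" where
  "resolvent_op T \<mu> = inv_into ell2 (shifted T \<mu>)"

definition point_spectrum :: "seq_op \<Rightarrow> complex set" where
  "point_spectrum T = {\<mu>. \<not> inj_on (shifted T \<mu>) ell2}"

definition residual_spectrum :: "seq_op \<Rightarrow> complex set" where
  "residual_spectrum T =
     {\<mu>. inj_on (shifted T \<mu>) ell2 \<and> \<not> ell2_dense (shifted T \<mu> ` ell2)}"

definition continuous_spectrum :: "seq_op \<Rightarrow> complex set" where
  "continuous_spectrum T =
     {\<mu>. inj_on (shifted T \<mu>) ell2 \<and> ell2_dense (shifted T \<mu> ` ell2) \<and>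
         \<not> (\<exists>C. \<forall>w\<in>shifted T \<mu> ` ell2. ell2_norm (resolvent_op T \<mu> w) \<le> C * ell2_norm w)}"

definition spectrum :: "seq_op \<Rightarrow> complex set" where
  "spectrum T = point_spectrum T \<union> residual_spectrum T \<union> continuous_spectrum T"

text \<open>The Riesz projection \<open>-1/(2\<pi>i) \<integral> (T - \<mu>)\<^sup>-\<^sup>1 d\<mu>\<close> over a circle, computed entry by
  entry. As in Reed and Simon, the algebraic multiplicity of an isolated point of the spectrum
  is the dimension of the range of this projection, for any circle that separates the point
  from the rest of the spectrum.\<close>

definition riesz_projection :: "seq_op \<Rightarrow> complex \<Rightarrow> real \<Rightarrow> seq_op" where
  "riesz_projection T \<mu>\<^sub>0 r = (\<lambda>z n.
     - 1 / (2 * of_real pi * \<i>) *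
       contour_integral (circlepath \<mu>\<^sub>0 r) (\<lambda>\<mu>. resolvent_op T \<mu> z n))"

definition finite_algebraic_multiplicity :: "seq_op \<Rightarrow> complex \<Rightarrow> bool" where
  "finite_algebraic_multiplicity T \<mu>\<^sub>0 \<longleftrightarrow>
     (\<exists>r>0. spectrum T \<inter> cball \<mu>\<^sub>0 r = {\<mu>\<^sub>0} \<and>
            finite_dimensional (riesz_projection T \<mu>\<^sub>0 r ` ell2))"

definition discrete_spectrum :: "seq_op \<Rightarrow> complex set" where
  "discrete_spectrum T =
     {\<mu>. \<mu> isolated_in (spectrum T) \<and> \<mu> \<in> point_spectrum T \<and> finite_algebraic_multiplicity T \<mu>}"

definition essential_spectrum :: "seq_op \<Rightarrow> complex set" where
  "essential_spectrum T = spectrum T - discrete_spectrum T"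


section \<open>The lattice and the operator\<close>

definition lnorm :: "int \<times> int \<Rightarrow> real" where
  "lnorm k = sqrt ((real_of_int (fst k))\<^sup>2 + (real_of_int (snd k))\<^sup>2)"

definition line_pt :: "int \<times> int \<Rightarrow> int \<times> int \<Rightarrow> int \<Rightarrow> int \<times> int" where
  "line_pt kh p n = (fst kh + n * fst p, snd kh + n * snd p)"

definition rho :: "int \<times> int \<Rightarrow> int \<times> int \<Rightarrow> int \<Rightarrow> real" where
  "rho kh p n = lnorm (line_pt kh p n) powi (-2) - lnorm p powi (-2)"

definition Sigma_line :: "int \<times> int \<Rightarrow> int \<times> int \<Rightarrow> (int \<times> int) set" where
  "Sigma_line kh p = range (line_pt kh p) - {(0, 0)}"

definition closed_disk :: "int \<times> int \<Rightarrow> (int \<times> int) set" where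
  "closed_disk p = {k. k \<noteq> (0, 0) \<and> lnorm k \<le> lnorm p}"

definition LA :: "real \<Rightarrow> (int \<Rightarrow> real) \<Rightarrow> seq_op" where
  "LA a \<rho> z m =
     (if m = 0 then 0
      else if m = 1 then \<i> * of_real a * (of_real (\<rho> 1) * z 2 + of_real (\<rho> (-1)) * z 3)
      else if m = 2 then \<i> * of_real a * (of_real (\<rho> 0) * z 1 + of_real (\<rho> 2) * z 4)
      else let n = m div 2 in
        if even m
        then \<i> * of_real a * (of_real (\<rho> (int n - 1)) * z (2 * (n - 1))
                              + of_real (\<rho> (int n + 1)) * z (2 * (n + 1)))
        else \<i> * of_real a * (of_real (\<rho> (- int n + 1)) * z (2 * (n - 1) + 1)
                              + of_real (\<rho> (- int n - 1)) * z (2 * (n + 1) + 1)))"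

lemma LA_even:
  assumes "n \<ge> 2"
  shows "LA a \<rho> z (2 * n) = \<i> * of_real a * (of_real (\<rho> (int n - 1)) * z (2 * (n - 1))
                                            + of_real (\<rho> (int n + 1)) * z (2 * (n + 1)))"
  using assms by (simp add: LA_def Let_def)

lemma LA_odd:
  assumes "n \<ge> 1"
  shows "LA a \<rho> z (2 * n + 1) = \<i> * of_real a * (of_real (\<rho> (- int n + 1)) * z (2 * (n - 1) + 1)
                                            + of_real (\<rho> (- int n - 1)) * z (2 * (n + 1) + 1))"
  using assms by (auto simp: LA_def Let_def)

definition CB :: "real \<Rightarrow> complex set" where
  "CB b = {\<i> * of_real (2 * b * cos (2 * \<theta>)) | \<theta>. \<theta> \<in> {0..<2 * pi}}"


section \<open>The circle case\<close>

text \<open>If the line meets the circle of radius \<open>|p|\<close> at \<open>kh + np\<close>, then \<open>\<rho>\<^sub>n = 0\<close> and the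
  corresponding unit vector is in the kernel of the operator. So 0, which is in \<^term>\<open>CB b\<close>, is
  an eigenvalue and not a point of the continuous spectrum, and the continuous spectrum
  cannot be all of \<^term>\<open>CB b\<close> then.\<close>

lemma rho_eq_0: "lnorm (line_pt kh p n) = lnorm p \<Longrightarrow> rho kh p n = 0"
  by (simp add: rho_def)

lemma zero_eigenvalue:
  assumes "\<rho> n = 0"
  shows "0 \<in> point_spectrum (LA a \<rho>)" and "0 \<notin> continuous_spectrum (LA a \<rho>)"
proof -
  define m :: nat where
    "m = (if n = 0 then 1 else if n > 0 then 2 * nat n else 2 * nat (- n) + 1)"
  define e :: "nat \<Rightarrow> complex" where "e = (\<lambda>j. if j = m then 1 else 0)"
  have m: "m \<noteq> 0" by (auto simp: m_def)
  have "summable (\<lambda>j. (cmod (e j))\<^sup>2)"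
    by (rule summable_finite[of "{m}"]) (auto simp: e_def)
  then have e: "e \<in> ell2" using m by (auto simp: ell2_def e_def)
  have z: "(\<lambda>_. 0) \<in> ell2" by (simp add: ell2_def)
  have "LA a \<rho> e j = 0" for j
  proof -
    have m_pos: "n > 0 \<Longrightarrow> m = 2 * nat n" and m_nonpos: "\<not> n > 0 \<Longrightarrow> m = 2 * nat (- n) + 1"
      by (auto simp: m_def)
    have m2: "n = int k" if "2 * k = m" for k
    proof (cases "n > 0")
      case True then show ?thesis using m_pos that by simp
    next
      case False then show ?thesis using m_nonpos that by (metis even_add even_mult_iff odd_one even_numeral)
    qed
    have m3: "n = - int k" if "2 * k + 1 = m" for k
    proof (cases "n > 0")
      case True then show ?thesis using m_pos that by (metis even_add even_mult_iff odd_one even_numeral)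
    next
      case False then show ?thesis using m_nonpos that by simp
    qed
    have w2: "\<rho> (int k) * e (2 * k) = 0" for k
      using m2[of k] assms by (auto simp: e_def)
    have w3: "\<rho> (- int k) * e (Suc (2 * k)) = 0" for k
      using m3[of k] assms by (auto simp: e_def)
    have w1: "\<rho> 0 * e 1 = 0" using w3[of 0] by simp
    consider "j = 0" | "j = 1" | "j = 2" | k where "j = 2 * (k + 2)" | k where "j = 2 * (k + 1) + 1"
    proof -
      have "j = 0 \<or> j = 1 \<or> j = 2 \<or> (\<exists>k. j = 2 * (k + 2)) \<or> (\<exists>k. j = 2 * (k + 1) + 1)"
        by presburger
      then show ?thesis using that by blast
    qed
    then show ?thesis
    proof cases
      case 1 then show ?thesis by (auto simp: LA_def)
    next
      case 2 then show ?thesis using w2[of 1] w3[of 1] by (auto simp: LA_def eval_nat_numeral)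
    next
      case 3 then show ?thesis using w1 w2[of 2] by (auto simp: LA_def)
    next
      case (4 k)
      have "LA a \<rho> e (2 * (k + 2)) = 0"
        using w2[of "k + 1"] w2[of "k + 3"] by (subst LA_even) (auto simp: algebra_simps eval_nat_numeral)
      then show ?thesis using 4 by simp
    next
      case (5 k)
      have "LA a \<rho> e (2 * (k + 1) + 1) = 0"
        using w3[of k] w3[of "k + 2"] by (subst LA_odd) (auto simp: algebra_simps eval_nat_numeral)
      then show ?thesis using 5 by simp
    qed
  qed
  then have "shifted (LA a \<rho>) 0 e = shifted (LA a \<rho>) 0 (\<lambda>_. 0)"
    by (auto simp: shifted_def LA_def fun_eq_iff Let_def)
  moreover have "e \<noteq> (\<lambda>_. 0)" by (auto simp: e_def fun_eq_iff)
  ultimately have "\<not> inj_on (shifted (LA a \<rho>) 0) ell2"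
    using e z by (auto simp: inj_on_def)
  then show "0 \<in> point_spectrum (LA a \<rho>)" and "0 \<notin> continuous_spectrum (LA a \<rho>)"
    by (auto simp: point_spectrum_def continuous_spectrum_def)
qed

lemma zero_in_CB: "0 \<in> CB b"
proof -
  have "\<i> * of_real (2 * b * cos (2 * (pi / 4))) = 0" by (simp add: cos_pi_half)
  moreover have "pi / 4 \<in> {0..<2 * pi}" by simp
  ultimately show ?thesis unfolding CB_def by (metis (mono_tags, lifting) mem_Collect_eq)
qed

end

(* Reindex by the integers: positive n by 2n and nonpositive n by -2n+1. The operator becomes
   i a (S + S^-1) rho with S the shift, and rho_n + |p|^-2 is positive and summable, so that it
   is a perturbation of -i a |p|^-2 (S + S^-1), whose spectrum is the segment CB.

   Off CB: rho_n is nonnegative for at most two n. Once these entries are made negative, rho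
   times the operator shifted by mu has, up to a constant factor, a coercive real part, so the
   shifted operator is invertible. The operator is a rank-two perturbation of this one, and its
   resolvent is given by Cramer's rule with a holomorphic 2x2 determinant that does not vanish
   identically. Its zeros are isolated eigenvalues with Riesz projections of finite rank.

   On CB: truncated plane waves show that the shifted operator is not bounded below, and a vector
   orthogonal to its range would give an eigenvector. Eigenvectors for a nonzero mu, and for
   mu = 0 if no rho_n vanishes, are excluded by a three-term recurrence for u = rho w: an energy
   estimate in the interior of CB, and at its endpoints the equation
   (x^2 - s^2) (second difference of u) = 2 u on a translate of the integers with s^2 < 1, handled
   by the maximum principle and, if two coefficients are negative, by comparison with 1/x. *)

theory Submission
  imports Defs
begin

section \<open>The Hilbert space of square-summable two-sided sequences\<close>

text \<open>With \<sigma> = -\<rho> the operator is -i a (S + S^-1) \<sigma>. It is not skew-adjoint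
  in the given inner product but skew for the form weighted by \<sigma>, and this is where the
  coercivity comes from. As soon as some weight is nonnegative the weighted form is no longer
  positive definite; hence the detour through altered weights and a determinant, although at most
  two entries are at fault. At the endpoints of the segment the energy form of the interior argument
  degenerates. Moreover 1/x, which solves the endpoint equation for s = 1, is square summable along
  each half line, so decay at infinity alone cannot exclude a solution there. What has to be shown
  is that solutions decaying to the left and to the right do not fit together in the middle. This
  takes the exact form of the coefficients and not just their asymptotics.\<close>

lemma norm_add_sq_le: "(norm (x + y))\<^sup>2 \<le> 2 * (norm x)\<^sup>2 + 2 * (norm y)\<^sup>2"
  for x y :: "'a::real_inner"
proof -
  have "0 \<le> (norm (x - y))\<^sup>2" by simp
  then show ?thesis
    by (simp add: power2_norm_eq_inner inner_simps inner_commute algebra_simps)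
qed

lemma abs_inner_le: "\<bar>x \<bullet> y\<bar> \<le> (norm x)\<^sup>2 + (norm y)\<^sup>2" for x y :: "'a::real_inner"
proof -
  have "\<bar>x \<bullet> y\<bar> \<le> norm x * norm y" by (rule Cauchy_Schwarz_ineq2)
  also have "\<dots> \<le> (norm x)\<^sup>2 + (norm y)\<^sup>2"
    using sum_squares_bound[of "norm x" "norm y"] mult_nonneg_nonneg[OF norm_ge_zero[of x] norm_ge_zero[of y]]
    unfolding power2_eq_square by linarith
  finally show ?thesis .
qed

text \<open>As a type it can be an instance of the classes of real inner product spaces and of
  complete spaces. The inner product is the real part of the Hermitian one; complex scalars enter
  through \<open>cscale\<close>.\<close>

typedef zl2 = "{f :: int \<Rightarrow> complex. (\<lambda>n. (cmod (f n))\<^sup>2) summable_on UNIV}"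
  morphisms ent Abs_zl2
  by (rule exI[of _ "\<lambda>_. 0"]) simp

setup_lifting type_definition_zl2

lemma zl2_eqI: "(\<And>n. ent x n = ent y n) \<Longrightarrow> x = y"
  by (metis ent_inject ext)

lemma summable_on_ent: "(\<lambda>n. (cmod (ent x n))\<^sup>2) summable_on UNIV"
  using ent[of x] by simp

lemma summable_on_inner_ent: "(\<lambda>n. ent x n \<bullet> ent y n) summable_on UNIV"
proof -
  have "(\<lambda>n. norm (ent x n \<bullet> ent y n)) summable_on UNIV"
    by (rule summable_on_comparison_test[where f = "\<lambda>n. (cmod (ent x n))\<^sup>2 + (cmod (ent y n))\<^sup>2"])
       (auto intro!: summable_on_add summable_on_ent simp: abs_inner_le)
  then show ?thesis by (rule abs_summable_summable)
qed

instantiation zl2 :: real_vector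
begin
lift_definition zero_zl2 :: zl2 is "\<lambda>_. 0" by simp
lift_definition plus_zl2 :: "zl2 \<Rightarrow> zl2 \<Rightarrow> zl2" is "\<lambda>f g n. f n + g n"
proof -
  fix f g :: "int \<Rightarrow> complex"
  assume *: "(\<lambda>n. (cmod (f n))\<^sup>2) summable_on UNIV" "(\<lambda>n. (cmod (g n))\<^sup>2) summable_on UNIV"
  show "(\<lambda>n. (cmod (f n + g n))\<^sup>2) summable_on UNIV"
    by (rule summable_on_comparison_test[where f = "\<lambda>n. 2 * (cmod (f n))\<^sup>2 + 2 * (cmod (g n))\<^sup>2"])
       (use * in \<open>auto intro!: summable_on_add summable_on_cmult_right norm_add_sq_le\<close>)
qed
lift_definition uminus_zl2 :: "zl2 \<Rightarrow> zl2" is "\<lambda>f n. - f n" by simp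
definition minus_zl2 :: "zl2 \<Rightarrow> zl2 \<Rightarrow> zl2" where "minus_zl2 x y = x + - y"
lift_definition scaleR_zl2 :: "real \<Rightarrow> zl2 \<Rightarrow> zl2" is "\<lambda>c f n. c *\<^sub>R f n"
  by (auto simp: power_mult_distrib intro!: summable_on_cmult_right)
instance
  by standard (auto intro!: zl2_eqI simp: minus_zl2_def zero_zl2.rep_eq plus_zl2.rep_eq uminus_zl2.rep_eq
      scaleR_zl2.rep_eq scaleR_add_left scaleR_add_right)
end

lemma ent_zero [simp]: "ent 0 n = 0" by transfer simp
lemma ent_add [simp]: "ent (x + y) n = ent x n + ent y n" by transfer simp
lemma ent_minus [simp]: "ent (- x) n = - ent x n" by transfer simp
lemma ent_diff [simp]: "ent (x - y) n = ent x n - ent y n"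
  unfolding minus_zl2_def ent_add ent_minus by simp
lemma ent_scaleR [simp]: "ent (c *\<^sub>R x) n = c *\<^sub>R ent x n" by transfer simp

instantiation zl2 :: real_inner
begin
definition inner_zl2 :: "zl2 \<Rightarrow> zl2 \<Rightarrow> real" where "inner_zl2 x y = (\<Sum>\<^sub>\<infinity>n. ent x n \<bullet> ent y n)"
definition norm_zl2 :: "zl2 \<Rightarrow> real" where "norm_zl2 x = sqrt (x \<bullet> x)"
definition dist_zl2 :: "zl2 \<Rightarrow> zl2 \<Rightarrow> real" where "dist_zl2 x y = norm (x - y)"
definition sgn_zl2 :: "zl2 \<Rightarrow> zl2" where "sgn_zl2 x = x /\<^sub>R norm x"
definition uniformity_zl2 :: "(zl2 \<times> zl2) filter" where
  "uniformity_zl2 = (INF e\<in>{0<..}. principal {(x, y). dist x y < e})"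
definition open_zl2 :: "zl2 set \<Rightarrow> bool" where
  "open_zl2 U \<longleftrightarrow> (\<forall>x\<in>U. \<forall>\<^sub>F (x', y) in uniformity. x' = x \<longrightarrow> y \<in> U)"
instance
proof
  fix x y z :: zl2 and r :: real
  show "dist x y = norm (x - y)" "sgn x = x /\<^sub>R norm x" "norm x = sqrt (x \<bullet> x)"
    by (simp_all add: dist_zl2_def sgn_zl2_def norm_zl2_def)
  show "uniformity = (INF e\<in>{0<..}. principal {(x::zl2, y). dist x y < e})"
    by (simp add: uniformity_zl2_def)
  show "open U \<longleftrightarrow> (\<forall>x\<in>U. \<forall>\<^sub>F (x', y) in uniformity. x' = x \<longrightarrow> y \<in> U)" for U :: "zl2 set"
    by (simp add: open_zl2_def)
  show "x \<bullet> y = y \<bullet> x" by (simp add: inner_zl2_def inner_commute)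
  show "(x + y) \<bullet> z = x \<bullet> z + y \<bullet> z"
    by (simp add: inner_zl2_def inner_add_left infsum_add summable_on_inner_ent)
  show "(r *\<^sub>R x) \<bullet> y = r * (x \<bullet> y)"
    by (simp add: inner_zl2_def infsum_cmult_right')
  show "0 \<le> x \<bullet> x" by (simp add: inner_zl2_def infsum_nonneg)
  show "x \<bullet> x = 0 \<longleftrightarrow> x = 0"
  proof
    assume *: "x \<bullet> x = 0"
    have "ent x n \<bullet> ent x n \<le> 0" for n
      using finite_sum_le_infsum[OF summable_on_inner_ent[of x x], of "{n}"] *
      by (simp add: inner_zl2_def)
    then have "ent x n = 0" for n by (metis inner_eq_zero_iff inner_ge_zero order_antisym)
    then show "x = 0" by (intro zl2_eqI) simp
  qed (simp add: inner_zl2_def)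
qed
end

lemma norm_sq_zl2: "(norm x)\<^sup>2 = (\<Sum>\<^sub>\<infinity>n. (cmod (ent x n))\<^sup>2)"
  by (simp add: power2_norm_eq_inner inner_zl2_def)


lemma ent_sum [simp]: "ent (sum f A) n = (\<Sum>i\<in>A. ent (f i) n)"
  by (induction A rule: infinite_finite_induct) auto

lemma cmod_ent_le: "cmod (ent x n) \<le> norm x"
proof -
  have "(cmod (ent x n))\<^sup>2 \<le> (norm x)\<^sup>2"
    using finite_sum_le_infsum[OF summable_on_ent[of x], of "{n}"] by (simp add: norm_sq_zl2)
  then show ?thesis by (rule power2_le_imp_le) simp
qed

lemma bounded_linear_ent: "bounded_linear (\<lambda>x. ent x n)"
  by (rule bounded_linear_intro[where K = 1]) (auto simp: cmod_ent_le)

lemma norm_zl2_le: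
  assumes "\<And>n. cmod (ent x n) \<le> cmod (ent y n)"
  shows "norm x \<le> norm y"
proof -
  have "(norm x)\<^sup>2 \<le> (norm y)\<^sup>2"
    unfolding norm_sq_zl2 by (intro infsum_mono summable_on_ent power_mono assms) auto
  then show ?thesis by (rule power2_le_imp_le) simp
qed

lemma zl2_membership:
  assumes "\<And>F. finite F \<Longrightarrow> (\<Sum>n\<in>F. (cmod (f n))\<^sup>2) \<le> C"
  shows "f \<in> {f. (\<lambda>n. (cmod (f n))\<^sup>2) summable_on UNIV}"
  using assms by (auto intro!: nonneg_bdd_above_summable_on bdd_aboveI)

lemma sum_ent_le: "finite F \<Longrightarrow> (\<Sum>n\<in>F. (cmod (ent x n))\<^sup>2) \<le> (norm x)\<^sup>2"
  unfolding norm_sq_zl2 by (rule finite_sum_le_infsum) (auto simp: summable_on_ent)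

lemma norm_zl2_leI:
  assumes "\<And>F. finite F \<Longrightarrow> (\<Sum>n\<in>F. (cmod (ent x n))\<^sup>2) \<le> C\<^sup>2" "0 \<le> C"
  shows "norm x \<le> C"
proof -
  have "(norm x)\<^sup>2 \<le> C\<^sup>2"
    unfolding norm_sq_zl2 by (rule infsum_le_finite_sums) (use assms summable_on_ent in auto)
  then show ?thesis using assms(2) by (rule power2_le_imp_le)
qed

instance zl2 :: complete_space
proof
  fix X :: "nat \<Rightarrow> zl2" assume X: "Cauchy X"
  have "Cauchy (\<lambda>k. ent (X k) n)" for n
    by (rule bounded_linear.Cauchy[OF bounded_linear_ent X])
  then have "\<forall>n. \<exists>l. (\<lambda>k. ent (X k) n) \<longlonglongrightarrow> l"
    using Cauchy_convergent convergentD by blast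
  then obtain g where g: "(\<lambda>k. ent (X k) n) \<longlonglongrightarrow> g n" for n
    unfolding choice_iff by blast
  \<comment> \<open>The limit in \<open>l\<close> is taken for one finite set \<open>F\<close> at a
    time, with a bound that does not depend on \<open>F\<close>.\<close>
  have tail: "\<exists>K. \<forall>k\<ge>K. \<forall>F. finite F \<longrightarrow> (\<Sum>n\<in>F. (cmod (ent (X k) n - g n))\<^sup>2) \<le> e\<^sup>2" if e: "e > 0" for e
  proof -
    obtain K where K: "norm (X k - X l) < e" if "k \<ge> K" "l \<ge> K" for k l
      using CauchyD[OF X e] by blast
    have "(\<Sum>n\<in>F. (cmod (ent (X k) n - g n))\<^sup>2) \<le> e\<^sup>2" if k: "k \<ge> K" and F: "finite F" for k F
    proof (rule LIMSEQ_le_const2)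
      show "(\<lambda>l. \<Sum>n\<in>F. (cmod (ent (X k) n - ent (X l) n))\<^sup>2) \<longlonglongrightarrow> (\<Sum>n\<in>F. (cmod (ent (X k) n - g n))\<^sup>2)"
        by (intro tendsto_intros g)
      have "(\<Sum>n\<in>F. (cmod (ent (X k) n - ent (X l) n))\<^sup>2) \<le> e\<^sup>2" if l: "l \<ge> K" for l
      proof -
        have "(\<Sum>n\<in>F. (cmod (ent (X k) n - ent (X l) n))\<^sup>2) \<le> (norm (X k - X l))\<^sup>2"
          using sum_ent_le[OF F, of "X k - X l"] by simp
        also have "\<dots> \<le> e\<^sup>2" using K[OF k l] by (intro power_mono) auto
        finally show ?thesis .
      qed
      then show "\<exists>N. \<forall>l\<ge>N. (\<Sum>n\<in>F. (cmod (ent (X k) n - ent (X l) n))\<^sup>2) \<le> e\<^sup>2" by blast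
    qed
    then show ?thesis by blast
  qed
  obtain K where K: "\<And>F. finite F \<Longrightarrow> (\<Sum>n\<in>F. (cmod (ent (X K) n - g n))\<^sup>2) \<le> 1\<^sup>2"
    using tail[of 1] by auto
  \<comment> \<open>The tail bound controls differences only, so \<open>g\<close> is reached as
    \<open>X K\<close> minus a square summable sequence.\<close>
  have "(\<lambda>n. ent (X K) n - g n) \<in> {f. (\<lambda>n. (cmod (f n))\<^sup>2) summable_on UNIV}"
    by (rule zl2_membership) (rule K)
  then have "ent (Abs_zl2 (\<lambda>n. ent (X K) n - g n)) = (\<lambda>n. ent (X K) n - g n)"
    by (rule Abs_zl2_inverse)
  moreover define y where "y = X K - Abs_zl2 (\<lambda>n. ent (X K) n - g n)"
  ultimately have y: "ent y n = g n" for n by simp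
  have "X \<longlonglongrightarrow> y"
  proof (rule metric_LIMSEQ_I)
    fix e :: real assume "e > 0"
    then obtain K where K: "\<And>k F. k \<ge> K \<Longrightarrow> finite F \<Longrightarrow> (\<Sum>n\<in>F. (cmod (ent (X k) n - g n))\<^sup>2) \<le> (e/2)\<^sup>2"
      using tail[of "e/2"] by auto
    have "norm (X k - y) \<le> e/2" if "k \<ge> K" for k
    proof (rule norm_zl2_leI)
      show "(\<Sum>n\<in>F. (cmod (ent (X k - y) n))\<^sup>2) \<le> (e/2)\<^sup>2" if "finite F" for F
        unfolding ent_diff y by (rule K[OF \<open>K \<le> k\<close> that])
      show "0 \<le> e/2" using \<open>e > 0\<close> by simp
    qed
    then show "\<exists>K. \<forall>k\<ge>K. dist (X k) y < e"
      using \<open>e > 0\<close> unfolding dist_norm by (intro exI[of _ K]) (metis field_sum_of_halves le_less_trans less_add_same_cancel1 half_gt_zero)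
  qed
  then show "convergent X" by (auto simp: convergent_def)
qed

section \<open>Hilbert space tools\<close>

lemma norm_diff_scaleR_sq:
  "(norm (x - t *\<^sub>R y))\<^sup>2 = (norm x)\<^sup>2 - 2 * t * (y \<bullet> x) + t\<^sup>2 * (norm y)\<^sup>2"
  for x y :: "'a::real_inner"
  unfolding power2_norm_eq_inner
  by (simp add: inner_simps inner_commute power2_eq_square algebra_simps)

text \<open>The Lax-Milgram argument: A x = y is the fixed point equation of x - t (A x - y), whose
  linear part has squared norm at most 1 - 2 t d + t^2 K^2. This is least at t = d / K^2.\<close>

lemma coercive_surj:
  fixes A :: "'a::{real_inner, complete_space} \<Rightarrow> 'a"
  assumes A: "bounded_linear A" and d: "d > 0" and co: "\<And>x. d * (norm x)\<^sup>2 \<le> A x \<bullet> x"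
  shows "surj A"
proof -
  interpret A: bounded_linear A by (rule A)
  obtain K0 where K0: "\<And>x. norm (A x) \<le> norm x * K0" using A.bounded by blast
  \<comment> \<open>The maximum makes K positive and d / K at most 1, so that 1 - (d / K)^2 is not
    negative.\<close>
  define K where "K = max K0 d"
  have K: "norm (A x) \<le> norm x * K" for x
    using K0[of x] mult_left_mono[of K0 K "norm x"] by (simp add: K_def)
  have Kd: "K > 0" "d \<le> K" using d by (auto simp: K_def)
  define c where "c = sqrt (1 - (d / K)\<^sup>2)"
  have dK: "0 < (d / K)\<^sup>2" "(d / K)\<^sup>2 \<le> 1" using d Kd by (auto simp: power_le_one)
  then have c: "0 \<le> c" "c < 1" "c\<^sup>2 = 1 - (d / K)\<^sup>2" by (auto simp: c_def real_sqrt_lt_1_iff)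
  have contr: "norm (x - (d / K\<^sup>2) *\<^sub>R A x) \<le> c * norm x" for x
  proof (rule power2_le_imp_le)
    have "(norm (x - (d / K\<^sup>2) *\<^sub>R A x))\<^sup>2
        = (norm x)\<^sup>2 - 2 * (d / K\<^sup>2) * (A x \<bullet> x) + (d / K\<^sup>2)\<^sup>2 * (norm (A x))\<^sup>2"
      by (rule norm_diff_scaleR_sq)
    also have "\<dots> \<le> (norm x)\<^sup>2 - 2 * (d / K\<^sup>2) * (d * (norm x)\<^sup>2) + (d / K\<^sup>2)\<^sup>2 * (norm x * K)\<^sup>2"
      using d Kd by (intro add_mono diff_mono mult_left_mono power_mono K co) auto
    also have "\<dots> = (c * norm x)\<^sup>2"
      unfolding power_mult_distrib c(3) using Kd by (simp add: field_simps power2_eq_square)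
    finally show "(norm (x - (d / K\<^sup>2) *\<^sub>R A x))\<^sup>2 \<le> (c * norm x)\<^sup>2" .
  qed (use c in auto)
  show ?thesis
    unfolding surj_def
  proof
    fix y :: 'a
    define f where "f x = x - (d / K\<^sup>2) *\<^sub>R (A x - y)" for x
    have "dist (f x) (f z) \<le> c * dist x z" for x z
      using contr[of "x - z"] by (simp add: f_def dist_norm A.diff algebra_simps)
    then obtain x where "f x = x" using banach_fix_type[OF c(1,2), of f] by blast
    then have "A x = y" using d Kd by (auto simp: f_def)
    then show "\<exists>x. y = A x" by blast
  qed
qed

text \<open>A minimising sequence for the distance from \<open>f\<close> to \<open>V\<close> is
  Cauchy by the parallelogram law, and \<open>f\<close> minus its limit is the vector
  \<open>z\<close>.\<close>

lemma nondense_subspace_orthogonal: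
  fixes V :: "'a::{real_inner, complete_space} set"
  assumes V: "subspace V" and f: "f \<notin> closure V"
  obtains z where "z \<noteq> 0" "\<And>v. v \<in> V \<Longrightarrow> z \<bullet> v = 0"
proof -
  define D where "D = (INF v\<in>V. (norm (f - v))\<^sup>2)"
  have V0: "V \<noteq> {}" using subspace_0[OF V] by auto
  have D_le: "D \<le> (norm (f - v))\<^sup>2" if "v \<in> V" for v
    unfolding D_def by (rule cINF_lower) (use that in \<open>auto intro!: bdd_belowI2[where m = 0]\<close>)
  have "\<exists>v\<in>V. (norm (f - v))\<^sup>2 < D + 1 / real (Suc n)" for n
    using cINF_less_iff[OF V0, of "\<lambda>v. (norm (f - v))\<^sup>2" "D + 1 / real (Suc n)"]
    unfolding D_def[symmetric] by (metis bdd_belowI2 less_add_same_cancel1 of_nat_0_less_iff zero_le_power2 zero_less_Suc zero_less_divide_1_iff)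
  then obtain w where wV: "w n \<in> V" and w: "(norm (f - w n))\<^sup>2 < D + 1 / real (Suc n)" for n
    unfolding Bex_def by metis
  \<comment> \<open>Parallelogram law for f - w m and f - w n, where the midpoint of w m and w n has
    squared distance at least \<open>D\<close> from \<open>f\<close>.\<close>
  have close: "(norm (w m - w n))\<^sup>2 \<le> 2 / real (Suc m) + 2 / real (Suc n)" for m n
  proof -
    have "(1/2) *\<^sub>R (w m + w n) \<in> V" by (intro subspace_scale[OF V] subspace_add[OF V] wV)
    from D_le[OF this] have "4 * D \<le> 4 * (norm (f - (1/2) *\<^sub>R (w m + w n)))\<^sup>2" by simp
    moreover have "(norm (w m - w n))\<^sup>2 = 2 * (norm (f - w m))\<^sup>2 + 2 * (norm (f - w n))\<^sup>2
        - 4 * (norm (f - (1/2) *\<^sub>R (w m + w n)))\<^sup>2"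
      by (simp add: power2_norm_eq_inner inner_simps inner_commute algebra_simps)
    moreover have "2 / real (Suc k) = 2 * (1 / real (Suc k))" for k by simp
    ultimately show ?thesis using w[of m] w[of n] by linarith
  qed
  have "Cauchy w"
  proof (rule metric_CauchyI)
    fix e :: real assume e: "e > 0"
    obtain N where N: "4 / e\<^sup>2 < real (Suc N)"
      using reals_Archimedean2[of "4 / e\<^sup>2"] by (meson less_trans of_nat_less_iff lessI)
    have "dist (w m) (w n) < e" if mn: "m \<ge> N" "n \<ge> N" for m n
    proof (rule power2_less_imp_less)
      have "(norm (w m - w n))\<^sup>2 \<le> 2 / real (Suc m) + 2 / real (Suc n)" by (rule close)
      also have "\<dots> \<le> 2 / real (Suc N) + 2 / real (Suc N)"
        using mn by (intro add_mono divide_left_mono) auto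
      also have "\<dots> = 4 / real (Suc N)" by (metis add_divide_distrib numeral_Bit0)
      also have "\<dots> < e\<^sup>2" using N e by (simp add: field_simps)
      finally show "(dist (w m) (w n))\<^sup>2 < e\<^sup>2" by (simp add: dist_norm)
    qed (use e in simp)
    then show "\<exists>M. \<forall>m\<ge>M. \<forall>n\<ge>M. dist (w m) (w n) < e" by blast
  qed
  then obtain y where y: "w \<longlonglongrightarrow> y" using Cauchy_convergent convergentD by blast
  have "(\<lambda>n. (norm (f - w n))\<^sup>2) \<longlonglongrightarrow> (norm (f - y))\<^sup>2" by (intro tendsto_intros y)
  moreover have "(\<lambda>n. D + 1 / real (Suc n)) \<longlonglongrightarrow> D + 0"
    by (intro tendsto_add tendsto_const) (use LIMSEQ_inverse_real_of_nat in \<open>simp only: inverse_eq_divide\<close>)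
  ultimately have "(norm (f - y))\<^sup>2 \<le> D + 0"
    by (rule LIMSEQ_le) (intro exI[of _ 0] allI impI less_imp_le w)
  then have fy: "(norm (f - y))\<^sup>2 \<le> D" by simp
  have "y \<in> closure V" using y wV by (auto simp: closure_sequential)
  then have "f - y \<noteq> 0" using f by auto
  moreover have "(f - y) \<bullet> v = 0" if v: "v \<in> V" for v
  proof (cases "v = 0")
    case False
    \<comment> \<open>This \<open>t\<close> minimises the squared distance from \<open>f\<close> to
      y + t v; a nonzero inner product would push it below \<open>D\<close>.\<close>
    define t where "t = ((f - y) \<bullet> v) / (v \<bullet> v)"
    have "(\<lambda>n. (norm (f - (w n + t *\<^sub>R v)))\<^sup>2) \<longlonglongrightarrow> (norm (f - (y + t *\<^sub>R v)))\<^sup>2"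
      by (intro tendsto_intros y)
    then have "D \<le> (norm (f - (y + t *\<^sub>R v)))\<^sup>2"
      by (rule LIMSEQ_le_const) (auto intro!: exI[of _ 0] D_le subspace_add[OF V] subspace_scale[OF V] wV v)
    also have "\<dots> = (norm (f - y))\<^sup>2 - 2 * t * ((f - y) \<bullet> v) + t * (t * (v \<bullet> v))"
      using norm_diff_scaleR_sq[of "f - y" t v]
      by (simp add: power2_eq_square inner_commute diff_diff_eq flip: power2_norm_eq_inner)
    also have "t * (v \<bullet> v) = (f - y) \<bullet> v" using False by (simp add: t_def)
    finally have "t * ((f - y) \<bullet> v) \<le> 0" using fy by simp
    then have "t * ((f - y) \<bullet> v) * (v \<bullet> v) \<le> 0" by (rule mult_nonpos_nonneg) simp
    then have "((f - y) \<bullet> v)\<^sup>2 \<le> 0" using False by (simp add: t_def power2_eq_square)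
    then show ?thesis by simp
  qed simp
  ultimately show thesis using that by blast
qed

section \<open>Decaying solutions of real three-term recurrences\<close>

text \<open>Because of the limit 0, a negative value would give a negative global minimum at some m
  \<ge> 1. There the second difference is nonnegative, while the equation makes \<open>P m\<close>
  times it negative.\<close>

lemma minimum_principle:
  fixes u P :: "nat \<Rightarrow> real"
  assumes eq: "\<And>n. n \<ge> 1 \<Longrightarrow> P n * (u (Suc n) + u (n - 1) - 2 * u n) = 2 * u n"
    and P: "\<And>n. n \<ge> 1 \<Longrightarrow> 0 \<le> P n" and lim: "u \<longlonglongrightarrow> 0" and u0: "0 \<le> u 0"
  shows "0 \<le> u n"
proof (rule ccontr)
  assume neg: "\<not> 0 \<le> u n"
  then have "\<forall>\<^sub>F k in sequentially. u n < u k" using lim by (intro order_tendstoD) auto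
  then obtain N where N: "\<And>k. k \<ge> N \<Longrightarrow> u n < u k" by (auto simp: eventually_sequentially)
  define m where "m = arg_min_on u {..N}"
  have m: "m \<le> N" "\<And>k. k \<le> N \<Longrightarrow> u m \<le> u k"
    using arg_min_if_finite(1)[of "{..N}" u] arg_min_least[of "{..N}" _ u] by (auto simp: m_def)
  have "n \<le> N" using N[of n] by (meson less_irrefl linear)
  then have um: "u m \<le> u n" using m by blast
  have mmin: "u m \<le> u k" for k
    using m(2)[of k] N[of k] um by (cases "k \<le> N") auto
  have "m \<ge> 1" using um neg u0 by (cases m) auto
  have "0 \<le> P m * (u (Suc m) + u (m - 1) - 2 * u m)"
    using P[OF \<open>m \<ge> 1\<close>] mmin[of "Suc m"] mmin[of "m - 1"] by (intro mult_nonneg_nonneg) auto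
  then show False using eq[OF \<open>m \<ge> 1\<close>] um neg by simp
qed

lemma minimum_principle_zero:
  fixes u P :: "nat \<Rightarrow> real"
  assumes eq: "\<And>n. n \<ge> 1 \<Longrightarrow> P n * (u (Suc n) + u (n - 1) - 2 * u n) = 2 * u n"
    and P: "\<And>n. n \<ge> 1 \<Longrightarrow> 0 \<le> P n" and lim: "u \<longlonglongrightarrow> 0" and u0: "u 0 = 0"
  shows "u n = 0"
proof -
  have "0 \<le> u n" by (rule minimum_principle[OF eq P lim]) (use u0 in auto)
  moreover have "0 \<le> - u n"
  proof (rule minimum_principle[where u = "\<lambda>n. - u n", OF _ P])
    show "P n * (- u (Suc n) + - u (n - 1) - 2 * - u n) = 2 * - u n" if "n \<ge> 1" for n
      using eq[OF that] by (simp add: algebra_simps)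
    show "(\<lambda>n. - u n) \<longlonglongrightarrow> 0" using tendsto_minus[OF lim] by simp
  qed (use u0 in auto)
  ultimately show ?thesis by simp
qed

(* The comparison solution 1/x solves the recurrence with s = 1. *)
lemma comparison_with_reciprocal:
  fixes u :: "nat \<Rightarrow> real" and X s2 :: real
  defines "P \<equiv> \<lambda>n. (X + real n - 1)\<^sup>2 - s2"
  assumes X: "0 < X" "X < 1" and s: "s2 < 1" "X\<^sup>2 < s2"
    and eq: "\<And>n. n \<ge> 1 \<Longrightarrow> P n * (u (Suc n) + u (n - 1) - 2 * u n) = 2 * u n"
    and lim: "u \<longlonglongrightarrow> 0" and u1: "0 < u 1"
  shows "u 1 * X < u 0 * (X - 1)"
proof -
  have P: "0 < P n" "(X + real n - 1)\<^sup>2 - 1 < P n" "0 < (X + real n - 1)\<^sup>2 - 1" if "n \<ge> 2" for n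
  proof -
    have "1 < X + real n - 1" using that X by simp
    then have "1 < (X + real n - 1)\<^sup>2" by (simp add: one_less_power)
    then show "0 < P n" "(X + real n - 1)\<^sup>2 - 1 < P n" "0 < (X + real n - 1)\<^sup>2 - 1"
      using s by (auto simp: P_def)
  qed
  have u_nonneg: "0 \<le> u (Suc n)" for n
  proof (rule minimum_principle[where u = "\<lambda>n. u (Suc n)" and P = "\<lambda>n. P (Suc n)"])
    show "P (Suc n) * (u (Suc (Suc n)) + u (Suc (n - 1)) - 2 * u (Suc n)) = 2 * u (Suc n)" if "n \<ge> 1" for n
      using eq[of "Suc n"] that by simp
    show "0 \<le> P (Suc n)" if "n \<ge> 1" for n using P(1)[of "Suc n"] that by simp
    show "(\<lambda>n. u (Suc n)) \<longlonglongrightarrow> 0" using lim by (rule LIMSEQ_Suc)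
  qed (use u1 in simp)
  \<comment> \<open>\<open>g n\<close> is 1/x at x = X + n, the position of index n + 1.
    \<open>W\<close> is the Casoratian (discrete Wronskian) of \<open>u\<close> and this solution.
    It decreases because \<open>P\<close> exceeds x^2 - 1, and it tends to 0, so it is
    nonnegative.\<close>
  define g where "g n = 1 / (X + real n)" for n
  define W where "W n = u (n + 2) * g n - u (n + 1) * g (Suc n)" for n
  have W_step: "W (Suc n) \<le> W n" for n
  proof -
    define y where "y = X + real n + 1"
    have y: "1 < y" using X by (simp add: y_def)
    have gs: "g n = 1 / (y - 1)" "g (Suc n) = 1 / y" "g (Suc (Suc n)) = 1 / (y + 1)"
      by (simp_all add: g_def y_def algebra_simps)
    have Pn: "P (n + 2) = y\<^sup>2 - s2" by (simp add: P_def y_def algebra_simps)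
    have y1: "0 < y\<^sup>2 - 1" "0 < P (n + 2)" "y\<^sup>2 - 1 < P (n + 2)"
      unfolding Pn using one_less_power[OF y, of 2] s by simp_all
    define v where "v = u (n + 2)"
    have v: "0 \<le> v" using u_nonneg[of "n + 1"] by (simp add: v_def)
    have rec: "u (n + 3) + u (n + 1) = 2 * v + 2 * v / P (n + 2)"
      using eq[of "n + 2"] y1 by (simp add: v_def field_simps eval_nat_numeral)
    have "W (Suc n) - W n = (u (n + 3) + u (n + 1)) * g (Suc n) - v * (g n + g (Suc (Suc n)))"
      by (simp add: W_def v_def algebra_simps eval_nat_numeral)
    also have "g n + g (Suc (Suc n)) = (2 + 2 / (y\<^sup>2 - 1)) * g (Suc n)"
      using y y1 by (simp add: gs field_simps power2_eq_square)
    also have "(u (n + 3) + u (n + 1)) * g (Suc n) - v * ((2 + 2 / (y\<^sup>2 - 1)) * g (Suc n))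
        = 2 * v * g (Suc n) * (1 / P (n + 2) - 1 / (y\<^sup>2 - 1))"
      unfolding rec by (simp add: algebra_simps)
    also have "\<dots> \<le> 0"
      using v y y1 by (intro mult_nonneg_nonpos) (auto simp: gs intro: divide_left_mono)
    finally show ?thesis by simp
  qed
  have "(\<lambda>n. W n) \<longlonglongrightarrow> 0 * 0 - 0 * 0"
  proof -
    have "filterlim (\<lambda>n. X + real n) at_top sequentially"
      by (intro filterlim_tendsto_add_at_top[OF tendsto_const] filterlim_real_sequentially)
    then have "g \<longlonglongrightarrow> 0"
      unfolding g_def by (intro tendsto_divide_0[OF tendsto_const] filterlim_at_top_imp_at_infinity)
    from this LIMSEQ_Suc[OF this] show ?thesis unfolding W_def
      by (intro tendsto_diff tendsto_mult LIMSEQ_ignore_initial_segment[OF lim])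
  qed
  then have "0 \<le> W 0"
    using decseq_ge[of W 0] W_step by (simp add: decseq_SucI)
  then have "u 1 / (X + 1) \<le> u 2 / X" by (simp add: W_def g_def eval_nat_numeral)
  then have u2: "u 1 * X \<le> u 2 * (X + 1)" using X by (simp add: field_simps)
  \<comment> \<open>The step back through index 1, where the coefficient is negative and larger than
    X^2 - 1, makes the comparison with the values 1/X and 1/(X - 1) strict.\<close>
  have P1: "P 1 = X\<^sup>2 - s2" by (simp add: P_def)
  have XX: "X\<^sup>2 - 1 < X\<^sup>2 - s2" "X\<^sup>2 - s2 < 0" using s by auto
  have "u 2 + u 0 = 2 * u 1 + 2 * u 1 / (X\<^sup>2 - s2)"
    using eq[of 1] XX unfolding P1 by (simp add: field_simps eval_nat_numeral)
  also have "\<dots> < 2 * u 1 + 2 * u 1 / (X\<^sup>2 - 1)"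
    using u1 XX by (intro add_strict_left_mono) (simp add: field_simps)
  also have "\<dots> = u 1 * X * (2 * X) / (X\<^sup>2 - 1)" using XX by (simp add: field_simps power2_eq_square)
  finally have u0: "u 2 + u 0 < u 1 * X * (2 * X) / (X\<^sup>2 - 1)" .
  have "u 1 * X / (X + 1) \<le> u 2" using u2 X by (simp add: field_simps)
  then have "u 0 < u 1 * X * (2 * X) / (X\<^sup>2 - 1) - u 1 * X / (X + 1)" using u0 by simp
  also have "\<dots> = u 1 * X / (X - 1)"
  proof -
    have "X\<^sup>2 - 1 = (X - 1) * (X + 1)" by (simp add: power2_eq_square algebra_simps)
    moreover have "c * (2 * X) / ((X - 1) * (X + 1)) - c / (X + 1) = c / (X - 1)" for c
      using X by (simp add: divide_simps) (simp add: algebra_simps)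
    ultimately show ?thesis by metis
  qed
  finally show ?thesis using X by (simp add: field_simps)
qed

text \<open>Convergence to 0 along the cofinite filter. In this form it passes at once to every
  injective reindexing, be it a translation, a reflection or a half line.\<close>

definition decaying :: "('i \<Rightarrow> real) \<Rightarrow> bool" where
  "decaying u \<longleftrightarrow> (\<forall>e>0. finite {n. e \<le> \<bar>u n\<bar>})"

lemma decaying_reindex: "decaying u \<Longrightarrow> inj f \<Longrightarrow> decaying (\<lambda>n. u (f n))"
  unfolding decaying_def using finite_vimageI[of "{n. e \<le> \<bar>u n\<bar>}" f for e]
  by (auto simp: vimage_def)

lemma decaying_mono:
  assumes "decaying u" "\<And>n. \<bar>v n\<bar> \<le> \<bar>u n\<bar>"
  shows "decaying v"
  unfolding decaying_def
proof (intro allI impI)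
  fix e :: real assume "e > 0"
  then have "finite {n. e \<le> \<bar>u n\<bar>}" using assms(1) by (simp add: decaying_def)
  then show "finite {n. e \<le> \<bar>v n\<bar>}"
    by (rule finite_subset[rotated]) (use assms(2) order_trans in blast)
qed

lemma decaying_tendsto: "decaying u \<Longrightarrow> u \<longlonglongrightarrow> 0"
proof (rule tendstoI)
  fix e :: real assume "decaying u" "e > 0"
  then have "finite {n. e \<le> \<bar>u n\<bar>}" by (simp add: decaying_def)
  then show "\<forall>\<^sub>F n in sequentially. dist (u n) 0 < e"
    by (simp add: eventually_cofinite cofinite_eq_sequentially[symmetric] not_less)
qed

lemma inj_int_affine: "inj (\<lambda>n. n + j)" "inj (\<lambda>n. j - n)" "inj (\<lambda>k. j + int k)" "inj (\<lambda>k. j - int k)" for j :: int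
  by (auto simp: inj_def)

text \<open>Decay in both directions replaces the boundary value: a negative value leaves only the
  finite set \<open>F\<close> as candidates for the minimum.\<close>

lemma minimum_principle_int:
  fixes u P :: "int \<Rightarrow> real"
  assumes eq: "\<And>n. P n * (u (n + 1) + u (n - 1) - 2 * u n) = 2 * u n"
    and P: "\<And>n. 0 \<le> P n" and dec: "decaying u"
  shows "0 \<le> u n"
proof (rule ccontr)
  assume neg: "\<not> 0 \<le> u n"
  define F where "F = {k. - u n \<le> \<bar>u k\<bar>}"
  have "finite F" "n \<in> F" using dec neg by (auto simp: F_def decaying_def)
  define m where "m = arg_min_on u F"
  have m: "m \<in> F" "\<And>k. k \<in> F \<Longrightarrow> u m \<le> u k"
    using arg_min_if_finite(1)[of F u] arg_min_least[of F _ u] \<open>finite F\<close> \<open>n \<in> F\<close> by (auto simp: m_def)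
  have um: "u m \<le> u n" using m \<open>n \<in> F\<close> by blast
  have mmin: "u m \<le> u k" for k
    using m(2)[of k] um neg by (cases "k \<in> F") (auto simp: F_def)
  have "0 \<le> P m * (u (m + 1) + u (m - 1) - 2 * u m)"
    using P[of m] mmin[of "m + 1"] mmin[of "m - 1"] by (intro mult_nonneg_nonneg) auto
  then show False using eq[of m] um neg by simp
qed

lemma le_square_of_one_le: "s < 1 \<Longrightarrow> 1 \<le> \<bar>x\<bar> \<Longrightarrow> s \<le> x\<^sup>2" for s x :: real
  using power_mono[of 1 "\<bar>x\<bar>" 2] by simp

text \<open>The equation for u = \<rho> w at the ends of the segment, up to alternating signs at one
  of them. The offset \<open>c\<close> stays a parameter because translations and reflections of the
  index change it.\<close>

definition endpoint_solution :: "real \<Rightarrow> real \<Rightarrow> (int \<Rightarrow> real) \<Rightarrow> bool" where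
  "endpoint_solution s2 c u \<longleftrightarrow> decaying u \<and>
     (\<forall>n. ((real_of_int n + c)\<^sup>2 - s2) * (u (n + 1) + u (n - 1) - 2 * u n) = 2 * u n)"

lemma endpoint_solution_uminus: "endpoint_solution s2 c u \<Longrightarrow> endpoint_solution s2 c (\<lambda>n. - u n)"
  by (auto simp: endpoint_solution_def decaying_def algebra_simps)

lemma endpoint_solution_shift: "endpoint_solution s2 c u \<Longrightarrow> endpoint_solution s2 (c + real_of_int j) (\<lambda>n. u (n + j))"
  unfolding endpoint_solution_def
proof (intro conjI allI)
  fix n assume *: "decaying u \<and> (\<forall>n. ((real_of_int n + c)\<^sup>2 - s2) * (u (n + 1) + u (n - 1) - 2 * u n) = 2 * u n)"
  show "((real_of_int n + (c + real_of_int j))\<^sup>2 - s2) * (u (n + 1 + j) + u (n - 1 + j) - 2 * u (n + j)) = 2 * u (n + j)"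
    using conjunct2[OF *, rule_format, of "n + j"] by (simp add: algebra_simps)
qed (auto intro!: decaying_reindex[of u] inj_int_affine)

lemma endpoint_solution_reflect: "endpoint_solution s2 c u \<Longrightarrow> endpoint_solution s2 (- c - real_of_int j) (\<lambda>n. u (j - n))"
  unfolding endpoint_solution_def
proof (intro conjI allI)
  fix n assume *: "decaying u \<and> (\<forall>n. ((real_of_int n + c)\<^sup>2 - s2) * (u (n + 1) + u (n - 1) - 2 * u n) = 2 * u n)"
  have "(real_of_int n + (- c - real_of_int j))\<^sup>2 = (real_of_int (j - n) + c)\<^sup>2"
    by (simp add: power2_eq_square algebra_simps)
  then show "((real_of_int n + (- c - real_of_int j))\<^sup>2 - s2) * (u (j - (n + 1)) + u (j - (n - 1)) - 2 * u (j - n)) = 2 * u (j - n)"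
    using conjunct2[OF *, rule_format, of "j - n"] by (simp add: algebra_simps)
qed (auto intro!: decaying_reindex[of u] inj_int_affine)

lemma endpoint_half_line:
  assumes u: "endpoint_solution s2 c u"
    and P: "\<And>n. n > j \<Longrightarrow> s2 \<le> (real_of_int n + c)\<^sup>2" and n: "j \<le> n"
  shows "0 \<le> u j \<Longrightarrow> 0 \<le> u n" and "u j = 0 \<Longrightarrow> u n = 0"
proof -
  define v where "v k = u (j + int k)" for k
  define P where "P k = (real_of_int (j + int k) + c)\<^sup>2 - s2" for k
  have eq: "P k * (v (Suc k) + v (k - 1) - 2 * v k) = 2 * v k" if "k \<ge> 1" for k
  proof -
    have "int (k - 1) = int k - 1" using that by simp
    then show ?thesis
      using u[unfolded endpoint_solution_def, THEN conjunct2, rule_format, of "j + int k"]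
      by (simp add: v_def P_def algebra_simps)
  qed
  have P: "0 \<le> P k" if "k \<ge> 1" for k using P[of "j + int k"] that by (simp add: P_def)
  have lim: "v \<longlonglongrightarrow> 0"
    unfolding v_def using u decaying_tendsto decaying_reindex inj_int_affine(3)
    unfolding endpoint_solution_def by blast
  have vn: "v (nat (n - j)) = u n" "v 0 = u j" using n by (simp_all add: v_def)
  show "0 \<le> u j \<Longrightarrow> 0 \<le> u n"
    using minimum_principle[of P v "nat (n - j)", OF eq P lim] vn by simp
  show "u j = 0 \<Longrightarrow> u n = 0"
    using minimum_principle_zero[of P v "nat (n - j)", OF eq P lim] vn by simp
qed

lemma endpoint_half_line_left:
  assumes u: "endpoint_solution s2 c u"
    and P: "\<And>n. n < j \<Longrightarrow> s2 \<le> (real_of_int n + c)\<^sup>2" and n: "n \<le> j"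
  shows "0 \<le> u j \<Longrightarrow> 0 \<le> u n" and "u j = 0 \<Longrightarrow> u n = 0"
proof -
  have *: "s2 \<le> (real_of_int k + - c)\<^sup>2" if "- j < k" for k
  proof -
    have "(real_of_int (- k) + c)\<^sup>2 = (real_of_int k + - c)\<^sup>2" by (simp add: power2_eq_square algebra_simps)
    then show ?thesis using P[of "- k"] that by simp
  qed
  have v: "endpoint_solution s2 (- c) (\<lambda>n. u (- n))" using endpoint_solution_reflect[OF u, of 0] by simp
  note endpoint_half_line[OF v, of "- j" "- n", OF *]
  then show "0 \<le> u j \<Longrightarrow> 0 \<le> u n" and "u j = 0 \<Longrightarrow> u n = 0" using n by auto
qed

text \<open>In absolute value 1/x is 1/(-c) at index 0 and 1/(c + 1) at index 1, and the comparison
  puts the ratio of |u 1| to |u 0| strictly below that of 1/x. The mirror image gives the opposite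
  inequality, so applying it from both sides excludes a nonzero solution.\<close>

lemma endpoint_two_negative:
  assumes u: "endpoint_solution s2 c u" and s: "s2 < 1" and c: "- 1 < c" "c < 0" "(c + 1)\<^sup>2 < s2"
  shows "u 1 \<noteq> 0 \<Longrightarrow> \<bar>u 1\<bar> * (c + 1) < \<bar>u 0\<bar> * (- c)" and "u 1 = 0 \<Longrightarrow> u 0 = 0"
proof -
  have pos: "\<bar>v 1\<bar> * (c + 1) < \<bar>v 0\<bar> * (- c)" if v: "endpoint_solution s2 c v" and v1: "0 < v 1" for v
  proof -
    have "v 1 * (c + 1) < v 0 * (c + 1 - 1)"
    proof (rule comparison_with_reciprocal[of _ s2 "\<lambda>k. v (int k)", unfolded of_nat_0 of_nat_1])
      show "((c + 1 + real k - 1)\<^sup>2 - s2) * (v (int (Suc k)) + v (int (k - 1)) - 2 * v (int k)) = 2 * v (int k)" if "k \<ge> 1" for k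
      proof -
        have "int (k - 1) = int k - 1" using that by simp
        then show ?thesis
          using v[unfolded endpoint_solution_def, THEN conjunct2, rule_format, of "int k"] by (simp add: algebra_simps)
      qed
      show "(\<lambda>k. v (int k)) \<longlonglongrightarrow> 0"
        using v decaying_tendsto decaying_reindex[OF _ inj_int_affine(3)[of 0], of v]
        unfolding endpoint_solution_def by simp
    qed (use s c v1 in auto)
    also have "v 0 * (c + 1 - 1) \<le> \<bar>v 0\<bar> * (- c)"
      using c mult_right_mono[of "- v 0" "\<bar>v 0\<bar>" "- c"] by simp
    finally show ?thesis using v1 by simp
  qed
  show "\<bar>u 1\<bar> * (c + 1) < \<bar>u 0\<bar> * (- c)" if "u 1 \<noteq> 0"
    using pos[OF u] pos[OF endpoint_solution_uminus[OF u]] that by (cases "u 1 > 0") auto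
  show "u 0 = 0" if u1: "u 1 = 0"
  proof -
    have "s2 \<le> (real_of_int n + c)\<^sup>2" if "n > 1" for n
    proof (rule le_square_of_one_le[OF s])
      have "2 \<le> real_of_int n" using that by simp
      then show "1 \<le> \<bar>real_of_int n + c\<bar>" using c by linarith
    qed
    then have "u 2 = 0" using endpoint_half_line(2)[OF u, of 1 2] u1 by simp
    then have "((1 + c)\<^sup>2 - s2) * u 0 = 0"
      using u[unfolded endpoint_solution_def, THEN conjunct2, rule_format, of 1] u1 by simp
    then show ?thesis using c by (simp add: add.commute)
  qed
qed

text \<open>A negative coefficient forces |n + c| < 1, so there are none, one or two of them, and
  two are adjacent. Once \<open>u\<close> is 0 at these places, the half lines on both sides follow
  by the minimum principle.\<close>

lemma endpoint_solution_eq_0: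
  assumes u: "endpoint_solution s2 c u" and s: "s2 < 1"
  shows "u n = 0"
proof (cases "\<exists>j. (real_of_int j + c)\<^sup>2 < s2")
  case False
  then have P: "0 \<le> (real_of_int n + c)\<^sup>2 - s2" for n by (simp add: not_less)
  have "0 \<le> v n" if "endpoint_solution s2 c v" for v n
    by (rule minimum_principle_int[where P = "\<lambda>n. (real_of_int n + c)\<^sup>2 - s2", OF _ P])
       (use that in \<open>auto simp: endpoint_solution_def\<close>)
  from this[OF u, of n] this[OF endpoint_solution_uminus[OF u], of n] show ?thesis by simp
next
  case True
  have small: "- 1 < real_of_int j + c \<and> real_of_int j + c < 1" if "(real_of_int j + c)\<^sup>2 < s2" for j
    using that s abs_square_less_1[of "real_of_int j + c"] by auto
  \<comment> \<open>\<open>j\<close> is the leftmost place with a negative coefficient; it is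
    translated to 0.\<close>
  obtain j where j: "(real_of_int j + c)\<^sup>2 < s2" "\<not> (real_of_int (j - 1) + c)\<^sup>2 < s2"
  proof -
    obtain i where i: "(real_of_int i + c)\<^sup>2 < s2" using True by blast
    show thesis
    proof (cases "(real_of_int (i - 1) + c)\<^sup>2 < s2")
      case True
      have "\<not> (real_of_int (i - 1 - 1) + c)\<^sup>2 < s2" using small[of "i - 1 - 1"] small[OF i] by auto
      with True that show thesis by blast
    qed (use i that in blast)
  qed
  define d where "d = c + real_of_int j"
  define v where "v n = u (n + j)" for n
  have v: "endpoint_solution s2 d v" unfolding d_def v_def by (rule endpoint_solution_shift[OF u])
  have d: "d\<^sup>2 < s2" "- 1 < d" "d < 1" using j small[of j] by (auto simp: d_def add.commute)
  have left: "s2 \<le> (real_of_int n + d)\<^sup>2" if "n < 0" for n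
  proof (cases "n = - 1")
    case True then show ?thesis using j(2) by (simp add: d_def algebra_simps)
  next
    case False
    then have "real_of_int n \<le> - 2" using that by simp
    then show ?thesis using d by (intro le_square_of_one_le[OF s]) linarith
  qed
  have right: "s2 \<le> (real_of_int n + d)\<^sup>2" if "n > 1" for n
  proof -
    have "real_of_int n \<ge> 2" using that by simp
    then show ?thesis using d by (intro le_square_of_one_le[OF s]) linarith
  qed
  have v0: "v 0 = 0 \<and> v 1 = 0"
  proof (cases "(1 + d)\<^sup>2 < s2")
    case True
    then have d0: "d < 0" using small[of "1 + j"] by (simp add: d_def algebra_simps)
    define w where "w n = v (1 - n)" for n
    have w: "endpoint_solution s2 (- d - 1) w" unfolding w_def using endpoint_solution_reflect[OF v, of 1] by simp
    have "(- d - 1 + 1)\<^sup>2 < s2" using d by simp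
    note 1 = endpoint_two_negative[OF v s] and 2 = endpoint_two_negative[OF w s _ _ this]
    show ?thesis
    \<comment> \<open>The estimate for \<open>v\<close> and the one for its mirror image
      \<open>w\<close> are opposite strict inequalities.\<close>
    proof (rule ccontr)
      assume "\<not> ?thesis"
      then have "v 1 \<noteq> 0" "v 0 \<noteq> 0" using 1(2) 2(2) d d0 True by (auto simp: w_def add.commute)
      then show False using 1(1) 2(1) d d0 True by (auto simp: w_def add.commute)
    qed
  next
    case False
    then have right: "s2 \<le> (real_of_int n + d)\<^sup>2" if "n > 0" for n
      using right[of n] that by (cases "n = 1") auto
    have "z 0 \<le> 0" if z: "endpoint_solution s2 d z" for z
    proof (rule ccontr)
      assume "\<not> z 0 \<le> 0"
      then have "0 < z 0" "0 \<le> z 1" "0 \<le> z (- 1)"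
        using endpoint_half_line(1)[OF z, of 0 1] right endpoint_half_line_left(1)[OF z, of 0 "- 1"] left by auto
      \<comment> \<open>With a single negative coefficient the equation at 0 reads (d^2 - s2) (z 1 +
        z (-1)) = 2 (1 + d^2 - s2) z 0, where the left side is at most 0 and the right side is
        positive.\<close>
      then have "(d\<^sup>2 - s2) * (z 1 + z (- 1)) \<le> 0" "0 < z 0 * (1 + (d\<^sup>2 - s2))"
        using d(1) s zero_le_power2[of d] by (intro mult_nonpos_nonneg mult_pos_pos; linarith)+
      then show False
        using z[unfolded endpoint_solution_def, THEN conjunct2, rule_format, of 0] by (simp add: algebra_simps)
    qed
    from this[OF v] this[OF endpoint_solution_uminus[OF v]] have "v 0 = 0" by simp
    then show ?thesis using endpoint_half_line(2)[OF v, of 0 1] right by simp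
  qed
  have "v (n - j) = 0"
    using endpoint_half_line(2)[OF v, of 1 "n - j"] right endpoint_half_line_left(2)[OF v, of 0 "n - j"] left v0
    by (cases "n - j \<ge> 1") auto
  then show ?thesis by (simp add: v_def)
qed

text \<open>\<open>E\<close> is the quadratic form that the unperturbed recurrence conserves,
  positive definite because |c| < 2. The perturbation shrinks it by factors whose product converges,
  so \<open>F\<close>, which compensates for them, increases to the limit 0, and \<open>E\<close>
  cannot be positive.\<close>

lemma perturbed_oscillation_eventually_0:
  fixes u e :: "nat \<Rightarrow> real"
  assumes c: "\<bar>c\<bar> < 2" and e: "summable (\<lambda>n. \<bar>e n\<bar>)" and lim: "u \<longlonglongrightarrow> 0"
    and eq: "\<And>n. n \<ge> N \<Longrightarrow> u (Suc (Suc n)) + u n = (c + e n) * u (Suc n)"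
  shows "\<exists>M. \<forall>n\<ge>M. u n = 0"
proof -
  define E where "E n = (u n)\<^sup>2 + (u (Suc n))\<^sup>2 - c * u n * u (Suc n)" for n
  define K where "K = 1 / (1 - \<bar>c\<bar> / 2)"
  have K: "K > 0" using c by (simp add: K_def)
  have E: "(u n)\<^sup>2 + (u (Suc n))\<^sup>2 \<le> K * E n" for n
  proof -
    have "c * u n * u (Suc n) \<le> \<bar>c\<bar> * (\<bar>u n\<bar> * \<bar>u (Suc n)\<bar>)"
      by (metis abs_ge_self abs_mult mult.assoc)
    also have "\<dots> \<le> \<bar>c\<bar> * (((u n)\<^sup>2 + (u (Suc n))\<^sup>2) / 2)"
      using sum_squares_bound[of "\<bar>u n\<bar>" "\<bar>u (Suc n)\<bar>"] by (intro mult_left_mono) auto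
    finally have "(1 - \<bar>c\<bar> / 2) * ((u n)\<^sup>2 + (u (Suc n))\<^sup>2) \<le> E n"
      by (simp add: E_def algebra_simps)
    then show ?thesis using c by (simp add: K_def field_simps)
  qed
  have E0: "0 \<le> E n" for n using E[of n] K by (metis add_nonneg_nonneg order_trans zero_le_mult_iff zero_le_power2 less_le_not_le)
  define a where "a n = K * \<bar>e n\<bar>" for n
  have a0: "0 \<le> a n" for n using K by (simp add: a_def)
  have a: "summable a" unfolding a_def by (intro summable_mult e)
  have "\<forall>\<^sub>F n in sequentially. a n < 1 / 2"
    using summable_LIMSEQ_zero[OF a] by (intro order_tendstoD) auto
  then obtain M1 where M1: "\<And>n. n \<ge> M1 \<Longrightarrow> a n < 1 / 2" by (auto simp: eventually_sequentially)
  define M where "M = max N M1"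
  have step: "E n \<le> E (Suc n) * exp (4 * a n)" if n: "n \<ge> M" for n
  proof -
    have "E n - E (Suc n) = - (u (Suc (Suc n)) - u n) * (u (Suc (Suc n)) + u n - c * u (Suc n))"
      by (simp add: E_def power2_eq_square algebra_simps)
    also have "\<dots> = - (u (Suc (Suc n)) - u n) * (e n * u (Suc n))"
      using eq[of n] n by (simp add: M_def algebra_simps)
    also have "\<dots> \<le> \<bar>e n\<bar> * \<bar>u (Suc (Suc n)) * u (Suc n) - u n * u (Suc n)\<bar>"
      by (rule order_trans[OF abs_ge_self]) (simp add: abs_mult[symmetric] algebra_simps abs_minus_commute)
    also have "\<dots> \<le> \<bar>e n\<bar> * (K * (E n + E (Suc n)))"
    proof (rule mult_left_mono)
      have "\<bar>u (Suc (Suc n)) * u (Suc n) - u n * u (Suc n)\<bar>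
          \<le> \<bar>u (Suc (Suc n))\<bar> * \<bar>u (Suc n)\<bar> + \<bar>u n\<bar> * \<bar>u (Suc n)\<bar>"
        by (metis abs_mult abs_triangle_ineq4)
      also have "\<dots> \<le> K * E n + K * E (Suc n)"
        using sum_squares_bound[of "\<bar>u (Suc (Suc n))\<bar>" "\<bar>u (Suc n)\<bar>"]
          sum_squares_bound[of "\<bar>u n\<bar>" "\<bar>u (Suc n)\<bar>"] E[of n] E[of "Suc n"]
          zero_le_power2[of "u n"] zero_le_power2[of "u (Suc n)"] zero_le_power2[of "u (Suc (Suc n))"]
        unfolding mult.assoc power2_abs by linarith
      finally show "\<bar>u (Suc (Suc n)) * u (Suc n) - u n * u (Suc n)\<bar> \<le> K * (E n + E (Suc n))"
        by (simp add: algebra_simps)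
    qed simp
    finally have 1: "E n * (1 - a n) \<le> E (Suc n) * (1 + a n)" by (simp add: a_def algebra_simps)
    \<comment> \<open>The constant 4 suffices for a \<le> 1/2, since (1 - a) (1 + 4 a) = 1 + a + 2 a
      (1 - 2 a).\<close>
    have "1 + a n \<le> (1 - a n) * (1 + 4 * a n)"
      using M1[of n] n a0[of n] mult_left_mono[of "a n" "1/2" "4 * a n"] by (simp add: M_def algebra_simps)
    with 1 have "E n * (1 - a n) \<le> E (Suc n) * ((1 - a n) * (1 + 4 * a n))"
      using E0[of "Suc n"] mult_left_mono order_trans by blast
    then have "(1 - a n) * E n \<le> (1 - a n) * (E (Suc n) * (1 + 4 * a n))" by (simp only: mult_ac)
    moreover have "0 < 1 - a n" using M1[of n] n by (simp add: M_def)
    ultimately have "E n \<le> E (Suc n) * (1 + 4 * a n)" by (rule mult_left_le_imp_le)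
    also have "\<dots> \<le> E (Suc n) * exp (4 * a n)"
      using E0 exp_ge_add_one_self by (intro mult_left_mono) auto
    finally show ?thesis .
  qed
  define F where "F n = E (n + M) * exp (4 * sum a {..<n + M})" for n
  have "incseq F"
    unfolding incseq_Suc_iff
  proof
    fix n
    have "E (n + M) * exp (4 * sum a {..<n + M}) \<le> E (Suc (n + M)) * exp (4 * a (n + M)) * exp (4 * sum a {..<n + M})"
      by (intro mult_right_mono step) auto
    then show "F n \<le> F (Suc n)" by (simp add: F_def exp_add distrib_left mult_ac)
  qed
  moreover have "F \<longlonglongrightarrow> (0\<^sup>2 + 0\<^sup>2 - c * 0 * 0) * exp (4 * suminf a)"
    unfolding F_def E_def
    by (intro tendsto_mult tendsto_exp tendsto_diff tendsto_add tendsto_power tendsto_const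
        LIMSEQ_ignore_initial_segment[OF summable_LIMSEQ[OF a]] LIMSEQ_ignore_initial_segment[OF lim]
        LIMSEQ_ignore_initial_segment[OF LIMSEQ_Suc[OF lim]])
  ultimately have "F n \<le> 0" for n using incseq_le[of F 0 n] by simp
  then have EM: "E (n + M) \<le> 0" for n by (simp add: F_def mult_le_0_iff)
  have "(u (n + M))\<^sup>2 \<le> 0" for n
    using E[of "n + M"] mult_nonneg_nonpos[OF less_imp_le[OF K] EM[of n]] zero_le_power2[of "u (Suc (n + M))"]
    by linarith
  then have "u n = 0" if "n \<ge> M" for n using that le_add_diff_inverse2[of M n] by (metis power2_less_eq_zero_iff)
  then show ?thesis by blast
qed

section \<open>The weights on a lattice line\<close>

text \<open>The absolute values have period 2, so decay makes them 0. Thus S + S^-1 is injective on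
  square summable sequences, as the case \<mu> = 0 and the density of the range require.\<close>

lemma decaying_antiperiodic:
  fixes u :: "int \<Rightarrow> real"
  assumes dec: "decaying u" and step: "\<And>m. \<bar>u (m + 1)\<bar> = \<bar>u (m - 1)\<bar>"
  shows "u n = 0"
proof -
  have "\<bar>u (n + 2 * int k)\<bar> = \<bar>u n\<bar>" for k
  proof (induction k)
    case (Suc k)
    have "n + 2 * int (Suc k) = n + 2 * int k + 1 + 1" by simp
    then show ?case using step[of "n + 2 * int k + 1"] Suc by (simp only:) simp
  qed simp
  moreover have "(\<lambda>k. \<bar>u (n + 2 * int k)\<bar>) \<longlonglongrightarrow> \<bar>0\<bar>"
    by (intro tendsto_rabs decaying_tendsto decaying_reindex[OF dec]) (auto simp: inj_def)
  ultimately show ?thesis by (simp add: LIMSEQ_const_iff)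
qed

text \<open>Completing the square gives |kh + n p|^2 = |p|^2 ((n + c)^2 - s2 + 1), hence this
  formula with r = |p|^(-2). Here 1 - s2 is the squared distance of the line from the origin in
  units of |p|, so s2 < 1 says that the line misses the origin.\<close>

locale line_weights =
  fixes r c s2 :: real and \<rho> :: "int \<Rightarrow> real"
  assumes r: "0 < r" and s2: "s2 < 1"
    and \<rho>: "\<And>n. \<rho> n = - r * ((real_of_int n + c)\<^sup>2 - s2) / ((real_of_int n + c)\<^sup>2 - s2 + 1)"
begin

lemma denominator_pos: "0 < (real_of_int n + c)\<^sup>2 - s2 + 1"
  using s2 zero_le_power2[of "real_of_int n + c"] by linarith

lemma \<rho>_plus_r: "\<rho> n + r = r / ((real_of_int n + c)\<^sup>2 - s2 + 1)"
  using denominator_pos[of n] by (simp add: \<rho> field_simps)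

lemma \<rho>_gt: "- r < \<rho> n"
  using \<rho>_plus_r[of n] denominator_pos[of n] r by (metis add.commute divide_pos_pos less_add_iff1 neg_less_iff_less add.inverse_inverse diff_0 diff_less_eq)

lemma \<rho>_nonneg_iff: "0 \<le> \<rho> n \<longleftrightarrow> (real_of_int n + c)\<^sup>2 \<le> s2"
proof -
  have "0 \<le> \<rho> n \<longleftrightarrow> r \<le> r / ((real_of_int n + c)\<^sup>2 - s2 + 1)"
    unfolding \<rho>_plus_r[symmetric] by simp
  also have "\<dots> \<longleftrightarrow> r * ((real_of_int n + c)\<^sup>2 - s2 + 1) \<le> r * 1"
    using denominator_pos[of n] by (simp add: pos_le_divide_eq)
  also have "\<dots> \<longleftrightarrow> (real_of_int n + c)\<^sup>2 \<le> s2" unfolding mult_le_cancel_left_pos[OF r] by simp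
  finally show ?thesis .
qed

lemma nonneg_weights_adjacent:
  assumes "0 \<le> \<rho> i" "0 \<le> \<rho> j"
  shows "\<bar>i - j\<bar> \<le> 1"
proof -
  have "\<bar>real_of_int k + c\<bar> < 1" if "0 \<le> \<rho> k" for k
    using that s2 abs_square_less_1[of "real_of_int k + c"] by (simp add: \<rho>_nonneg_iff)
  from this[OF assms(1)] this[OF assms(2)] show ?thesis by linarith
qed

lemma \<rho>_plus_r_bound: "\<exists>C>0. \<forall>n. \<rho> n + r \<le> C / ((real_of_int n)\<^sup>2 + 1)"
proof -
  \<comment> \<open>\<open>C\<close> dominates both terms of n^2 + 1 \<le> 2 x^2 + (2 c^2 + 1), the
    constant one being measured in units of 1 - s2.\<close>
  define C where "C = 2 + (2 * c\<^sup>2 + 1) / (1 - s2)"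
  have C: "0 < C" using s2 by (auto simp: C_def intro!: add_pos_nonneg)
  have "\<rho> n + r \<le> r * C / ((real_of_int n)\<^sup>2 + 1)" for n
  proof -
    define x where "x = real_of_int n + c"
    have "(real_of_int n)\<^sup>2 = (x + - c)\<^sup>2" by (simp add: x_def)
    also have "\<dots> \<le> 2 * x\<^sup>2 + 2 * c\<^sup>2" using norm_add_sq_le[of x "- c"] by simp
    finally have "(real_of_int n)\<^sup>2 + 1 \<le> 2 * x\<^sup>2 + (2 * c\<^sup>2 + 1)" by simp
    also have "\<dots> = 2 * x\<^sup>2 + (2 * c\<^sup>2 + 1) / (1 - s2) * (1 - s2)" using s2 by simp
    also have "\<dots> \<le> C * x\<^sup>2 + C * (1 - s2)"
      using s2 by (intro add_mono mult_right_mono) (auto simp: C_def)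
    finally have "(real_of_int n)\<^sup>2 + 1 \<le> C * (x\<^sup>2 - s2 + 1)" by (simp add: algebra_simps)
    then have "r * ((real_of_int n)\<^sup>2 + 1) \<le> r * (C * (x\<^sup>2 - s2 + 1))"
      using r by (intro mult_left_mono) auto
    moreover have "0 < (real_of_int n)\<^sup>2 + 1" by (simp add: add_nonneg_pos)
    ultimately show ?thesis
      using denominator_pos[of n] unfolding \<rho>_plus_r x_def[symmetric]
      by (simp add: divide_le_eq pos_le_divide_eq mult_ac)
  qed
  then show ?thesis using C r by (intro exI[of _ "r * C"]) auto
qed

lemma summable_\<rho>_plus_r: "summable (\<lambda>k::nat. \<rho> (int k) + r)"
proof -
  obtain C where C: "0 < C" "\<And>n. \<rho> n + r \<le> C / ((real_of_int n)\<^sup>2 + 1)" using \<rho>_plus_r_bound by blast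
  show ?thesis
  proof (rule summable_comparison_test')
    show "summable (\<lambda>k. C * inverse (real k ^ 2))" by (intro summable_mult inverse_power_summable) simp
    fix k :: nat assume "1 \<le> k"
    have "\<rho> (int k) + r \<le> C / ((real k)\<^sup>2 + 1)" using C(2)[of "int k"] by simp
    also have "\<dots> \<le> C / (real k)\<^sup>2" using C(1) \<open>1 \<le> k\<close> by (intro divide_left_mono mult_pos_pos add_nonneg_pos) auto
    finally show "norm (\<rho> (int k) + r) \<le> C * inverse (real k ^ 2)"
      using \<rho>_gt[of "int k"] by (simp add: divide_inverse)
  qed
qed

lemma reflected: "line_weights r (- c) s2 (\<lambda>n. \<rho> (- n))"
proof
  fix n
  have "(real_of_int (- n) + c)\<^sup>2 = (real_of_int n + - c)\<^sup>2" by (simp add: power2_eq_square algebra_simps)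
  then show "\<rho> (- n) = - r * ((real_of_int n + - c)\<^sup>2 - s2) / ((real_of_int n + - c)\<^sup>2 - s2 + 1)"
    unfolding \<rho> by simp
qed (use r s2 in auto)

text \<open>Far out \<rho> is close to -r and can be divided by. The recurrence then has the
  constant coefficient -\<mu>/r, of size below 2, plus an error that is summable because \<rho> + r
  is.\<close>

lemma interior_solution_eventually_0:
  assumes \<mu>: "\<bar>\<mu>\<bar> < 2 * r" and dec: "decaying u"
    and eq: "\<And>n. \<mu> * u n = \<rho> n * (u (n + 1) + u (n - 1))"
  shows "\<exists>M. \<forall>n\<ge>M. u n = 0"
proof -
  have lim: "(\<lambda>k. \<rho> (int k) + r) \<longlonglongrightarrow> 0" by (rule summable_LIMSEQ_zero[OF summable_\<rho>_plus_r])
  have "\<forall>\<^sub>F k in sequentially. \<rho> (int k) + r < r / 2" using r by (intro order_tendstoD(2)[OF lim]) simp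
  then obtain N where N: "\<And>k. k \<ge> N \<Longrightarrow> \<rho> (int k) < - r / 2" by (force simp: eventually_sequentially)
  define e where "e k = \<mu> / \<rho> (int (Suc k)) + \<mu> / r" for k
  have "\<exists>M. \<forall>k\<ge>M. u (int k) = 0"
  proof (rule perturbed_oscillation_eventually_0[of "- \<mu> / r" e _ N])
    show "\<bar>- \<mu> / r\<bar> < 2" using \<mu> r by (simp add: field_simps)
    show "(\<lambda>k. u (int k)) \<longlonglongrightarrow> 0"
      using decaying_tendsto[OF decaying_reindex[OF dec inj_int_affine(3)[of 0]]] by simp
    show "summable (\<lambda>k. \<bar>e k\<bar>)"
    proof (rule summable_comparison_test')
      show "summable (\<lambda>k. (2 * \<bar>\<mu>\<bar> / r\<^sup>2) * (\<rho> (int (Suc k)) + r))"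
        by (rule summable_mult) (use summable_\<rho>_plus_r summable_Suc_iff[of "\<lambda>k. \<rho> (int k) + r"] in blast)
      fix k assume k: "k \<ge> N"
      define y where "y = \<rho> (int (Suc k))"
      have y: "y < - r / 2" "- r < y" using N[of "Suc k"] k \<rho>_gt by (auto simp: y_def)
      have "\<bar>e k\<bar> = \<bar>\<mu>\<bar> * ((y + r) / (- y * r))"
      proof -
        have "e k = \<mu> * ((y + r) / (y * r))" unfolding e_def y_def[symmetric] using y r by (simp add: field_simps)
        then show ?thesis using y r by (simp add: abs_mult abs_divide)
      qed
      also have "\<dots> \<le> \<bar>\<mu>\<bar> * ((y + r) / (r / 2 * r))"
        using y r by (intro mult_left_mono divide_left_mono mult_right_mono mult_pos_pos) auto
      also have "\<dots> = (2 * \<bar>\<mu>\<bar> / r\<^sup>2) * (y + r)" using r by (simp add: power2_eq_square)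
      finally show "norm \<bar>e k\<bar> \<le> (2 * \<bar>\<mu>\<bar> / r\<^sup>2) * (\<rho> (int (Suc k)) + r)" unfolding y_def by simp
    qed
    show "u (int (Suc (Suc k))) + u (int k) = (- \<mu> / r + e k) * u (int (Suc k))" if "k \<ge> N" for k
    proof -
      have "\<rho> (int (Suc k)) \<noteq> 0" using N[of "Suc k"] that r by auto
      moreover have "int (Suc k) + 1 = int (Suc (Suc k))" "int (Suc k) - 1 = int k" by simp_all
      ultimately show ?thesis using eq[of "int (Suc k)"] by (simp only: e_def) (simp add: field_simps)
    qed
  qed
  then obtain M where M: "\<And>k. k \<ge> M \<Longrightarrow> u (int k) = 0" by blast
  have "u n = 0" if "n \<ge> int M" for n using M[of "nat n"] that by simp
  then show ?thesis by blast
qed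

text \<open>Wherever \<open>\<rho> i\<close> is nonzero, the equation at \<open>i\<close> determines
  u (i - 1) from the two values to its right.\<close>

lemma solution_propagates_left:
  assumes eq: "\<And>n. \<mu> * u n = \<rho> n * (u (n + 1) + u (n - 1))"
    and M: "\<And>m. m \<ge> M \<Longrightarrow> u m = 0" and nz: "\<And>m. m > n \<Longrightarrow> \<rho> m \<noteq> 0"
  shows "u n = 0"
proof (cases "n \<le> M")
  case True
  then have "\<forall>m\<ge>n. u m = 0" using nz
  proof (induction n rule: int_le_induct)
    case base then show ?case using M by blast
  next
    case (step i)
    have *: "u m = 0" if "m \<ge> i" for m using step that by auto
    have "u (i - 1) = 0" using eq[of i] *[of i] *[of "i + 1"] step.prems[of i] by simp
    moreover have "m = i - 1 \<or> i \<le> m" if "i - 1 \<le> m" for m using that by auto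
    ultimately show ?case using * by blast
  qed
  then show ?thesis by simp
qed (use M in simp)

lemma endpoint_relation:
  assumes "2 * r * x = - (\<rho> n * S)"
  shows "((real_of_int n + c)\<^sup>2 - s2) * (S - 2 * x) = 2 * x"
proof -
  define P where "P = (real_of_int n + c)\<^sup>2 - s2"
  have "r * (2 * x) = r * (P / (P + 1) * S)" using assms by (simp add: \<rho> P_def)
  then have "2 * x = P / (P + 1) * S" using r by (simp only: mult_left_cancel)
  moreover have "0 < P + 1" unfolding P_def by (rule denominator_pos)
  ultimately have "2 * x * (P + 1) = P * S" by (simp add: field_simps)
  then show ?thesis unfolding P_def[symmetric] by (simp add: algebra_simps)
qed

lemma no_embedded_solution:
  assumes \<mu>: "\<bar>\<mu>\<bar> \<le> 2 * r" and dec: "decaying u"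
    and eq: "\<And>n. \<mu> * u n = \<rho> n * (u (n + 1) + u (n - 1))"
    and nz: "\<mu> \<noteq> 0 \<or> (\<forall>n. \<rho> n \<noteq> 0)"
  shows "u n = 0"
proof -
  consider "\<mu> = - (2 * r)" | "\<mu> = 2 * r" | "\<mu> = 0" | "\<mu> \<noteq> 0" "\<bar>\<mu>\<bar> < 2 * r" using \<mu> by linarith
  then show ?thesis
  proof cases
    case 1
    have "endpoint_solution s2 c u"
      unfolding endpoint_solution_def
    proof (intro conjI dec allI)
      fix n
      show "((real_of_int n + c)\<^sup>2 - s2) * (u (n + 1) + u (n - 1) - 2 * u n) = 2 * u n"
        by (rule endpoint_relation) (use eq[of n] in \<open>simp add: 1\<close>)
    qed
    then show ?thesis by (rule endpoint_solution_eq_0[OF _ s2])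
  next
    case 2
    \<comment> \<open>Alternating signs turn \<mu> into -\<mu> and reduce this end of the segment to
      the other one.\<close>
    define v where "v n = (if even n then u n else - u n)" for n
    have "endpoint_solution s2 c v"
      unfolding endpoint_solution_def
    proof (intro conjI allI)
      show "decaying v" by (rule decaying_mono[OF dec]) (simp add: v_def)
      fix n
      have "v (n + 1) + v (n - 1) = (if even n then - 1 else 1) * (u (n + 1) + u (n - 1))"
        by (simp add: v_def)
      then have "2 * r * v n = - (\<rho> n * (v (n + 1) + v (n - 1)))"
        using eq[of n] by (cases "even n") (simp_all add: 2 v_def algebra_simps)
      then show "((real_of_int n + c)\<^sup>2 - s2) * (v (n + 1) + v (n - 1) - 2 * v n) = 2 * v n"
        by (rule endpoint_relation)
    qed
    then have "v n = 0" by (rule endpoint_solution_eq_0[OF _ s2])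
    then show ?thesis by (simp add: v_def split: if_splits)
  next
    case 3
    then have step: "u (m + 1) = - u (m - 1)" for m using eq[of m] nz by (simp add: eq_neg_iff_add_eq_0)
    show ?thesis by (rule decaying_antiperiodic[OF dec]) (simp add: step)
  next
    case 4
    interpret R: line_weights r "- c" s2 "\<lambda>n. \<rho> (- n)" by (rule reflected)
    have eq': "\<mu> * u (- n) = \<rho> (- n) * (u (- (n + 1)) + u (- (n - 1)))" for n
    proof -
      have "- (n + 1) = - n - 1" "- (n - 1) = - n + 1" by simp_all
      then show ?thesis using eq[of "- n"] by (simp only: add.commute)
    qed
    have dec': "decaying (\<lambda>n. u (- n))" by (rule decaying_reindex[OF dec]) (simp add: inj_def)
    obtain M where M: "\<And>m. m \<ge> M \<Longrightarrow> u m = 0" using interior_solution_eventually_0[OF 4(2) dec eq] by blast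
    obtain M' where M': "\<And>m. m \<ge> M' \<Longrightarrow> u (- m) = 0"
      using R.interior_solution_eventually_0[OF 4(2) dec' eq'] by blast
    show ?thesis
    \<comment> \<open>A vanishing weight to the right of \<open>n\<close> blocks propagation from
      the right. But then no weight to the left of \<open>n\<close> vanishes, since nonnegative
      weights are at distance at most 1, and the reflected solution is propagated instead.\<close>
    proof (cases "\<exists>j>n. \<rho> j = 0")
      case True
      then obtain j where j: "j > n" "\<rho> j = 0" by blast
      have "\<rho> (- m) \<noteq> 0" if "m > - n" for m
        using nonneg_weights_adjacent[of j "- m"] j that by force
      from R.solution_propagates_left[of \<mu> "\<lambda>n. u (- n)" M' "- n", OF eq' M' this]
      show ?thesis by simp
    next
      case False
      then show ?thesis using solution_propagates_left[of \<mu> u M n, OF eq M] by blast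
    qed
  qed
qed

end

section \<open>Operators on two-sided sequences\<close>

lift_definition cscale :: "complex \<Rightarrow> zl2 \<Rightarrow> zl2" is "\<lambda>c f n. c * f n"
  by (auto simp: norm_mult power_mult_distrib intro!: summable_on_cmult_right)

lift_definition shift :: "int \<Rightarrow> zl2 \<Rightarrow> zl2" is "\<lambda>k f n. f (n + k)"
proof -
  fix k :: int and f :: "int \<Rightarrow> complex"
  have "bij_betw (\<lambda>n. n + k) UNIV UNIV" by (rule bij_betwI[of _ _ _ "\<lambda>n. n - k"]) auto
  from summable_on_reindex_bij_betw[OF this, of "\<lambda>n. (cmod (f n))\<^sup>2"]
  show "(\<lambda>n. (cmod (f n))\<^sup>2) summable_on UNIV \<Longrightarrow> (\<lambda>n. (cmod (f (n + k)))\<^sup>2) summable_on UNIV"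
    by simp
qed

text \<open>For unbounded \<open>d\<close> the product need not be square summable, so the facts
  about \<open>diag\<close> carry a bound on \<open>d\<close>.\<close>

definition diag :: "(int \<Rightarrow> real) \<Rightarrow> zl2 \<Rightarrow> zl2" where
  "diag d x = Abs_zl2 (\<lambda>n. d n *\<^sub>R ent x n)"

lemma ent_cscale [simp]: "ent (cscale c x) n = c * ent x n" by transfer simp
lemma ent_shift [simp]: "ent (shift k x) n = ent x (n + k)" by transfer simp

lemma ent_diag:
  assumes "\<And>n. \<bar>d n\<bar> \<le> K"
  shows "ent (diag d x) n = d n *\<^sub>R ent x n"
proof -
  have "(\<lambda>n. (cmod (d n *\<^sub>R ent x n))\<^sup>2) summable_on UNIV"
  proof (rule summable_on_comparison_test[where f = "\<lambda>n. K\<^sup>2 * (cmod (ent x n))\<^sup>2"])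
    show "(cmod (d n *\<^sub>R ent x n))\<^sup>2 \<le> K\<^sup>2 * (cmod (ent x n))\<^sup>2" for n
      using power_mono[OF assms[of n], of 2] by (simp add: power_mult_distrib mult_right_mono)
  qed (auto intro!: summable_on_cmult_right summable_on_ent)
  then show ?thesis by (simp add: diag_def Abs_zl2_inverse)
qed

lemma cscale_eq: "cscale c x = Re c *\<^sub>R x + Im c *\<^sub>R cscale \<i> x"
  by (rule zl2_eqI) (simp add: complex_eq_iff)

lemma norm_cscale [simp]: "norm (cscale c x) = cmod c * norm x"
proof -
  have "(norm (cscale c x))\<^sup>2 = (cmod c * norm x)\<^sup>2"
    unfolding norm_sq_zl2 power_mult_distrib by (simp add: norm_mult power_mult_distrib infsum_cmult_right')
  then show ?thesis by (simp add: power2_eq_iff_nonneg)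
qed

lemma inner_shift: "shift k x \<bullet> y = x \<bullet> shift (- k) y"
proof -
  have "bij_betw (\<lambda>n. n + k) UNIV UNIV" by (rule bij_betwI[of _ _ _ "\<lambda>n. n - k"]) auto
  from infsum_reindex_bij_betw[OF this, of "\<lambda>n. ent x n \<bullet> ent y (n - k)"]
  show ?thesis by (simp add: inner_zl2_def)
qed

lemma shift_shift [simp]: "shift k (shift l x) = shift (k + l) x"
  by (rule zl2_eqI) (simp add: add.assoc)

lemma shift_0 [simp]: "shift 0 x = x"
  by (rule zl2_eqI) simp

lemma norm_shift [simp]: "norm (shift k x) = norm x"
  by (simp add: norm_eq_sqrt_inner inner_shift)

lemma cscale_shift: "cscale c (shift k x) = shift k (cscale c x)"
  by (rule zl2_eqI) simp

lemma inner_cscale_i: "cscale \<i> x \<bullet> y = - (x \<bullet> cscale \<i> y)"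
proof -
  have "ent (cscale \<i> x) n \<bullet> ent y n = - (ent x n \<bullet> ent (cscale \<i> y) n)" for n
    by (simp add: inner_complex_def)
  then show ?thesis by (simp add: inner_zl2_def infsum_uminus)
qed

definition clinear_bounded :: "(zl2 \<Rightarrow> zl2) \<Rightarrow> bool" where
  "clinear_bounded T \<longleftrightarrow> bounded_linear T \<and> (\<forall>c x. T (cscale c x) = cscale c (T x))"

lemma bounded_linear_cscale: "bounded_linear (cscale c)"
  by (rule bounded_linear_intro[where K = "cmod c"]) (auto intro!: zl2_eqI simp: algebra_simps)

lemma bounded_linear_shift: "bounded_linear (shift k)"
  by (rule bounded_linear_intro[where K = 1]) (auto intro!: zl2_eqI)

lemma norm_diag_le:
  assumes "\<And>n. \<bar>d n\<bar> \<le> K"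
  shows "norm (diag d x) \<le> K * norm x"
proof -
  have "0 \<le> K" using assms[of 0] abs_ge_zero order_trans by blast
  then have "norm (diag d x) \<le> norm (K *\<^sub>R x)"
    using assms by (intro norm_zl2_le) (auto simp: ent_diag[OF assms] intro!: mult_right_mono)
  then show ?thesis using \<open>0 \<le> K\<close> by simp
qed

lemma clinear_bounded_diag:
  assumes "\<And>n. \<bar>d n\<bar> \<le> K"
  shows "clinear_bounded (diag d)"
  unfolding clinear_bounded_def
proof (intro conjI allI)
  show "bounded_linear (diag d)"
    by (rule bounded_linear_intro[where K = K])
       (auto intro!: zl2_eqI simp: ent_diag[OF assms] algebra_simps norm_diag_le[OF assms] mult.commute[of _ K])
  show "diag d (cscale c x) = cscale c (diag d x)" for c x
    by (rule zl2_eqI) (simp add: ent_diag[OF assms])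
qed

lemma inner_diag:
  assumes "\<And>n. \<bar>d n\<bar> \<le> K"
  shows "diag d x \<bullet> y = x \<bullet> diag d y"
  by (simp add: inner_zl2_def ent_diag[OF assms])

definition jacobi :: "real \<Rightarrow> (int \<Rightarrow> real) \<Rightarrow> zl2 \<Rightarrow> zl2" where
  "jacobi a \<rho> x = cscale (\<i> * of_real a) (shift (- 1) (diag \<rho> x) + shift 1 (diag \<rho> x))"

lemma ent_jacobi:
  assumes "\<And>n. \<bar>\<rho> n\<bar> \<le> K"
  shows "ent (jacobi a \<rho> x) n =
    \<i> * of_real a * (of_real (\<rho> (n - 1)) * ent x (n - 1) + of_real (\<rho> (n + 1)) * ent x (n + 1))"
  by (simp add: jacobi_def ent_diag[OF assms] scaleR_conv_of_real)

lemma clinear_bounded_jacobi: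
  assumes "\<And>n. \<bar>\<rho> n\<bar> \<le> K"
  shows "clinear_bounded (jacobi a \<rho>)"
  unfolding clinear_bounded_def
proof (intro conjI allI)
  note D = clinear_bounded_diag[OF assms, unfolded clinear_bounded_def, THEN conjunct1]
  show "bounded_linear (jacobi a \<rho>)"
    unfolding jacobi_def
    by (intro bounded_linear_compose[OF bounded_linear_cscale] bounded_linear_add
        bounded_linear_compose[OF bounded_linear_shift D])
  show "jacobi a \<rho> (cscale c x) = cscale c (jacobi a \<rho> x)" for c x
    by (rule zl2_eqI) (simp add: ent_jacobi[OF assms] algebra_simps)
qed

section \<open>Regular points and the resolvent\<close>

text \<open>Membership in the resolvent set: the lower bound stands for injectivity together with
  boundedness of the inverse.\<close>

definition regular :: "(zl2 \<Rightarrow> zl2) \<Rightarrow> complex \<Rightarrow> bool" where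
  "regular T \<mu> \<longleftrightarrow> surj (\<lambda>x. T x - cscale \<mu> x) \<and>
     (\<exists>\<delta>>0. \<forall>x. \<delta> * norm x \<le> norm (T x - cscale \<mu> x))"

definition res :: "(zl2 \<Rightarrow> zl2) \<Rightarrow> complex \<Rightarrow> zl2 \<Rightarrow> zl2" where
  "res T \<mu> = inv (\<lambda>x. T x - cscale \<mu> x)"

lemma bounded_linear_minus_cscale: "clinear_bounded T \<Longrightarrow> bounded_linear (\<lambda>x. T x - cscale \<mu> x)"
  unfolding clinear_bounded_def by (intro bounded_linear_sub bounded_linear_cscale) auto

text \<open>Lax-Milgram is applied to the product of the multiplier \<open>B\<close> with T - \<mu>;
  injectivity of \<open>B\<close> carries surjectivity of the product over to T - \<mu>.\<close>

lemma regularI_coercive: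
  assumes T: "clinear_bounded T" and B: "bounded_linear B" and inj: "\<And>x. B x = 0 \<Longrightarrow> x = 0"
    and d: "0 < d" and co: "\<And>x. d * (norm x)\<^sup>2 \<le> B (T x - cscale \<mu> x) \<bullet> x"
  shows "regular T \<mu>"
proof -
  define D where "D x = T x - cscale \<mu> x" for x
  have D: "bounded_linear D" unfolding D_def by (rule bounded_linear_minus_cscale[OF T])
  interpret B: bounded_linear B by (rule B)
  have s: "surj (\<lambda>x. B (D x))"
    by (rule coercive_surj[OF bounded_linear_compose[OF B D] d]) (simp add: co D_def)
  have "surj D"
    unfolding surj_def
  proof
    fix y
    obtain x where "B y = B (D x)" using s by (metis surjD)
    then have "B (y - D x) = 0" by (simp add: B.diff)
    then have "y - D x = 0" by (rule inj)
    then show "\<exists>x. y = D x" by auto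
  qed
  moreover obtain K where K: "0 < K" "\<And>x. norm (B x) \<le> norm x * K" using B.pos_bounded by blast
  have "d / K * norm x \<le> norm (D x)" for x
  proof (cases "x = 0")
    case False
    have "d * (norm x)\<^sup>2 \<le> norm (B (D x)) * norm x"
      using co[of x] norm_cauchy_schwarz[of "B (D x)" x] by (simp add: D_def)
    also have "\<dots> \<le> norm (D x) * K * norm x" by (intro mult_right_mono K) auto
    finally have "norm x * (d * norm x) \<le> norm x * (norm (D x) * K)" by (simp add: power2_eq_square mult_ac)
    then have "d * norm x \<le> norm (D x) * K" using False by simp
    then show ?thesis using K(1) by (simp add: field_simps)
  qed simp
  then have "\<exists>\<delta>>0. \<forall>x. \<delta> * norm x \<le> norm (D x)" using d K(1) by (intro exI[of _ "d / K"]) auto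
  ultimately show ?thesis by (simp add: regular_def D_def[abs_def])
qed

lemma regular_inj:
  assumes "clinear_bounded T" "regular T \<mu>"
  shows "inj (\<lambda>x. T x - cscale \<mu> x)"
proof -
  interpret bounded_linear "\<lambda>x. T x - cscale \<mu> x" by (rule bounded_linear_minus_cscale[OF assms(1)])
  obtain \<delta> where \<delta>: "0 < \<delta>" "\<And>x. \<delta> * norm x \<le> norm (T x - cscale \<mu> x)"
    using assms(2) by (auto simp: regular_def)
  show ?thesis
  proof (rule injI)
    fix x y assume "T x - cscale \<mu> x = T y - cscale \<mu> y"
    then have "T (x - y) - cscale \<mu> (x - y) = 0" by (simp add: diff)
    then have "norm (x - y) \<le> 0" using \<delta>(2)[of "x - y"] \<delta>(1) by (simp add: mult_le_0_iff)
    then show "x = y" by simp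
  qed
qed

lemma res_eq_iff:
  assumes "clinear_bounded T" "regular T \<mu>"
  shows "res T \<mu> y = x \<longleftrightarrow> T x - cscale \<mu> x = y"
proof -
  have "bij (\<lambda>x. T x - cscale \<mu> x)"
    using regular_inj[OF assms] assms(2) by (simp add: bij_def regular_def)
  from bij_inv_eq_iff[OF this, of x y] show ?thesis unfolding res_def by auto
qed

lemma res_right:
  assumes "clinear_bounded T" "regular T \<mu>"
  shows "T (res T \<mu> y) - cscale \<mu> (res T \<mu> y) = y"
  using res_eq_iff[OF assms, of y "res T \<mu> y"] by simp

lemma resolvent_identity:
  assumes T: "clinear_bounded T" and "regular T \<mu>" "regular T \<nu>"
  shows "res T \<nu> x - res T \<mu> x = cscale (\<nu> - \<mu>) (res T \<nu> (res T \<mu> x))"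
proof -
  interpret T: bounded_linear T using T by (simp add: clinear_bounded_def)
  have Tc: "T (cscale c y) = cscale c (T y)" for c y using T by (simp add: clinear_bounded_def)
  define y where "y = res T \<mu> x"
  define z where "z = res T \<nu> y"
  have y: "T y = x + cscale \<mu> y" using res_right[OF T assms(2), of x] by (simp add: y_def algebra_simps)
  have z: "T z = y + cscale \<nu> z" using res_right[OF T assms(3), of y] by (simp add: z_def algebra_simps)
  have "T (y + cscale (\<nu> - \<mu>) z) - cscale \<nu> (y + cscale (\<nu> - \<mu>) z) = x"
    by (rule zl2_eqI) (simp add: T.add Tc y z algebra_simps)
  then have "res T \<nu> x = y + cscale (\<nu> - \<mu>) z" by (simp add: res_eq_iff[OF T assms(3)])
  then show ?thesis by (simp add: y_def z_def)
qed

lemma res_tendsto: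
  assumes T: "clinear_bounded T" and S: "open S" "\<And>\<mu>. \<mu> \<in> S \<Longrightarrow> regular T \<mu>" and \<mu>: "\<mu> \<in> S"
  shows "((\<lambda>\<nu>. res T \<nu> x) \<longlongrightarrow> res T \<mu> x) (at \<mu>)"
proof -
  obtain \<delta> where \<delta>: "0 < \<delta>" "\<And>x. \<delta> * norm x \<le> norm (T x - cscale \<mu> x)"
    using S(2)[OF \<mu>] by (auto simp: regular_def)
  \<comment> \<open>Moving \<mu> by at most \<delta>/2 at worst halves the lower bound \<delta>, so
    the resolvents nearby are uniformly bounded.\<close>
  have bound: "norm (res T \<nu> y) \<le> 2 / \<delta> * norm y" if \<nu>: "\<nu> \<in> S" "cmod (\<nu> - \<mu>) \<le> \<delta> / 2" for \<nu> y
  proof -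
    define z where "z = res T \<nu> y"
    have "T z - cscale \<mu> z = y + cscale (\<nu> - \<mu>) z"
      using res_right[OF T S(2)[OF \<nu>(1)], of y] by (intro zl2_eqI) (auto simp: z_def algebra_simps dest: arg_cong[of _ _ "\<lambda>x. ent x n" for n])
    then have "\<delta> * norm z \<le> norm y + cmod (\<nu> - \<mu>) * norm z"
      using \<delta>(2)[of z] norm_triangle_ineq[of y "cscale (\<nu> - \<mu>) z"] by simp
    also have "\<dots> \<le> norm y + \<delta> / 2 * norm z" using \<nu> by (intro add_left_mono mult_right_mono) auto
    finally show ?thesis using \<delta>(1) by (simp add: z_def field_simps)
  qed
  have "((\<lambda>\<nu>. res T \<nu> x - res T \<mu> x) \<longlongrightarrow> 0) (at \<mu>)"
  proof (rule tendsto_norm_zero_cancel, rule tendsto_sandwich)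
    show "\<forall>\<^sub>F \<nu> in at \<mu>. 0 \<le> norm (res T \<nu> x - res T \<mu> x)" by simp
    show "((\<lambda>_. 0) \<longlongrightarrow> (0::real)) (at \<mu>)" by simp
    have "\<forall>\<^sub>F \<nu> in at \<mu>. \<nu> \<in> S \<inter> ball \<mu> (\<delta> / 2)"
      by (rule eventually_at_in_open') (use S(1) \<mu> \<delta>(1) in auto)
    then show "\<forall>\<^sub>F \<nu> in at \<mu>. norm (res T \<nu> x - res T \<mu> x) \<le> cmod (\<nu> - \<mu>) * (2 / \<delta> * norm (res T \<mu> x))"
    proof eventually_elim
      case (elim \<nu>)
      then have \<nu>: "\<nu> \<in> S" "cmod (\<nu> - \<mu>) \<le> \<delta> / 2" by (auto simp: dist_norm norm_minus_commute)
      then show ?case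
        unfolding resolvent_identity[OF T S(2)[OF \<mu>] S(2)[OF \<nu>(1)]]
        by (simp only: norm_cscale) (intro mult_left_mono bound, auto)
    qed
    show "((\<lambda>\<nu>. cmod (\<nu> - \<mu>) * (2 / \<delta> * norm (res T \<mu> x))) \<longlongrightarrow> 0) (at \<mu>)"
      using \<delta>(1) by (auto intro!: tendsto_eq_intros)
  qed
  from tendsto_add[OF this tendsto_const[of "res T \<mu> x"]] show ?thesis by simp
qed

text \<open>By the resolvent identity the difference quotient is an entry of the resolvent at \<nu>
  applied to the fixed vector \<open>res T \<mu> x\<close>, so strong continuity already gives the
  derivative.\<close>

lemma res_holomorphic:
  assumes T: "clinear_bounded T" and S: "open S" "\<And>\<mu>. \<mu> \<in> S \<Longrightarrow> regular T \<mu>"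
  shows "(\<lambda>\<mu>. ent (res T \<mu> x) n) holomorphic_on S"
proof (rule holomorphic_onI)
  fix \<mu> assume \<mu>: "\<mu> \<in> S"
  define y where "y = res T \<mu> x"
  have "((\<lambda>\<nu>. ent (res T \<nu> y) n) \<longlongrightarrow> ent (res T \<mu> y) n) (at \<mu>)"
    by (rule bounded_linear.tendsto[OF bounded_linear_ent res_tendsto[OF T S \<mu>]])
  moreover have "\<forall>\<^sub>F \<nu> in at \<mu>. ent (res T \<nu> y) n = (ent (res T \<nu> x) n - ent (res T \<mu> x) n) / (\<nu> - \<mu>)"
    unfolding eventually_at_topological
  proof (intro exI[of _ S] conjI ballI impI S(1) \<mu>)
    fix \<nu> assume \<nu>: "\<nu> \<in> S" "\<nu> \<noteq> \<mu>"
    have "ent (res T \<nu> x - res T \<mu> x) n = (\<nu> - \<mu>) * ent (res T \<nu> y) n"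
      using resolvent_identity[OF T S(2)[OF \<mu>] S(2)[OF \<nu>(1)], of x] by (simp add: y_def)
    then show "ent (res T \<nu> y) n = (ent (res T \<nu> x) n - ent (res T \<mu> x) n) / (\<nu> - \<mu>)"
      using \<nu> by (simp add: field_simps)
  qed
  ultimately have "((\<lambda>\<nu>. ent (res T \<nu> x) n) has_field_derivative ent (res T \<mu> y) n) (at \<mu>)"
    unfolding has_field_derivative_iff by (rule Lim_transform_eventually)
  then show "(\<lambda>\<mu>. ent (res T \<mu> x) n) field_differentiable at \<mu> within S"
    using field_differentiable_at_within field_differentiable_def by blast
qed

section \<open>Negative weights\<close>

text \<open>Pairing \<sigma> (T - \<mu>) x with x gives -Re \<mu> times \<open>Q x\<close>, because
  i \<sigma> (S + S^-1) \<sigma> is skew. Pairing i \<sigma> (T - \<mu>) x with x gives a times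
  \<open>q x\<close> plus Im \<mu> times \<open>Q x\<close>, where |q| \<le> 2 r Q. Off the segment
  one of the two is coercive up to sign.\<close>

lemma jacobi_negative_regular:
  assumes neg: "\<And>n. - r \<le> \<rho> n" "\<And>n. \<rho> n \<le> - m" "0 < m"
    and \<mu>: "\<mu> \<notin> {\<i> * of_real t | t. \<bar>t\<bar> \<le> 2 * \<bar>a\<bar> * r}"
  shows "regular (jacobi a \<rho>) \<mu>"
proof -
  define \<sigma> where "\<sigma> n = - \<rho> n" for n
  have \<sigma>: "m \<le> \<sigma> n" "\<sigma> n \<le> r" "0 < \<sigma> n" for n using neg(1,2)[of n] neg(3) by (auto simp: \<sigma>_def)
  have r: "0 < r" using \<sigma>(2,3)[of 0] by linarith
  have \<sigma>b: "\<bar>\<sigma> n\<bar> \<le> r" and \<rho>b: "\<bar>\<rho> n\<bar> \<le> r" for n using \<sigma>[of n] by (auto simp: \<sigma>_def)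
  note T = clinear_bounded_jacobi[OF \<rho>b, of a]
  note ent_\<sigma> = ent_diag[OF \<sigma>b]
  define Q where "Q x = diag \<sigma> x \<bullet> x" for x
  define q where "q x = 2 * (shift 1 (diag \<sigma> x) \<bullet> diag \<sigma> x)" for x
  have decomp: "diag \<sigma> (jacobi a \<rho> x - cscale \<mu> x) = - cscale (\<i> * of_real a)
      (diag \<sigma> (shift (- 1) (diag \<sigma> x) + shift 1 (diag \<sigma> x))) - cscale \<mu> (diag \<sigma> x)" for x
    by (rule zl2_eqI) (simp add: ent_\<sigma> ent_jacobi[OF \<rho>b] scaleR_conv_of_real \<sigma>_def algebra_simps)
  have sym: "diag \<sigma> (shift (- 1) (diag \<sigma> x) + shift 1 (diag \<sigma> x)) \<bullet> x = q x" for x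
    unfolding inner_diag[OF \<sigma>b, where x = "shift (- 1) (diag \<sigma> x) + shift 1 (diag \<sigma> x)"] q_def inner_add_left inner_shift[of "- 1"]
    by (simp add: inner_commute)
  have skew: "cscale \<i> (diag \<sigma> (shift (- 1) (diag \<sigma> x) + shift 1 (diag \<sigma> x))) \<bullet> x = 0" for x
  proof -
    define y where "y = diag \<sigma> x"
    have "cscale \<i> (diag \<sigma> (shift (- 1) y + shift 1 y)) = diag \<sigma> (shift (- 1) (cscale \<i> y) + shift 1 (cscale \<i> y))"
      by (rule zl2_eqI) (simp add: ent_\<sigma> algebra_simps)
    then have "cscale \<i> (diag \<sigma> (shift (- 1) y + shift 1 y)) \<bullet> x = shift (- 1) (cscale \<i> y) \<bullet> y + shift 1 (cscale \<i> y) \<bullet> y"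
      by (simp add: inner_diag[OF \<sigma>b] y_def inner_add_left)
    also have "shift (- 1) (cscale \<i> y) \<bullet> y = - (y \<bullet> shift 1 (cscale \<i> y))"
      unfolding inner_shift by (simp add: inner_cscale_i cscale_shift)
    finally show ?thesis by (simp add: y_def inner_commute)
  qed
  have skewQ: "cscale \<i> (diag \<sigma> x) \<bullet> x = 0" for x
  proof -
    have "ent (cscale \<i> (diag \<sigma> x)) n \<bullet> ent x n = 0" for n by (simp add: ent_\<sigma> inner_complex_def)
    then show ?thesis by (simp add: inner_zl2_def)
  qed
  have Q_ge: "m * (norm x)\<^sup>2 \<le> Q x" for x
    unfolding Q_def power2_norm_eq_inner inner_scaleR_left[symmetric] unfolding inner_zl2_def
    by (rule infsum_mono[OF summable_on_inner_ent summable_on_inner_ent])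
       (auto simp: ent_\<sigma> intro!: mult_right_mono \<sigma>)
  \<comment> \<open>From 0 < \<sigma> \<le> r follows \<sigma>^2 \<le> r \<sigma>. Estimating by the
    weighted form instead of the norm keeps the excluded set down to the segment.\<close>
  have q_le: "\<bar>q x\<bar> \<le> 2 * r * Q x" for x
  proof -
    have "\<bar>shift 1 (diag \<sigma> x) \<bullet> diag \<sigma> x\<bar> \<le> (norm (diag \<sigma> x))\<^sup>2"
      using Cauchy_Schwarz_ineq2[of "shift 1 (diag \<sigma> x)" "diag \<sigma> x"] by (simp add: power2_eq_square)
    also have "\<dots> \<le> r * Q x"
      unfolding Q_def power2_norm_eq_inner inner_scaleR_right[symmetric] unfolding inner_zl2_def
      by (rule infsum_mono[OF summable_on_inner_ent summable_on_inner_ent])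
         (simp add: ent_\<sigma> mult_right_mono mult_left_mono \<sigma> less_imp_le[OF \<sigma>(3)])
    finally show ?thesis by (simp add: q_def)
  qed
  have Q0: "0 \<le> Q x" for x using Q_ge[of x] neg(3) by (meson mult_nonneg_nonneg less_imp_le order_trans zero_le_power2)
  have inner1: "diag \<sigma> (jacobi a \<rho> x - cscale \<mu> x) \<bullet> x = - Re \<mu> * Q x" for x
    unfolding decomp inner_diff_left inner_minus_left
    by (subst (1 2) cscale_eq) (simp add: inner_add_left skew skewQ Q_def)
  have inner2: "cscale \<i> (diag \<sigma> (jacobi a \<rho> x - cscale \<mu> x)) \<bullet> x = a * q x + Im \<mu> * Q x" for x
  proof -
    have "cscale \<i> (diag \<sigma> (jacobi a \<rho> x - cscale \<mu> x)) = cscale (of_real a)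
      (diag \<sigma> (shift (- 1) (diag \<sigma> x) + shift 1 (diag \<sigma> x))) - cscale (\<i> * \<mu>) (diag \<sigma> x)"
      unfolding decomp by (rule zl2_eqI) (simp add: algebra_simps)
    then show ?thesis
      unfolding inner_diff_left
      by (subst (asm) (1 2) cscale_eq) (simp add: inner_add_left inner_diff_left skewQ Q_def sym)
  qed
  have inj: "x = 0" if "diag \<sigma> x = 0" for x
  proof (rule zl2_eqI)
    fix n
    have "ent (diag \<sigma> x) n = \<sigma> n *\<^sub>R ent x n" by (rule ent_\<sigma>)
    then have "\<sigma> n *\<^sub>R ent x n = 0" using that by simp
    then show "ent x n = ent 0 n" using \<sigma>(3)[of n] by simp
  qed
  have bl: "bounded_linear (diag \<sigma>)"
    using clinear_bounded_diag[OF \<sigma>b] by (simp add: clinear_bounded_def)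
  show ?thesis
  proof (cases "Re \<mu> = 0")
    case False
    show ?thesis
    proof (rule regularI_coercive[OF T])
      show "bounded_linear (\<lambda>x. (- Re \<mu>) *\<^sub>R diag \<sigma> x)" by (intro bounded_linear_scaleR_right bounded_linear_const_scaleR bl)
      show "x = 0" if "(- Re \<mu>) *\<^sub>R diag \<sigma> x = 0" for x using that False inj by simp
      show "0 < (Re \<mu>)\<^sup>2 * m" using False neg(3) by simp
      show "(Re \<mu>)\<^sup>2 * m * (norm x)\<^sup>2 \<le> (- Re \<mu>) *\<^sub>R diag \<sigma> (jacobi a \<rho> x - cscale \<mu> x) \<bullet> x" for x
        using mult_left_mono[OF Q_ge[of x], of "(Re \<mu>)\<^sup>2"] by (simp add: inner1 power2_eq_square mult_ac)
    qed
  next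
    case True
    define R where "R = 2 * \<bar>a\<bar> * r"
    have \<mu>R: "R < \<bar>Im \<mu>\<bar>"
    proof (rule ccontr)
      assume "\<not> R < \<bar>Im \<mu>\<bar>"
      moreover have "\<mu> = \<i> * of_real (Im \<mu>)" using True by (simp add: complex_eq_iff)
      ultimately show False using \<mu> unfolding R_def by auto
    qed
    show ?thesis
    proof (rule regularI_coercive[OF T])
      show "bounded_linear (\<lambda>x. sgn (Im \<mu>) *\<^sub>R cscale \<i> (diag \<sigma> x))"
        by (intro bounded_linear_const_scaleR bounded_linear_compose[OF bounded_linear_cscale bl])
      have "0 \<le> R" using r by (simp add: R_def)
      then have Im0: "Im \<mu> \<noteq> 0" using \<mu>R by auto
      show "x = 0" if "sgn (Im \<mu>) *\<^sub>R cscale \<i> (diag \<sigma> x) = 0" for x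
        using that Im0 inj norm_cscale[of \<i> "diag \<sigma> x"] by (simp add: sgn_zero_iff)
      show "0 < (\<bar>Im \<mu>\<bar> - R) * m" using \<mu>R neg(3) by simp
      show "(\<bar>Im \<mu>\<bar> - R) * m * (norm x)\<^sup>2 \<le> sgn (Im \<mu>) *\<^sub>R cscale \<i> (diag \<sigma> (jacobi a \<rho> x - cscale \<mu> x)) \<bullet> x" for x
      proof -
        have "(\<bar>Im \<mu>\<bar> - R) * m * (norm x)\<^sup>2 \<le> (\<bar>Im \<mu>\<bar> - R) * Q x"
          using mult_left_mono[OF Q_ge[of x], of "\<bar>Im \<mu>\<bar> - R"] \<mu>R by (simp add: mult.assoc)
        also have "\<dots> = \<bar>Im \<mu>\<bar> * Q x - \<bar>a\<bar> * (2 * r * Q x)" by (simp add: R_def algebra_simps)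
        also have "\<dots> \<le> \<bar>Im \<mu>\<bar> * Q x - \<bar>a\<bar> * \<bar>q x\<bar>" by (intro diff_left_mono mult_left_mono q_le) auto
        also have "\<dots> \<le> sgn (Im \<mu>) * (a * q x) + \<bar>Im \<mu>\<bar> * Q x"
          using Im0 abs_ge_minus_self[of "sgn (Im \<mu>) * (a * q x)"] by (simp add: abs_mult abs_sgn_eq)
        also have "\<dots> = sgn (Im \<mu>) *\<^sub>R cscale \<i> (diag \<sigma> (jacobi a \<rho> x - cscale \<mu> x)) \<bullet> x"
          by (simp add: inner2 algebra_simps) (simp add: abs_sgn mult_ac)
        finally show ?thesis .
      qed
    qed
  qed
qed

section \<open>Rank-two perturbations\<close>

text \<open>\<open>finite_dimensional\<close> sums over a set of vectors, so the coefficients of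
  coinciding vectors \<open>b l\<close> have to be merged.\<close>

lemma finite_image_sum:
  fixes b :: "'l \<Rightarrow> 'i \<Rightarrow> complex"
  assumes "finite I"
  shows "\<exists>c'. \<forall>i. (\<Sum>l\<in>I. c l * b l i) = (\<Sum>u\<in>b ` I. c' u * u i)"
proof (intro exI allI)
  fix i
  have "(\<Sum>l\<in>I. c l * b l i) = (\<Sum>u\<in>b ` I. \<Sum>l\<in>{l\<in>I. b l = u}. c l * b l i)"
    using assms by (rule sum.image_gen)
  also have "\<dots> = (\<Sum>u\<in>b ` I. (\<Sum>l\<in>{l\<in>I. b l = u}. c l) * u i)"
    by (intro sum.cong refl) (simp add: sum_distrib_right)
  finally show "(\<Sum>l\<in>I. c l * b l i) = (\<Sum>u\<in>b ` I. (\<Sum>l\<in>{l\<in>I. b l = u}. c l) * u i)" .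
qed

text \<open>Cauchy's formula for derivatives combined with the Leibniz rule. It separates the two
  factors: if only \<open>f\<close> depends on a vector, the integral is a combination of fixed
  derivatives of \<open>g\<close>.\<close>

lemma circle_integral_mult_pole:
  assumes S: "open S" "cball z r \<subseteq> S" "0 < r" and f: "f holomorphic_on S" and g: "g holomorphic_on S"
  shows "((\<lambda>u. f u * g u / (u - z) ^ Suc k) has_contour_integral
    (\<Sum>i\<le>k. 2 * of_real pi * \<i> / fact k * of_nat (k choose i) * (deriv ^^ i) f z * (deriv ^^ (k - i)) g z))
    (circlepath z r)"
proof -
  have fg: "(\<lambda>u. f u * g u) holomorphic_on S" by (intro holomorphic_intros f g)
  have "((\<lambda>u. f u * g u / (u - z) ^ Suc k) has_contour_integral
    2 * of_real pi * \<i> / fact k * (deriv ^^ k) (\<lambda>u. f u * g u) z) (circlepath z r)"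
  proof -
    have "continuous_on (cball z r) (\<lambda>u. f u * g u)"
      using holomorphic_on_imp_continuous_on[OF fg] S(2) continuous_on_subset by blast
    moreover have "(\<lambda>u. f u * g u) holomorphic_on ball z r"
      using fg S(2) ball_subset_cball holomorphic_on_subset by blast
    ultimately show ?thesis
      using Cauchy_has_contour_integral_higher_derivative_circlepath[of z r "\<lambda>u. f u * g u" z k] S(3) by simp
  qed
  moreover have "(deriv ^^ k) (\<lambda>u. f u * g u) z
      = (\<Sum>i=0..k. of_nat (k choose i) * (deriv ^^ i) f z * (deriv ^^ (k - i)) g z)"
    by (rule higher_deriv_mult[OF f g S(1)]) (use S in auto)
  ultimately show ?thesis
    by (simp add: sum_distrib_left atLeast0AtMost mult.assoc)
qed

locale rank_two_perturbation =
  fixes T T0 :: "zl2 \<Rightarrow> zl2" and j k :: int and \<xi> \<eta> :: zl2 and S :: "complex set"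
  assumes T0: "clinear_bounded T0"
    and T: "\<And>x. T x = T0 x + cscale (ent x j) \<xi> + cscale (ent x k) \<eta>"
    and S: "open S" "connected S"
    and regular_T0: "\<And>\<mu>. \<mu> \<in> S \<Longrightarrow> regular T0 \<mu>"
    and injective_somewhere: "\<exists>\<mu>\<in>S. \<forall>x. T x = cscale \<mu> x \<longrightarrow> x = 0"
begin

text \<open>Applying \<open>R \<mu>\<close> to (T - \<mu>) x = y gives x = R y - x_j h - x_k g. Its
  entries at \<open>j\<close> and \<open>k\<close> form a linear system for x_j and x_k, with
  determinant \<open>pdet\<close> and Cramer numerators \<open>num1\<close> and
  \<open>num2\<close>.\<close>

definition "R \<mu> = res T0 \<mu>"
definition "h \<mu> = R \<mu> \<xi>"
definition "g \<mu> = R \<mu> \<eta>"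
definition "pdet \<mu> = (1 + ent (h \<mu>) j) * (1 + ent (g \<mu>) k) - ent (g \<mu>) j * ent (h \<mu>) k"
definition "num1 \<mu> x = (1 + ent (g \<mu>) k) * ent (R \<mu> x) j - ent (g \<mu>) j * ent (R \<mu> x) k"
definition "num2 \<mu> x = (1 + ent (h \<mu>) j) * ent (R \<mu> x) k - ent (h \<mu>) k * ent (R \<mu> x) j"

lemma T0_cscale: "T0 (cscale c x) = cscale c (T0 x)" and bl_T0: "bounded_linear T0"
  using T0 by (auto simp: clinear_bounded_def)

lemma clinear_bounded_T: "clinear_bounded T"
  unfolding clinear_bounded_def
proof (intro conjI allI)
  have "bounded_linear (\<lambda>x. cscale (ent x i) y)" for i y
  proof (rule bounded_linear_intro[where K = "norm y"])
    show "norm (cscale (ent x i) y) \<le> norm x * norm y" for x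
      by (simp add: mult_right_mono cmod_ent_le)
  qed (auto intro!: zl2_eqI simp: algebra_simps)
  moreover have "T = (\<lambda>x. T0 x + cscale (ent x j) \<xi> + cscale (ent x k) \<eta>)" using T by auto
  ultimately show "bounded_linear T" by (simp add: bounded_linear_add bl_T0)
  show "T (cscale c x) = cscale c (T x)" for c x
    by (rule zl2_eqI) (simp add: T T0_cscale algebra_simps)
qed

lemma T0_R: "\<mu> \<in> S \<Longrightarrow> T0 (R \<mu> x) = x + cscale \<mu> (R \<mu> x)"
  using res_right[OF T0 regular_T0, of \<mu> x] by (simp add: R_def algebra_simps)

lemma R_eqI: "\<mu> \<in> S \<Longrightarrow> T0 x - cscale \<mu> x = y \<Longrightarrow> R \<mu> y = x"
  unfolding R_def using res_eq_iff[OF T0 regular_T0] by blast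

text \<open>A nonzero solution (c, d) of the homogeneous system gives w = -(c h + d g), whose
  entries at \<open>j\<close> and \<open>k\<close> are c and d. So \<open>w\<close> is nonzero, and
  the rank-two part of \<open>T w\<close> cancels T0 w - \<mu> w.\<close>

lemma eigenvector_if_det_eq_0:
  assumes \<mu>: "\<mu> \<in> S" and "pdet \<mu> = 0"
  shows "\<exists>x. x \<noteq> 0 \<and> T x = cscale \<mu> x"
proof -
  interpret T0: bounded_linear T0 by (rule bl_T0)
  obtain c d where cd: "c \<noteq> 0 \<or> d \<noteq> 0"
    "(1 + ent (h \<mu>) j) * c + ent (g \<mu>) j * d = 0" "ent (h \<mu>) k * c + (1 + ent (g \<mu>) k) * d = 0"
  \<comment> \<open>A kernel vector is read off from the first row of the singular matrix, or from
    the second if the first is zero.\<close>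
  proof (cases "1 + ent (h \<mu>) j = 0 \<and> ent (g \<mu>) j = 0")
    case False
    show thesis
    proof (rule that[of "ent (g \<mu>) j" "- (1 + ent (h \<mu>) j)"])
      show "ent (g \<mu>) j \<noteq> 0 \<or> - (1 + ent (h \<mu>) j) \<noteq> 0" using False neg_equal_0_iff_equal by blast
      show "ent (h \<mu>) k * ent (g \<mu>) j + (1 + ent (g \<mu>) k) * - (1 + ent (h \<mu>) j) = 0"
        using assms(2) by (simp add: pdet_def algebra_simps)
    qed (simp add: algebra_simps)
  next
    case True
    show thesis
    proof (cases "ent (h \<mu>) k = 0")
      case True
      with \<open>1 + ent (h \<mu>) j = 0 \<and> ent (g \<mu>) j = 0\<close> show thesis by (intro that[of 1 0]) auto
    next
      case False
      with \<open>1 + ent (h \<mu>) j = 0 \<and> ent (g \<mu>) j = 0\<close> show thesis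
        by (intro that[of "1 + ent (g \<mu>) k" "- ent (h \<mu>) k"]) (auto simp: algebra_simps)
    qed
  qed
  define w where "w = - (cscale c (h \<mu>) + cscale d (g \<mu>))"
  have "(c * ent (h \<mu>) j + d * ent (g \<mu>) j) + c = 0" "(c * ent (h \<mu>) k + d * ent (g \<mu>) k) + d = 0"
    using cd(2,3) by (simp_all add: algebra_simps)
  from this(1)[THEN minus_unique] this(2)[THEN minus_unique] have w: "ent w j = c" "ent w k = d"
    unfolding w_def ent_minus ent_add ent_cscale .
  have "T w = cscale \<mu> w"
  proof (rule zl2_eqI)
    show "ent (T w) n = ent (cscale \<mu> w) n" for n
      unfolding T w by (simp add: w_def T0.add T0.diff T0.neg T0_cscale h_def g_def T0_R[OF \<mu>] algebra_simps)
  qed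
  moreover have "w \<noteq> 0" using w cd(1) by auto
  ultimately show ?thesis by blast
qed

lemma solution_iff:
  assumes \<mu>: "\<mu> \<in> S" and pdet: "pdet \<mu> \<noteq> 0"
  shows "T x - cscale \<mu> x = y \<longleftrightarrow>
    x = R \<mu> y - cscale (num1 \<mu> y / pdet \<mu>) (h \<mu>) - cscale (num2 \<mu> y / pdet \<mu>) (g \<mu>)"
proof
  interpret T0: bounded_linear T0 by (rule bl_T0)
  assume "T x - cscale \<mu> x = y"
  then have y: "T0 x - cscale \<mu> x = y - cscale (ent x j) \<xi> - cscale (ent x k) \<eta>"
    by (simp add: T algebra_simps)
  have "T0 (R \<mu> y - cscale (ent x j) (h \<mu>) - cscale (ent x k) (g \<mu>))
      - cscale \<mu> (R \<mu> y - cscale (ent x j) (h \<mu>) - cscale (ent x k) (g \<mu>))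
      = y - cscale (ent x j) \<xi> - cscale (ent x k) \<eta>"
    by (rule zl2_eqI) (simp add: T0.diff T0.add T0_cscale h_def g_def T0_R[OF \<mu>] algebra_simps)
  from R_eqI[OF \<mu> this] R_eqI[OF \<mu> y]
  have x: "x = R \<mu> y - cscale (ent x j) (h \<mu>) - cscale (ent x k) (g \<mu>)" by simp
  have "ent x j = ent (R \<mu> y) j - ent x j * ent (h \<mu>) j - ent x k * ent (g \<mu>) j"
    "ent x k = ent (R \<mu> y) k - ent x j * ent (h \<mu>) k - ent x k * ent (g \<mu>) k"
    using arg_cong[OF x, of "\<lambda>x. ent x j"] arg_cong[OF x, of "\<lambda>x. ent x k"] by simp_all
  then have Rj: "ent (R \<mu> y) j = ent x j + ent x j * ent (h \<mu>) j + ent x k * ent (g \<mu>) j"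
    and Rk: "ent (R \<mu> y) k = ent x k + ent x j * ent (h \<mu>) k + ent x k * ent (g \<mu>) k"
    by (simp_all add: algebra_simps)
  have "num1 \<mu> y = ent x j * pdet \<mu>" "num2 \<mu> y = ent x k * pdet \<mu>"
    unfolding num1_def num2_def pdet_def Rj Rk by (simp_all add: algebra_simps)
  then have "num1 \<mu> y / pdet \<mu> = ent x j" "num2 \<mu> y / pdet \<mu> = ent x k" using pdet by simp_all
  then show "x = R \<mu> y - cscale (num1 \<mu> y / pdet \<mu>) (h \<mu>) - cscale (num2 \<mu> y / pdet \<mu>) (g \<mu>)"
    using x by simp
next
  interpret T0: bounded_linear T0 by (rule bl_T0)
  define c where "c = num1 \<mu> y / pdet \<mu>"
  define d where "d = num2 \<mu> y / pdet \<mu>"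
  assume "x = R \<mu> y - cscale (num1 \<mu> y / pdet \<mu>) (h \<mu>) - cscale (num2 \<mu> y / pdet \<mu>) (g \<mu>)"
  then have x: "x = R \<mu> y - cscale c (h \<mu>) - cscale d (g \<mu>)" by (simp add: c_def d_def)
  have "pdet \<mu> * (c * (1 + ent (h \<mu>) j) + d * ent (g \<mu>) j)
      = num1 \<mu> y * (1 + ent (h \<mu>) j) + num2 \<mu> y * ent (g \<mu>) j"
    using pdet by (simp add: c_def d_def field_simps)
  also have "\<dots> = pdet \<mu> * ent (R \<mu> y) j"
    by (simp add: num1_def num2_def pdet_def algebra_simps)
  finally have "c * (1 + ent (h \<mu>) j) + d * ent (g \<mu>) j = ent (R \<mu> y) j" using pdet by simp
  then have xj: "ent x j = c" by (simp add: x algebra_simps)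
  have "pdet \<mu> * (c * ent (h \<mu>) k + d * (1 + ent (g \<mu>) k))
      = num1 \<mu> y * ent (h \<mu>) k + num2 \<mu> y * (1 + ent (g \<mu>) k)"
    using pdet by (simp add: c_def d_def field_simps)
  also have "\<dots> = pdet \<mu> * ent (R \<mu> y) k"
    by (simp add: num1_def num2_def pdet_def algebra_simps)
  finally have "c * ent (h \<mu>) k + d * (1 + ent (g \<mu>) k) = ent (R \<mu> y) k" using pdet by simp
  then have xk: "ent x k = d" by (simp add: x algebra_simps)
  show "T x - cscale \<mu> x = y"
    unfolding T xj xk
    by (rule zl2_eqI) (simp add: x T0.diff T0.add T0_cscale h_def g_def T0_R[OF \<mu>] algebra_simps)
qed

lemma regular_if_det_neq_0:
  assumes \<mu>: "\<mu> \<in> S" and pdet: "pdet \<mu> \<noteq> 0"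
  shows "regular T \<mu>"
  unfolding regular_def
proof
  show "surj (\<lambda>x. T x - cscale \<mu> x)"
    unfolding surj_def using solution_iff[OF assms] by metis
  obtain \<delta> where \<delta>: "0 < \<delta>" "\<And>x. \<delta> * norm x \<le> norm (T0 x - cscale \<mu> x)"
    using regular_T0[OF \<mu>] by (auto simp: regular_def)
  \<comment> \<open>\<open>A\<close> and \<open>B\<close> bound the Cramer quotients by multiples of
    the norm of \<open>u\<close>, as single entries never exceed the norm.\<close>
  define A where "A = (cmod (1 + ent (g \<mu>) k) + cmod (ent (g \<mu>) j)) / cmod (pdet \<mu>)"
  define B where "B = (cmod (1 + ent (h \<mu>) j) + cmod (ent (h \<mu>) k)) / cmod (pdet \<mu>)"
  define K where "K = 1 + A * norm (h \<mu>) + B * norm (g \<mu>)"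
  have K: "0 < K" by (auto simp: K_def A_def B_def intro!: add_pos_nonneg mult_nonneg_nonneg divide_nonneg_nonneg)
  have "\<delta> / K * norm x \<le> norm (T x - cscale \<mu> x)" for x
  proof -
    define y where "y = T x - cscale \<mu> x"
    define u where "u = R \<mu> y"
    have "\<delta> * norm u \<le> norm y" using \<delta>(2)[of u] T0_R[OF \<mu>, of y] by (simp add: u_def)
    have n1: "cmod (num1 \<mu> y / pdet \<mu>) \<le> A * norm u"
    proof -
      have "cmod (num1 \<mu> y) \<le> cmod (1 + ent (g \<mu>) k) * cmod (ent u j) + cmod (ent (g \<mu>) j) * cmod (ent u k)"
        unfolding num1_def u_def[symmetric] by (metis norm_mult norm_triangle_ineq4)
      also have "\<dots> \<le> cmod (1 + ent (g \<mu>) k) * norm u + cmod (ent (g \<mu>) j) * norm u"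
        by (intro add_mono mult_left_mono cmod_ent_le) auto
      finally show ?thesis using pdet by (simp add: A_def norm_divide divide_right_mono algebra_simps add_divide_distrib[symmetric])
    qed
    have n2: "cmod (num2 \<mu> y / pdet \<mu>) \<le> B * norm u"
    proof -
      have "cmod (num2 \<mu> y) \<le> cmod (1 + ent (h \<mu>) j) * cmod (ent u k) + cmod (ent (h \<mu>) k) * cmod (ent u j)"
        unfolding num2_def u_def[symmetric] by (metis norm_mult norm_triangle_ineq4)
      also have "\<dots> \<le> cmod (1 + ent (h \<mu>) j) * norm u + cmod (ent (h \<mu>) k) * norm u"
        by (intro add_mono mult_left_mono cmod_ent_le) auto
      finally show ?thesis using pdet by (simp add: B_def norm_divide divide_right_mono algebra_simps add_divide_distrib[symmetric])
    qed
    have "x = u - cscale (num1 \<mu> y / pdet \<mu>) (h \<mu>) - cscale (num2 \<mu> y / pdet \<mu>) (g \<mu>)"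
      using solution_iff[OF assms, of x y] by (simp add: y_def u_def)
    then have "norm x \<le> norm u + norm (cscale (num1 \<mu> y / pdet \<mu>) (h \<mu>)) + norm (cscale (num2 \<mu> y / pdet \<mu>) (g \<mu>))"
      by (metis norm_triangle_ineq4 order_trans add_right_mono)
    also have "\<dots> \<le> norm u + A * norm u * norm (h \<mu>) + B * norm u * norm (g \<mu>)"
      unfolding norm_cscale by (intro add_mono mult_right_mono n1 n2 order_refl) auto
    also have "\<dots> = K * norm u" by (simp add: K_def algebra_simps)
    finally have "\<delta> * norm x \<le> K * (\<delta> * norm u)" using mult_left_mono[of "norm x" "K * norm u" \<delta>] \<delta>(1) by (simp add: mult_ac)
    also have "\<dots> \<le> K * norm y" using \<open>\<delta> * norm u \<le> norm y\<close> K by (intro mult_left_mono) auto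
    finally show ?thesis using K by (simp add: y_def field_simps)
  qed
  then show "\<exists>\<delta>>0. \<forall>x. \<delta> * norm x \<le> norm (T x - cscale \<mu> x)"
    using \<delta>(1) K by (intro exI[of _ "\<delta> / K"]) auto
qed

lemma res_T:
  assumes "\<mu> \<in> S" "pdet \<mu> \<noteq> 0"
  shows "res T \<mu> y = R \<mu> y - cscale (num1 \<mu> y / pdet \<mu>) (h \<mu>) - cscale (num2 \<mu> y / pdet \<mu>) (g \<mu>)"
  using res_eq_iff[OF clinear_bounded_T regular_if_det_neq_0[OF assms]] solution_iff[OF assms] by blast

lemma R_holomorphic: "(\<lambda>\<mu>. ent (R \<mu> x) n) holomorphic_on S"
  unfolding R_def by (rule res_holomorphic[OF T0 S(1) regular_T0])

text \<open>Injectivity somewhere keeps \<open>pdet\<close> from vanishing identically, so its zero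
  has a finite order N + 1. The singular part of the resolvent consists of multiples of
  \<open>h\<close> and \<open>g\<close> over that power, and its integral is spanned by their
  derivatives of order at most N, whatever \<open>x\<close> is.\<close>

lemma isolated_finite_rank:
  assumes \<mu>0: "\<mu>0 \<in> S" "pdet \<mu>0 = 0"
  shows "\<exists>r>0. \<exists>B. cball \<mu>0 r \<subseteq> S \<and> (\<forall>\<mu>\<in>cball \<mu>0 r - {\<mu>0}. regular T \<mu>) \<and> finite B \<and>
    (\<forall>x. \<exists>c. \<forall>i. contour_integral (circlepath \<mu>0 r) (\<lambda>\<mu>. ent (res T \<mu> x) i) = (\<Sum>u\<in>B. c u * u i))"
proof -
  have hol: "pdet holomorphic_on S" "(\<lambda>\<mu>. num1 \<mu> x) holomorphic_on S" "(\<lambda>\<mu>. num2 \<mu> x) holomorphic_on S" for x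
    unfolding pdet_def[abs_def] num1_def num2_def h_def g_def by (intro holomorphic_intros R_holomorphic)+
  have nz: "\<exists>\<mu>\<in>S. pdet \<mu> \<noteq> 0"
    using injective_somewhere eigenvector_if_det_eq_0 by blast
  obtain r where r: "0 < r" "cball \<mu>0 r \<subseteq> S" and hol_q: "zor_poly pdet \<mu>0 holomorphic_on cball \<mu>0 r"
    and q: "\<And>w. w \<in> cball \<mu>0 r \<Longrightarrow> pdet w = zor_poly pdet \<mu>0 w * (w - \<mu>0) ^ nat (zorder pdet \<mu>0) \<and> zor_poly pdet \<mu>0 w \<noteq> 0"
    and n: "zorder pdet \<mu>0 > 0"
    using zorder_exist_zero[OF hol(1) S \<mu>0(1) nz] \<mu>0(2) by auto
  define q' where "q' = zor_poly pdet \<mu>0"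
  obtain N where N: "nat (zorder pdet \<mu>0) = Suc N" using n by (metis not0_implies_Suc zero_less_nat_eq less_not_refl)
  have q: "pdet w = q' w * (w - \<mu>0) ^ Suc N" "q' w \<noteq> 0" if "w \<in> cball \<mu>0 r" for w
    using q[OF that] unfolding N q'_def[symmetric] by auto
  have det_nz: "pdet \<mu> \<noteq> 0" if "\<mu> \<in> cball \<mu>0 r - {\<mu>0}" for \<mu> using q[of \<mu>] that by auto
  \<comment> \<open>The smaller circle lies, with its interior, in an open ball on which the
    cofactor \<open>q'\<close> is holomorphic and nonzero.\<close>
  define s where "s = r / 2"
  have s: "0 < s" "cball \<mu>0 s \<subseteq> ball \<mu>0 r" "cball \<mu>0 s \<subseteq> cball \<mu>0 r" using r by (auto simp: s_def)
  have ball: "ball \<mu>0 r \<subseteq> S" "ball \<mu>0 r \<subseteq> cball \<mu>0 r" using r by auto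
  have hol_q': "q' holomorphic_on ball \<mu>0 r" using hol_q ball holomorphic_on_subset by (auto simp: q'_def)
  have hol_h: "(\<lambda>\<mu>. ent (h \<mu>) i) holomorphic_on ball \<mu>0 r" "(\<lambda>\<mu>. ent (g \<mu>) i) holomorphic_on ball \<mu>0 r"
    "(\<lambda>\<mu>. ent (R \<mu> x) i) holomorphic_on ball \<mu>0 r" for i x
    unfolding h_def g_def using R_holomorphic ball holomorphic_on_subset by blast+
  have hol_num: "(\<lambda>\<mu>. num1 \<mu> x / q' \<mu>) holomorphic_on ball \<mu>0 r" "(\<lambda>\<mu>. num2 \<mu> x / q' \<mu>) holomorphic_on ball \<mu>0 r" for x
    using ball q(2) by (auto intro!: holomorphic_intros hol_q' holomorphic_on_subset[OF hol(2)] holomorphic_on_subset[OF hol(3)])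
  \<comment> \<open>\<open>bh\<close> and \<open>bg\<close> are the spanning sequences;
    \<open>x\<close> enters only through the coefficients \<open>ch\<close> and \<open>cg\<close>
    below.\<close>
  define bh where "bh l i = (deriv ^^ (N - l)) (\<lambda>\<mu>. ent (h \<mu>) i) \<mu>0" for l i
  define bg where "bg l i = (deriv ^^ (N - l)) (\<lambda>\<mu>. ent (g \<mu>) i) \<mu>0" for l i
  define b where "b = case_sum bh bg"
  define I where "I = {..N} <+> {..N}"
  have I: "finite I" by (simp add: I_def)
  have "\<exists>c. \<forall>i. contour_integral (circlepath \<mu>0 s) (\<lambda>\<mu>. ent (res T \<mu> x) i) = (\<Sum>u\<in>b ` I. c u * u i)" for x
  proof -
    define ch where "ch l = - (2 * of_real pi * \<i> / fact N * of_nat (N choose l) * (deriv ^^ l) (\<lambda>\<mu>. num1 \<mu> x / q' \<mu>) \<mu>0)" for l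
    define cg where "cg l = - (2 * of_real pi * \<i> / fact N * of_nat (N choose l) * (deriv ^^ l) (\<lambda>\<mu>. num2 \<mu> x / q' \<mu>) \<mu>0)" for l
    define c where "c = case_sum ch cg"
    have int: "contour_integral (circlepath \<mu>0 s) (\<lambda>\<mu>. ent (res T \<mu> x) i) = (\<Sum>l\<in>I. c l * b l i)" for i
    proof -
      \<comment> \<open>The regular term is written with a factor \<mu> - \<mu>0 over a simple pole,
        so the same formula returns 0 for it.\<close>
      have "((\<lambda>\<mu>. (\<mu> - \<mu>0) * ent (R \<mu> x) i / (\<mu> - \<mu>0) ^ Suc 0) has_contour_integral 0) (circlepath \<mu>0 s)"
        using circle_integral_mult_pole[OF open_ball s(2,1) _ hol_h(3), of "\<lambda>\<mu>. \<mu> - \<mu>0" x i 0]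
        by (simp add: holomorphic_intros)
      moreover have "((\<lambda>\<mu>. (num1 \<mu> x / q' \<mu>) * ent (h \<mu>) i / (\<mu> - \<mu>0) ^ Suc N) has_contour_integral
          (\<Sum>l\<le>N. - ch l * bh l i)) (circlepath \<mu>0 s)"
        using circle_integral_mult_pole[OF open_ball s(2,1) hol_num(1) hol_h(1), of x i N]
        by (simp add: ch_def bh_def)
      moreover have "((\<lambda>\<mu>. (num2 \<mu> x / q' \<mu>) * ent (g \<mu>) i / (\<mu> - \<mu>0) ^ Suc N) has_contour_integral
          (\<Sum>l\<le>N. - cg l * bg l i)) (circlepath \<mu>0 s)"
        using circle_integral_mult_pole[OF open_ball s(2,1) hol_num(2) hol_h(2), of x i N]
        by (simp add: cg_def bg_def)
      ultimately have "((\<lambda>\<mu>. (\<mu> - \<mu>0) * ent (R \<mu> x) i / (\<mu> - \<mu>0) ^ Suc 0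
          - (num1 \<mu> x / q' \<mu>) * ent (h \<mu>) i / (\<mu> - \<mu>0) ^ Suc N
          - (num2 \<mu> x / q' \<mu>) * ent (g \<mu>) i / (\<mu> - \<mu>0) ^ Suc N)
        has_contour_integral (0 - (\<Sum>l\<le>N. - ch l * bh l i) - (\<Sum>l\<le>N. - cg l * bg l i))) (circlepath \<mu>0 s)"
        by (intro has_contour_integral_diff)
      then have "((\<lambda>\<mu>. ent (res T \<mu> x) i)
        has_contour_integral (0 - (\<Sum>l\<le>N. - ch l * bh l i) - (\<Sum>l\<le>N. - cg l * bg l i))) (circlepath \<mu>0 s)"
      proof (rule has_contour_integral_eq)
        fix \<mu> assume "\<mu> \<in> path_image (circlepath \<mu>0 s)"
        then have "\<mu> \<in> sphere \<mu>0 s" using s(1) by simp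
        then have \<mu>: "\<mu> \<in> cball \<mu>0 r" "\<mu> \<noteq> \<mu>0" using s by auto
        then have "\<mu> \<in> S" "pdet \<mu> \<noteq> 0" using r det_nz by auto
        then show "(\<mu> - \<mu>0) * ent (R \<mu> x) i / (\<mu> - \<mu>0) ^ Suc 0
          - (num1 \<mu> x / q' \<mu>) * ent (h \<mu>) i / (\<mu> - \<mu>0) ^ Suc N
          - (num2 \<mu> x / q' \<mu>) * ent (g \<mu>) i / (\<mu> - \<mu>0) ^ Suc N = ent (res T \<mu> x) i"
          using \<mu>(2) q[OF \<mu>(1)] by (simp add: res_T)
      qed
      then have "contour_integral (circlepath \<mu>0 s) (\<lambda>\<mu>. ent (res T \<mu> x) i)
          = (\<Sum>l\<le>N. ch l * bh l i) + (\<Sum>l\<le>N. cg l * bg l i)"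
        by (simp add: contour_integral_unique sum_negf)
      also have "\<dots> = (\<Sum>l\<in>I. c l * b l i)"
        unfolding I_def by (subst sum.Plus) (simp_all add: c_def b_def)
      finally show ?thesis .
    qed
    show ?thesis unfolding int by (rule finite_image_sum[OF I])
  qed
  moreover have "regular T \<mu>" if "\<mu> \<in> cball \<mu>0 s - {\<mu>0}" for \<mu>
    using that s(3) r(2) by (intro regular_if_det_neq_0 det_nz) auto
  ultimately show ?thesis using s r(2) I
    by (intro exI[of _ s] conjI exI[of _ "b ` I"]) auto
qed

end

section \<open>The operator with lattice weights\<close>

lift_definition unit :: "int \<Rightarrow> zl2" is "\<lambda>m n. if n = m then 1 else 0"
proof -
  fix m :: int
  have "(\<Sum>n\<in>F. (cmod (if n = m then 1 else 0))\<^sup>2) \<le> 1" if "finite F" for F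
  proof -
    have "(\<Sum>n\<in>F. (cmod (if n = m then 1 else 0))\<^sup>2) = (\<Sum>n\<in>F. if n = m then 1 else 0)"
      by (intro sum.cong) auto
    also have "\<dots> \<le> 1" using that by (simp add: sum.delta)
    finally show ?thesis .
  qed
  from zl2_membership[of "\<lambda>n. if n = m then 1 else 0", OF this]
  show "(\<lambda>n. (cmod (if n = m then 1 else 0))\<^sup>2) summable_on UNIV" by simp
qed

lemma ent_unit [simp]: "ent (unit m) n = (if n = m then 1 else 0)" by transfer simp

lemma norm_unit: "norm (unit m) \<le> 1"
proof (rule norm_zl2_leI)
  fix F :: "int set" assume "finite F"
  have "(\<Sum>n\<in>F. (cmod (ent (unit m) n))\<^sup>2) = (\<Sum>n\<in>F. if n = m then 1 else 0)"
    by (intro sum.cong) auto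
  also have "\<dots> \<le> 1\<^sup>2" using \<open>finite F\<close> by (simp add: sum.delta)
  finally show "(\<Sum>n\<in>F. (cmod (ent (unit m) n))\<^sup>2) \<le> 1\<^sup>2" .
qed simp

lemma decaying_ent: "decaying (\<lambda>n. cmod (ent x n))"
  unfolding decaying_def
proof (intro allI impI)
  fix e :: real assume e: "e > 0"
  show "finite {n. e \<le> \<bar>cmod (ent x n)\<bar>}"
  proof (rule ccontr)
    assume inf: "infinite {n. e \<le> \<bar>cmod (ent x n)\<bar>}"
    obtain N where N: "(norm x)\<^sup>2 / e\<^sup>2 < real N" using reals_Archimedean2 by blast
    obtain F where F: "finite F" "card F = N" "F \<subseteq> {n. e \<le> \<bar>cmod (ent x n)\<bar>}"
      using infinite_arbitrarily_large[OF inf] by blast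
    have "real N * e\<^sup>2 = (\<Sum>n\<in>F. e\<^sup>2)" using F by simp
    also have "\<dots> \<le> (\<Sum>n\<in>F. (cmod (ent x n))\<^sup>2)"
      using F(3) e by (intro sum_mono power_mono) auto
    also have "\<dots> \<le> (norm x)\<^sup>2" by (rule sum_ent_le[OF F(1)])
    finally show False using N e by (simp add: field_simps)
  qed
qed

definition imag_segment :: "real \<Rightarrow> complex set" where
  "imag_segment R = {\<i> * of_real t | t. \<bar>t\<bar> \<le> R}"

lemma imag_segment_image: "imag_segment R = (\<lambda>t. \<i> * of_real t) ` {- R..R}"
  by (auto simp: imag_segment_def abs_le_iff)

lemma compact_imag_segment: "compact (imag_segment R)"
  unfolding imag_segment_image by (intro compact_continuous_image continuous_intros) auto

lemma convex_imag_segment: "convex (imag_segment R)"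
  unfolding imag_segment_image
  by (intro convex_linear_image linearI) (auto simp: algebra_simps scaleR_conv_of_real)

lemma open_connected_compl_imag_segment: "open (- imag_segment R)" "connected (- imag_segment R)"
proof -
  show "open (- imag_segment R)"
    using compact_imag_segment compact_imp_closed open_Compl by blast
  show "connected (- imag_segment R)"
    by (rule connected_complement_bounded_convex)
       (auto simp: compact_imp_bounded compact_imag_segment convex_imag_segment)
qed

lemma imag_segment_memI: "\<bar>t\<bar> \<le> R \<Longrightarrow> \<i> * of_real t \<in> imag_segment R"
  by (auto simp: imag_segment_def)

lemma inner_cscale: "cscale c x \<bullet> y = x \<bullet> cscale (cnj c) y"
  by (subst (1 2) cscale_eq) (simp add: inner_add_left inner_diff_right inner_cscale_i)

context line_weights
begin

lemma \<rho>_bounded: "\<bar>\<rho> n\<bar> \<le> r + r / (1 - s2)"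
proof -
  have "r / ((real_of_int n + c)\<^sup>2 - s2 + 1) \<le> r / (1 - s2)"
    using r s2 denominator_pos[of n] by (intro divide_left_mono mult_pos_pos) auto
  then show ?thesis using \<rho>_plus_r[of n] \<rho>_gt[of n] r by linarith
qed

lemmas ent_L = ent_jacobi[of \<rho>, OF \<rho>_bounded]

lemma clinear_bounded_L: "clinear_bounded (jacobi a \<rho>)"
  by (rule clinear_bounded_jacobi[OF \<rho>_bounded])

text \<open>Multiplying the equation for \<open>x\<close> by \<rho> gives u = \<rho> x a recurrence
  with real coefficients, so the real result applies to Re u and Im u separately.\<close>

lemma no_embedded_eigenvalue:
  assumes a: "a \<noteq> 0" and t: "\<bar>t\<bar> \<le> 2 * \<bar>a\<bar> * r" "t \<noteq> 0 \<or> (\<forall>n. \<rho> n \<noteq> 0)"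
    and x: "jacobi a \<rho> x = cscale (\<i> * of_real t) x"
  shows "x = 0"
proof -
  define \<nu> where "\<nu> = t / a"
  have \<nu>: "\<bar>\<nu>\<bar> \<le> 2 * r" using t a by (simp add: \<nu>_def abs_divide field_simps)
  have eq: "of_real \<nu> * ent x n = of_real (\<rho> (n - 1)) * ent x (n - 1) + of_real (\<rho> (n + 1)) * ent x (n + 1)" for n
  proof -
    have "\<i> * of_real a * (of_real (\<rho> (n - 1)) * ent x (n - 1) + of_real (\<rho> (n + 1)) * ent x (n + 1)) = \<i> * of_real t * ent x n"
      using arg_cong[OF x, of "\<lambda>x. ent x n"] unfolding ent_L by simp
    then have "\<i> * (of_real a * (of_real (\<rho> (n - 1)) * ent x (n - 1) + of_real (\<rho> (n + 1)) * ent x (n + 1))) = \<i> * (of_real t * ent x n)"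
      by (simp only: mult.assoc)
    then have "of_real a * (of_real (\<rho> (n - 1)) * ent x (n - 1) + of_real (\<rho> (n + 1)) * ent x (n + 1)) = of_real t * ent x n"
      by simp
    then show ?thesis using a by (simp add: \<nu>_def field_simps)
  qed
  have u: "ent (diag \<rho> x) n = \<rho> n *\<^sub>R ent x n" for n by (rule ent_diag[OF \<rho>_bounded])
  have zero: "p (ent (diag \<rho> x) n) = 0"
    if p: "\<And>z. \<bar>p z\<bar> \<le> cmod z" "\<And>y z. p (y + z) = p y + p z" "\<And>s z. p (of_real s * z) = s * p z" for p n
  proof (rule no_embedded_solution[OF \<nu>])
    show "decaying (\<lambda>n. p (ent (diag \<rho> x) n))"
      by (rule decaying_mono[OF decaying_ent[of "diag \<rho> x"]]) (simp add: p(1))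
    show "\<nu> * p (ent (diag \<rho> x) n) = \<rho> n * (p (ent (diag \<rho> x) (n + 1)) + p (ent (diag \<rho> x) (n - 1)))" for n
    proof -
      have "\<nu> * p (ent (diag \<rho> x) n) = \<rho> n * p (of_real \<nu> * ent x n)"
        by (simp add: u scaleR_conv_of_real p(3))
      also have "\<dots> = \<rho> n * (p (ent (diag \<rho> x) (n + 1)) + p (ent (diag \<rho> x) (n - 1)))"
        unfolding eq by (simp add: u scaleR_conv_of_real p(2))
      finally show ?thesis .
    qed
    show "\<nu> \<noteq> 0 \<or> (\<forall>n. \<rho> n \<noteq> 0)" using t(2) a by (simp add: \<nu>_def)
  qed
  have "ent (diag \<rho> x) n = 0" for n
    using zero[of Re n] zero[of Im n] by (simp add: abs_Re_le_cmod abs_Im_le_cmod complex_eq_iff)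
  then have \<rho>x: "of_real (\<rho> n) * ent x n = 0" for n using u[of n] by (simp add: scaleR_conv_of_real)
  \<comment> \<open>From \<rho> x = 0 follows \<nu> x = 0, which suffices for \<nu> \<noteq> 0; for
    \<nu> = 0 no weight vanishes.\<close>
  show ?thesis
  proof (rule zl2_eqI)
    show "ent x n = ent 0 n" for n
      using eq[of n] \<rho>x[of n] \<rho>x[of "n - 1"] \<rho>x[of "n + 1"] t(2) a by (auto simp: \<nu>_def)
  qed
qed

(* With S the shift, a vector y orthogonal to the range satisfies a rho (S + S^-1) y = t y,
   which makes (S + S^-1) y an eigenvector. *)
lemma dense_range:
  assumes a: "a \<noteq> 0" and inj: "\<And>x. jacobi a \<rho> x = cscale (\<i> * of_real t) x \<Longrightarrow> x = 0" and e: "e > 0"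
  shows "\<exists>x. norm (jacobi a \<rho> x - cscale (\<i> * of_real t) x - f) < e"
proof -
  define D where "D x = jacobi a \<rho> x - cscale (\<i> * of_real t) x" for x
  have bl: "bounded_linear D" unfolding D_def by (rule bounded_linear_minus_cscale[OF clinear_bounded_L])
  have "f \<in> closure (range D)"
  proof (rule ccontr)
    assume "f \<notin> closure (range D)"
    then obtain y where y: "y \<noteq> 0" "\<And>v. v \<in> range D \<Longrightarrow> y \<bullet> v = 0"
      using nondense_subspace_orthogonal[OF linear_subspace_image[OF bounded_linear.linear[OF bl] subspace_UNIV]] by blast
    define z where "z = shift 1 y + shift (- 1) y"
    \<comment> \<open>\<open>q\<close> is the adjoint of \<open>D\<close> applied to
      \<open>y\<close>: S and S^-1 are adjoint to each other and \<open>diag \<rho>\<close> is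
      self-adjoint.\<close>
    define q where "q = diag \<rho> (cscale (cnj (\<i> * of_real a)) z) - cscale (cnj (\<i> * of_real t)) y"
    have "x \<bullet> q = 0" for x
    proof -
      have "D x \<bullet> y = x \<bullet> q"
        unfolding D_def q_def jacobi_def z_def inner_diff_left inner_diff_right inner_cscale inner_diag[OF \<rho>_bounded, symmetric]
        by (simp add: inner_add_left inner_add_right inner_shift cscale_shift algebra_simps bounded_linear.linear[OF bounded_linear_cscale] linear_add)
      then show ?thesis using y(2)[of "D x"] by (simp add: inner_commute)
    qed
    then have "q = 0" by (metis inner_eq_zero_iff)
    then have zy: "of_real a * of_real (\<rho> n) * ent z n = of_real t * ent y n" for n
    proof -
      have "ent q n = 0" using \<open>q = 0\<close> by simp
      then have "\<i> * (of_real a * of_real (\<rho> n) * ent z n) = \<i> * (of_real t * ent y n)"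
        by (simp add: q_def ent_diag[OF \<rho>_bounded] scaleR_conv_of_real algebra_simps)
      then show ?thesis by simp
    qed
    have "z = 0"
    proof (rule inj, rule zl2_eqI)
      fix n
      have "ent (jacobi a \<rho> z) n = \<i> * (of_real a * of_real (\<rho> (n - 1)) * ent z (n - 1) + of_real a * of_real (\<rho> (n + 1)) * ent z (n + 1))"
        unfolding ent_L by (simp add: algebra_simps)
      also have "\<dots> = ent (cscale (\<i> * of_real t) z) n"
        unfolding zy by (simp add: z_def algebra_simps)
      finally show "ent (jacobi a \<rho> z) n = ent (cscale (\<i> * of_real t) z) n" .
    qed
    have "y = 0"
    proof (rule zl2_eqI)
      fix n
      have "cmod (ent y n) = 0"
      proof (rule decaying_antiperiodic[OF decaying_ent])
        fix m
        have "ent z m = 0" using \<open>z = 0\<close> by simp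
        then have "ent y (m + 1) = - ent y (m - 1)" by (simp add: z_def eq_neg_iff_add_eq_0)
        then show "\<bar>cmod (ent y (m + 1))\<bar> = \<bar>cmod (ent y (m - 1))\<bar>" by simp
      qed
      then show "ent y n = ent 0 n" by simp
    qed
    then show False using y(1) by simp
  qed
  then obtain v where "v \<in> range D" "dist v f < e" using closure_approachable e by blast
  then show ?thesis by (auto simp: D_def dist_norm)
qed

text \<open>The truncated waves \<open>w N\<close> are left unnormalised: their norms grow at least
  like the square root of N, while their images under the shifted operator stay bounded by
  \<open>M\<close>.\<close>

lemma not_bounded_below:
  assumes a: "a \<noteq> 0" and t: "\<bar>t\<bar> \<le> 2 * \<bar>a\<bar> * r"
  shows "\<not> (\<exists>C. \<forall>x. norm x \<le> C * norm (jacobi a \<rho> x - cscale (\<i> * of_real t) x))"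
proof
  assume "\<exists>C. \<forall>x. norm x \<le> C * norm (jacobi a \<rho> x - cscale (\<i> * of_real t) x)"
  then obtain C where C: "\<And>x. norm x \<le> C * norm (jacobi a \<rho> x - cscale (\<i> * of_real t) x)" by blast
  \<comment> \<open>The limit operator -i a r (S + S^-1) multiplies the wave of frequency \<theta>
    by -2 i a r cos \<theta>, which is to equal i t.\<close>
  define \<theta> where "\<theta> = arccos (- t / (2 * a * r))"
  have "\<bar>- t / (2 * a * r)\<bar> \<le> 1" using t a r by (simp add: abs_mult divide_le_eq)
  then have cos: "cos \<theta> = - t / (2 * a * r)" unfolding \<theta>_def by (simp add: cos_arccos_abs)
  have ta: "t = - 2 * a * r * cos \<theta>" using a r by (simp add: cos)
  define w where "w N = (\<Sum>n<N. cscale (cis (real n * \<theta>)) (unit (int n)))" for N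
  \<comment> \<open>\<open>k N\<close> is (\<rho> + r) times \<open>w N\<close>. The wave lives on
    nonnegative indices, so one-sided summability of \<rho> + r bounds it uniformly in N.\<close>
  define k where "k N = (\<Sum>n<N. cscale (of_real (\<rho> (int n) + r) * cis (real n * \<theta>)) (unit (int n)))" for N
  have step: "2 * of_real (cos \<theta>) * cis (real n * \<theta>) = cis ((real n - 1) * \<theta>) + cis ((real n + 1) * \<theta>)" for n
  proof -
    have "cis ((real n - 1) * \<theta>) = cis (real n * \<theta>) * cis (- \<theta>)" "cis ((real n + 1) * \<theta>) = cis (real n * \<theta>) * cis \<theta>"
      by (simp_all add: cis_mult algebra_simps)
    moreover have "cis (- \<theta>) + cis \<theta> = 2 * of_real (cos \<theta>)" by (simp add: complex_eq_iff)
    ultimately show ?thesis by (metis distrib_left mult.commute)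
  qed
  \<comment> \<open>On the full line the wave is an exact eigenfunction of S + S^-1; truncation
    leaves four end terms.\<close>
  have boundary: "shift (- 1) (w N) + shift 1 (w N) - cscale (2 * of_real (cos \<theta>)) (w N)
      = cscale (cis ((real N - 1) * \<theta>)) (unit (int N)) - cscale (cis (- \<theta>)) (unit 0)
        + unit (- 1) - cscale (cis (real N * \<theta>)) (unit (int N - 1))" for N
  proof (induction N)
    case 0
    show ?case by (rule zl2_eqI) (simp add: w_def)
  next
    case (Suc N)
    have w: "w (Suc N) = w N + cscale (cis (real N * \<theta>)) (unit (int N))" by (simp add: w_def)
    show ?case
    proof (rule zl2_eqI)
      fix n
      have "ent (shift (- 1) (w (Suc N)) + shift 1 (w (Suc N)) - cscale (2 * of_real (cos \<theta>)) (w (Suc N))) n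
        = ent (shift (- 1) (w N) + shift 1 (w N) - cscale (2 * of_real (cos \<theta>)) (w N)) n
          + cis (real N * \<theta>) * ent (unit (int N)) (n - 1) + cis (real N * \<theta>) * ent (unit (int N)) (n + 1)
          - (2 * of_real (cos \<theta>) * cis (real N * \<theta>)) * ent (unit (int N)) n"
        by (simp add: w algebra_simps)
      also have "\<dots> = ent (cscale (cis ((real (Suc N) - 1) * \<theta>)) (unit (int (Suc N))) - cscale (cis (- \<theta>)) (unit 0)
        + unit (- 1) - cscale (cis (real (Suc N) * \<theta>)) (unit (int (Suc N) - 1))) n"
        unfolding Suc.IH step by (auto simp: add.commute)
      finally show "ent (shift (- 1) (w (Suc N)) + shift 1 (w (Suc N)) - cscale (2 * of_real (cos \<theta>)) (w (Suc N))) n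
        = ent (cscale (cis ((real (Suc N) - 1) * \<theta>)) (unit (int (Suc N))) - cscale (cis (- \<theta>)) (unit 0)
        + unit (- 1) - cscale (cis (real (Suc N) * \<theta>)) (unit (int (Suc N) - 1))) n" .
    qed
  qed
  have boundary_norm: "norm (shift (- 1) (w N) + shift 1 (w N) - cscale (2 * of_real (cos \<theta>)) (w N)) \<le> 4" for N
  proof -
    have n: "norm (cscale (cis s) (unit m)) \<le> 1" for s m by (simp add: norm_unit)
    show ?thesis
      unfolding boundary
      using norm_triangle_ineq4[of "cscale (cis ((real N - 1) * \<theta>)) (unit (int N))" "cscale (cis (- \<theta>)) (unit 0)"]
        norm_triangle_ineq[of "cscale (cis ((real N - 1) * \<theta>)) (unit (int N)) - cscale (cis (- \<theta>)) (unit 0)" "unit (- 1)"]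
        norm_triangle_ineq4[of "cscale (cis ((real N - 1) * \<theta>)) (unit (int N)) - cscale (cis (- \<theta>)) (unit 0) + unit (- 1)"
          "cscale (cis (real N * \<theta>)) (unit (int N - 1))"]
        n[of "(real N - 1) * \<theta>" "int N"] n[of "- \<theta>" 0] n[of "real N * \<theta>" "int N - 1"] norm_unit[of "- 1"]
      by linarith
  qed
  define K where "K = (\<Sum>n. \<rho> (int n) + r)"
  have k_norm: "norm (k N) \<le> K" for N
  proof -
    have pos: "0 \<le> \<rho> (int n) + r" for n using \<rho>_gt[of "int n"] by simp
    have "norm (k N) \<le> (\<Sum>n<N. norm (cscale (of_real (\<rho> (int n) + r) * cis (real n * \<theta>)) (unit (int n))))"
      unfolding k_def by (rule norm_sum)
    also have "\<dots> \<le> (\<Sum>n<N. \<rho> (int n) + r)"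
    proof (rule sum_mono)
      fix n
      show "norm (cscale (of_real (\<rho> (int n) + r) * cis (real n * \<theta>)) (unit (int n))) \<le> \<rho> (int n) + r"
        unfolding norm_cscale norm_mult norm_of_real norm_cis using pos[of n] norm_unit[of "int n"]
        by (simp add: mult_left_le)
    qed
    also have "\<dots> \<le> K" unfolding K_def by (rule sum_le_suminf[OF summable_\<rho>_plus_r]) (use pos in auto)
    finally show ?thesis .
  qed
  have diag_w: "diag \<rho> (w N) = k N - r *\<^sub>R w N" for N
  proof (rule zl2_eqI)
    fix n
    have "of_real (\<rho> n) * ent (w N) n = ent (k N) n - of_real r * ent (w N) n"
      unfolding w_def k_def ent_sum ent_cscale sum_distrib_left sum_subtractf[symmetric]
      by (intro sum.cong refl) (auto simp: algebra_simps)
    then show "ent (diag \<rho> (w N)) n = ent (k N - r *\<^sub>R w N) n"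
      by (simp add: ent_diag[OF \<rho>_bounded] scaleR_conv_of_real)
  qed
  have decomp: "jacobi a \<rho> (w N) - cscale (\<i> * of_real t) (w N) = cscale (\<i> * of_real a) (shift (- 1) (k N) + shift 1 (k N))
      - cscale (\<i> * of_real (a * r)) (shift (- 1) (w N) + shift 1 (w N) - cscale (2 * of_real (cos \<theta>)) (w N))" for N
    by (rule zl2_eqI) (simp add: jacobi_def diag_w ta scaleR_conv_of_real algebra_simps)
  define M where "M = \<bar>a\<bar> * (2 * K) + \<bar>a * r\<bar> * 4"
  have M: "norm (jacobi a \<rho> (w N) - cscale (\<i> * of_real t) (w N)) \<le> M" for N
  proof -
    have "norm (jacobi a \<rho> (w N) - cscale (\<i> * of_real t) (w N)) \<le> \<bar>a\<bar> * norm (shift (- 1) (k N) + shift 1 (k N))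
      + \<bar>a * r\<bar> * norm (shift (- 1) (w N) + shift 1 (w N) - cscale (2 * of_real (cos \<theta>)) (w N))"
      unfolding decomp by (rule order_trans[OF norm_triangle_ineq4]) (simp add: norm_mult abs_mult)
    also have "\<dots> \<le> \<bar>a\<bar> * (2 * K) + \<bar>a * r\<bar> * 4"
      using norm_triangle_ineq[of "shift (- 1) (k N)" "shift 1 (k N)"] k_norm[of N]
      by (intro add_mono mult_left_mono boundary_norm) auto
    finally show ?thesis by (simp add: M_def)
  qed
  have w_norm: "real N \<le> (norm (w N))\<^sup>2" for N
  proof -
    have ent_w: "ent (w N) (int n) = cis (real n * \<theta>)" if "n < N" for n
    proof -
      have "ent (w N) (int n) = (\<Sum>m<N. if m = n then cis (real m * \<theta>) else 0)"
        unfolding w_def ent_sum by (intro sum.cong) auto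
      then show ?thesis using that by simp
    qed
    have "real N = (\<Sum>n<N. (cmod (ent (w N) (int n)))\<^sup>2)" by (simp add: ent_w)
    also have "\<dots> = (\<Sum>m\<in>int ` {..<N}. (cmod (ent (w N) m))\<^sup>2)"
      by (subst sum.reindex) (auto simp: inj_on_def)
    also have "\<dots> \<le> (norm (w N))\<^sup>2" by (rule sum_ent_le) simp
    finally show ?thesis .
  qed
  have "real N \<le> (\<bar>C\<bar> * M)\<^sup>2" for N
  proof -
    have "norm (w N) \<le> \<bar>C\<bar> * norm (jacobi a \<rho> (w N) - cscale (\<i> * of_real t) (w N))"
      by (rule order_trans[OF C mult_right_mono]) auto
    also have "\<dots> \<le> \<bar>C\<bar> * M" by (intro mult_left_mono M) auto
    finally have "(norm (w N))\<^sup>2 \<le> (\<bar>C\<bar> * M)\<^sup>2" by (intro power_mono) auto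
    then show ?thesis using w_norm[of N] by simp
  qed
  then show False using reals_Archimedean2[of "(\<bar>C\<bar> * M)\<^sup>2"] by (metis not_less)
qed

lemma finite_\<rho>_ge: "finite {n. - r / 2 \<le> \<rho> n}"
proof -
  obtain C where C: "0 < C" "\<And>n. \<rho> n + r \<le> C / ((real_of_int n)\<^sup>2 + 1)" using \<rho>_plus_r_bound by blast
  have "{n. - r / 2 \<le> \<rho> n} \<subseteq> {- \<lceil>2 * C / r\<rceil>..\<lceil>2 * C / r\<rceil>}"
  proof
    fix n assume "n \<in> {n. - r / 2 \<le> \<rho> n}"
    then have "- r / 2 \<le> \<rho> n" by blast
    then have "r / 2 \<le> C / ((real_of_int n)\<^sup>2 + 1)" using C(2)[of n] by linarith
    moreover have "0 < (real_of_int n)\<^sup>2 + 1" by (simp add: add_nonneg_pos)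
    ultimately have "(real_of_int n)\<^sup>2 + 1 \<le> 2 * C / r" using r by (simp add: field_simps)
    moreover have "\<bar>real_of_int n\<bar> \<le> (real_of_int n)\<^sup>2 + 1"
      using sum_squares_bound[of "\<bar>real_of_int n\<bar>" 1] by simp
    ultimately have "\<bar>real_of_int n\<bar> \<le> 2 * C / r" by simp
    then show "n \<in> {- \<lceil>2 * C / r\<rceil>..\<lceil>2 * C / r\<rceil>}" by (simp add: abs_le_iff) linarith
  qed
  then show ?thesis using finite_subset by blast
qed

text \<open>Negativity becomes uniform because \<rho> tends to -r: only finitely many weights lie
  above -r/2, and the minimum over these is positive.\<close>

lemma negative_modification:
  obtains m where "0 < m" "\<And>n. (if 0 \<le> \<rho> n then - r else \<rho> n) \<le> - m"
proof -
  define \<rho>' where "\<rho>' n = (if 0 \<le> \<rho> n then - r else \<rho> n)" for n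
  define m where "m = Min (insert (r / 2) ((\<lambda>n. - \<rho>' n) ` {n. - r / 2 \<le> \<rho> n}))"
  have "0 < m" unfolding m_def using r finite_\<rho>_ge by (subst Min_gr_iff) (auto simp: \<rho>'_def)
  moreover have m: "m \<le> - \<rho>' n" for n
  proof (cases "- r / 2 \<le> \<rho> n")
    case True then show ?thesis unfolding m_def using finite_\<rho>_ge by (intro Min_le) auto
  next
    case False
    have "m \<le> r / 2" unfolding m_def using finite_\<rho>_ge by (intro Min_le) auto
    then show ?thesis using False r by (simp add: \<rho>'_def)
  qed
  then have "\<rho>' n \<le> - m" for n by (simp add: le_minus_iff)
  ultimately show thesis using that[of m] unfolding \<rho>'_def by blast
qed

lemma regular_if_all_negative:
  assumes "\<And>n. \<rho> n < 0" "\<mu> \<notin> imag_segment (2 * \<bar>a\<bar> * r)"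
  shows "regular (jacobi a \<rho>) \<mu>"
proof -
  obtain m where m: "0 < m" "\<And>n. (if 0 \<le> \<rho> n then - r else \<rho> n) \<le> - m" using negative_modification by blast
  show ?thesis
    by (rule jacobi_negative_regular[of r \<rho> m])
       (use assms m \<rho>_gt in \<open>auto simp: imag_segment_def less_imp_le not_le[symmetric]\<close>)
qed

lemma rank_two:
  "\<exists>T0 j k \<xi> \<eta>. rank_two_perturbation (jacobi a \<rho>) T0 j k \<xi> \<eta> (- imag_segment (2 * \<bar>a\<bar> * r))"
proof -
  obtain m where m: "0 < m" "\<And>n. (if 0 \<le> \<rho> n then - r else \<rho> n) \<le> - m" using negative_modification by blast
  define \<rho>' where "\<rho>' n = (if 0 \<le> \<rho> n then - r else \<rho> n)" for n
  have \<rho>': "- r \<le> \<rho>' n" "\<rho>' n \<le> - m" "\<bar>\<rho>' n\<bar> \<le> r" for n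
    using m(2)[of n] \<rho>_gt[of n] r m(1) by (auto simp: \<rho>'_def split: if_splits)
  \<comment> \<open>The nonnegative weights sit at \<open>j\<close> and j + 1 at most; with none or
    one of them the perturbation has smaller rank but the same form.\<close>
  obtain j where j: "\<And>n. 0 \<le> \<rho> n \<Longrightarrow> n = j \<or> n = j + 1"
  proof (cases "\<exists>i. 0 \<le> \<rho> i")
    case True
    then obtain i where i: "0 \<le> \<rho> i" by blast
    show thesis
    proof (cases "0 \<le> \<rho> (i - 1)")
      case True
      show thesis
        by (rule that[of "i - 1"]) (use nonneg_weights_adjacent[OF True] nonneg_weights_adjacent[OF i] in force)
    next
      case False
      show thesis
      proof (rule that[of i])
        fix n assume n: "0 \<le> \<rho> n"
        then have "n \<noteq> i - 1" using False by auto
        then show "n = i \<or> n = i + 1" using nonneg_weights_adjacent[OF i n] by auto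
      qed
    qed
  qed (use that in blast)
  define d where "d n = \<i> * of_real a * of_real (\<rho> n - \<rho>' n)" for n
  have d0: "d n = 0" if "n \<noteq> j" "n \<noteq> j + 1" for n using j[of n] that by (auto simp: d_def \<rho>'_def)
  define \<xi> where "\<xi> i = cscale (d i) (unit (i + 1) + unit (i - 1))" for i
  have d_ent: "d n * z n = (if n = j then d j * z j else 0) + (if n = j + 1 then d (j + 1) * z (j + 1) else 0)" for n z
    using d0[of n] by auto
  have "rank_two_perturbation (jacobi a \<rho>) (jacobi a \<rho>') j (j + 1) (\<xi> j) (\<xi> (j + 1)) (- imag_segment (2 * \<bar>a\<bar> * r))"
  proof
    show "clinear_bounded (jacobi a \<rho>')" by (rule clinear_bounded_jacobi[OF \<rho>'(3)])
    show "jacobi a \<rho> x = jacobi a \<rho>' x + cscale (ent x j) (\<xi> j) + cscale (ent x (j + 1)) (\<xi> (j + 1))" for x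
    proof (rule zl2_eqI)
      fix n
      have "ent (jacobi a \<rho> x) n = ent (jacobi a \<rho>' x) n + (d (n - 1) * ent x (n - 1) + d (n + 1) * ent x (n + 1))"
        unfolding ent_L ent_jacobi[OF \<rho>'(3)] d_def by (simp add: algebra_simps)
      also have "d (n - 1) * ent x (n - 1) + d (n + 1) * ent x (n + 1)
          = ent (cscale (ent x j) (\<xi> j) + cscale (ent x (j + 1)) (\<xi> (j + 1))) n"
        unfolding d_ent[of "n - 1" "ent x"] d_ent[of "n + 1" "ent x"] by (auto simp: \<xi>_def)
      finally show "ent (jacobi a \<rho> x) n = ent (jacobi a \<rho>' x + cscale (ent x j) (\<xi> j) + cscale (ent x (j + 1)) (\<xi> (j + 1))) n"
        by simp
    qed
    show "regular (jacobi a \<rho>') \<mu>" if "\<mu> \<in> - imag_segment (2 * \<bar>a\<bar> * r)" for \<mu>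
      by (rule jacobi_negative_regular[OF \<rho>'(1,2) m(1)]) (use that in \<open>simp add: imag_segment_def\<close>)
    show "\<exists>\<mu>\<in>- imag_segment (2 * \<bar>a\<bar> * r). \<forall>x. jacobi a \<rho> x = cscale \<mu> x \<longrightarrow> x = 0"
    proof -
      \<comment> \<open>A positive number beyond a bound on the operator norm is no eigenvalue and
        lies off the imaginary axis.\<close>
      obtain K where K: "0 < K" "\<And>x. norm (jacobi a \<rho> x) \<le> norm x * K"
        using bounded_linear.pos_bounded clinear_bounded_L unfolding clinear_bounded_def by blast
      have "x = 0" if "jacobi a \<rho> x = cscale (of_real (K + 1)) x" for x
      proof -
        have "(K + 1) * norm x \<le> norm x * K" using K(2)[of x] K(1) unfolding that by (simp only: norm_cscale norm_of_real)
        then have "norm x \<le> 0" by (simp add: algebra_simps)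
        then show ?thesis by simp
      qed
      moreover have "of_real (K + 1) \<notin> imag_segment (2 * \<bar>a\<bar> * r)"
        using K(1) by (auto simp: imag_segment_def complex_eq_iff)
      ultimately show ?thesis by blast
    qed
  qed (rule open_connected_compl_imag_segment)+
  then show ?thesis by blast
qed

end

section \<open>Transfer to sequences indexed by 1, 2, ...\<close>

definition idx :: "int \<Rightarrow> nat" where
  "idx n = (if n > 0 then 2 * nat n else 2 * nat (- n) + 1)"

text \<open>Both \<open>pos 0\<close> and \<open>pos 1\<close> are 0; index 0, where the sequences
  in \<open>ell2\<close> vanish, is treated apart.\<close>

definition pos :: "nat \<Rightarrow> int" where
  "pos m = (if even m then int (m div 2) else - int (m div 2))"

lemma pos_idx [simp]: "pos (idx n) = n"
  by (auto simp: pos_def idx_def)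

lemma idx_pos [simp]: "m \<noteq> 0 \<Longrightarrow> idx (pos m) = m"
  by (auto simp: pos_def idx_def elim!: evenE oddE)

lemma idx_neq_0 [simp]: "idx n \<noteq> 0"
  by (auto simp: idx_def)

lemma has_sum_idx:
  assumes "f 0 = 0"
  shows "((\<lambda>n. f (idx n)) has_sum s) UNIV \<longleftrightarrow> (f has_sum s) UNIV"
proof -
  have "bij_betw idx UNIV (- {0})"
    by (rule bij_betwI[of _ _ _ pos]) auto
  from has_sum_reindex_bij_betw[OF this, of f s]
  have "((\<lambda>n. f (idx n)) has_sum s) UNIV \<longleftrightarrow> (f has_sum s) (- {0})" by simp
  also have "\<dots> \<longleftrightarrow> (f has_sum s) UNIV"
    by (rule has_sum_cong_neutral) (use assms in auto)
  finally show ?thesis .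
qed

definition to_zl2 :: "(nat \<Rightarrow> complex) \<Rightarrow> zl2" where
  "to_zl2 z = Abs_zl2 (\<lambda>n. z (idx n))"

definition from_zl2 :: "zl2 \<Rightarrow> nat \<Rightarrow> complex" where
  "from_zl2 x m = (if m = 0 then 0 else ent x (pos m))"

lemma ent_to_zl2: "z \<in> ell2 \<Longrightarrow> ent (to_zl2 z) n = z (idx n)"
proof -
  assume "z \<in> ell2"
  then have z: "z 0 = 0" "summable (\<lambda>m. (cmod (z m))\<^sup>2)" by (auto simp: ell2_def)
  then have "(\<lambda>m. (cmod (z m))\<^sup>2) summable_on UNIV"
    by (subst summable_on_UNIV_nonneg_real_iff) auto
  then have "(\<lambda>n. (cmod (z (idx n)))\<^sup>2) summable_on UNIV"
    using has_sum_idx[of "\<lambda>m. (cmod (z m))\<^sup>2"] z(1) by (auto simp: summable_on_def)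
  then show ?thesis by (simp add: to_zl2_def Abs_zl2_inverse)
qed

lemma from_zl2_sums: "(\<lambda>m. (cmod (from_zl2 x m))\<^sup>2) sums (norm x)\<^sup>2"
proof (rule has_sum_imp_sums)
  have "((\<lambda>n. (cmod (ent x n))\<^sup>2) has_sum (norm x)\<^sup>2) UNIV"
    unfolding norm_sq_zl2 by (intro has_sum_infsum summable_on_ent)
  then show "((\<lambda>m. (cmod (from_zl2 x m))\<^sup>2) has_sum (norm x)\<^sup>2) UNIV"
    using has_sum_idx[of "\<lambda>m. (cmod (from_zl2 x m))\<^sup>2"] by (simp add: from_zl2_def)
qed

lemma from_zl2_in_ell2 [simp]: "from_zl2 x \<in> ell2"
  using sums_summable[OF from_zl2_sums] by (simp add: ell2_def) (simp add: from_zl2_def)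

lemma ell2_norm_from_zl2: "ell2_norm (from_zl2 x) = norm x"
  unfolding ell2_norm_def sums_unique[OF from_zl2_sums[of x], symmetric] by simp

lemma to_from_zl2 [simp]: "to_zl2 (from_zl2 x) = x"
  by (rule zl2_eqI) (simp add: ent_to_zl2 from_zl2_def)

lemma from_to_zl2 [simp]: "z \<in> ell2 \<Longrightarrow> from_zl2 (to_zl2 z) = z"
  by (auto simp: fun_eq_iff from_zl2_def ent_to_zl2 ell2_def)

lemma ell2_eq_range: "ell2 = range from_zl2"
  using from_to_zl2 by (auto intro: rangeI) (metis rangeI from_to_zl2)

lemma from_zl2_inject [simp]: "from_zl2 x = from_zl2 y \<longleftrightarrow> x = y"
  by (metis to_from_zl2)

lemma from_zl2_diff: "from_zl2 (x - y) = (\<lambda>m. from_zl2 x m - from_zl2 y m)"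
  by (auto simp: from_zl2_def)

lemma LA_from_zl2:
  assumes "\<And>n. \<bar>\<rho> n\<bar> \<le> K"
  shows "LA a \<rho> (from_zl2 x) = from_zl2 (jacobi a \<rho> x)"
proof
  fix m :: nat
  note ent = ent_jacobi[of \<rho>, OF assms]
  consider "m = 0" | "m = 1" | "m = 2" | k where "m = 2 * (k + 2)" | k where "m = 2 * (k + 1) + 1"
  proof -
    have "m = 0 \<or> m = 1 \<or> m = 2 \<or> (\<exists>k. m = 2 * (k + 2)) \<or> (\<exists>k. m = 2 * (k + 1) + 1)" by presburger
    then show thesis using that by blast
  qed
  then show "LA a \<rho> (from_zl2 x) m = from_zl2 (jacobi a \<rho> x) m"
  proof cases
    case 1 then show ?thesis by (simp add: LA_def from_zl2_def)
  next
    case 2 then show ?thesis by (simp add: LA_def from_zl2_def pos_def ent add.commute)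
  next
    case 3 then show ?thesis by (simp add: LA_def from_zl2_def pos_def ent)
  next
    case (4 k)
    show ?thesis unfolding 4 by (subst LA_even) (simp_all add: from_zl2_def pos_def ent algebra_simps)
  next
    case (5 k)
    show ?thesis unfolding 5 by (subst LA_odd) (simp_all add: from_zl2_def pos_def ent algebra_simps)
  qed
qed

section \<open>Symmetries of the eigenvalues\<close>

lift_definition conj_seq :: "zl2 \<Rightarrow> zl2" is "\<lambda>f n. cnj (f n)" by simp

lemma ent_conj_seq [simp]: "ent (conj_seq x) n = cnj (ent x n)" by transfer simp

text \<open>The operator is i times a real one, so conjugating an eigenvector turns \<mu> into -cnj
  \<mu>. It couples only even with odd indices, so alternating signs turn \<mu> into -\<mu>.\<close>

lemma jacobi_eigenvalue_symmetric:
  assumes \<rho>: "\<And>n. \<bar>\<rho> n\<bar> \<le> K" and x: "x \<noteq> 0" "jacobi a \<rho> x = cscale \<mu> x"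
  shows "\<exists>y. y \<noteq> 0 \<and> jacobi a \<rho> y = cscale (- cnj \<mu>) y" "\<exists>y. y \<noteq> 0 \<and> jacobi a \<rho> y = cscale (- \<mu>) y"
proof -
  note ent = ent_jacobi[of \<rho>, OF \<rho>]
  have eq: "\<i> * of_real a * (of_real (\<rho> (n - 1)) * ent x (n - 1) + of_real (\<rho> (n + 1)) * ent x (n + 1)) = \<mu> * ent x n" for n
    using arg_cong[OF x(2), of "\<lambda>x. ent x n"] by (simp only: ent ent_cscale)
  obtain m where m: "ent x m \<noteq> 0" using x(1) zl2_eqI[of x 0] by auto
  show "\<exists>y. y \<noteq> 0 \<and> jacobi a \<rho> y = cscale (- cnj \<mu>) y"
  proof (intro exI conjI zl2_eqI)
    show "conj_seq x \<noteq> 0" using m by (metis ent_conj_seq ent_zero complex_cnj_zero_iff)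
    show "ent (jacobi a \<rho> (conj_seq x)) n = ent (cscale (- cnj \<mu>) (conj_seq x)) n" for n
    proof -
      have "ent (jacobi a \<rho> (conj_seq x)) n = - cnj (\<i> * of_real a *
          (of_real (\<rho> (n - 1)) * ent x (n - 1) + of_real (\<rho> (n + 1)) * ent x (n + 1)))"
        by (simp add: ent)
      then show ?thesis unfolding eq by simp
    qed
  qed
  define s :: "int \<Rightarrow> real" where "s n = (if even n then 1 else - 1)" for n
  have s: "\<bar>s n\<bar> \<le> 1" "s (n + 1) = - s n" "s (n - 1) = - s n" for n by (auto simp: s_def)
  note ent_s = ent_diag[of s, OF s(1)]
  show "\<exists>y. y \<noteq> 0 \<and> jacobi a \<rho> y = cscale (- \<mu>) y"
  proof (intro exI conjI zl2_eqI)
    have "ent (diag s x) m \<noteq> 0" unfolding ent_s using m by (simp add: s_def)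
    then show "diag s x \<noteq> 0" by auto
    show "ent (jacobi a \<rho> (diag s x)) n = ent (cscale (- \<mu>) (diag s x)) n" for n
    proof -
      have "ent (jacobi a \<rho> (diag s x)) n = - of_real (s n) * (\<i> * of_real a *
          (of_real (\<rho> (n - 1)) * ent x (n - 1) + of_real (\<rho> (n + 1)) * ent x (n + 1)))"
        unfolding ent ent_s s scaleR_conv_of_real by (simp add: algebra_simps)
      then show ?thesis unfolding eq by (simp add: ent_s scaleR_conv_of_real)
    qed
  qed
qed

section \<open>Spectra of an operator carried over to \<open>ell2\<close>\<close>

locale transferred_operator =
  fixes L :: seq_op and T :: "zl2 \<Rightarrow> zl2"
  assumes T: "clinear_bounded T" and L: "\<And>x. L (from_zl2 x) = from_zl2 (T x)"
begin

lemma shifted_from_zl2: "shifted L \<mu> (from_zl2 x) = from_zl2 (T x - cscale \<mu> x)"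
  by (rule ext) (simp add: shifted_def L from_zl2_def)

lemma inj_shifted_iff: "inj_on (shifted L \<mu>) ell2 \<longleftrightarrow> (\<forall>x. T x = cscale \<mu> x \<longrightarrow> x = 0)"
proof -
  interpret bounded_linear "\<lambda>x. T x - cscale \<mu> x" by (rule bounded_linear_minus_cscale[OF T])
  have "inj_on (shifted L \<mu>) ell2 \<longleftrightarrow> inj (\<lambda>x. T x - cscale \<mu> x)"
    unfolding ell2_eq_range by (auto simp: inj_on_def shifted_from_zl2)
  also have "\<dots> \<longleftrightarrow> (\<forall>x. T x - cscale \<mu> x = 0 \<longrightarrow> x = 0)"
    using linear_injective_0[OF linear_axioms] by simp
  finally show ?thesis by simp
qed

lemma point_spectrum_iff: "\<mu> \<in> point_spectrum L \<longleftrightarrow> (\<exists>x. x \<noteq> 0 \<and> T x = cscale \<mu> x)"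
  by (auto simp: point_spectrum_def inj_shifted_iff)

lemma dense_shifted_iff:
  "ell2_dense (shifted L \<mu> ` ell2) \<longleftrightarrow> (\<forall>f. \<forall>e>0. \<exists>x. norm (T x - cscale \<mu> x - f) < e)"
proof -
  have "ell2_dense (shifted L \<mu> ` ell2) \<longleftrightarrow>
      (\<forall>f. \<forall>e>0. \<exists>x. ell2_norm (\<lambda>n. from_zl2 (T x - cscale \<mu> x) n - from_zl2 f n) < e)"
    unfolding ell2_dense_def ell2_eq_range by (simp add: shifted_from_zl2 image_image)
  then show ?thesis by (simp add: ell2_norm_from_zl2 flip: from_zl2_diff)
qed

lemma resolvent_op_shifted:
  assumes "inj_on (shifted L \<mu>) ell2"
  shows "resolvent_op L \<mu> (from_zl2 (T x - cscale \<mu> x)) = from_zl2 x"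
  unfolding resolvent_op_def shifted_from_zl2[symmetric] by (rule inv_into_f_f[OF assms]) simp

lemma continuous_spectrum_iff:
  "\<mu> \<in> continuous_spectrum L \<longleftrightarrow> inj_on (shifted L \<mu>) ell2 \<and> ell2_dense (shifted L \<mu> ` ell2) \<and>
    \<not> (\<exists>C. \<forall>x. norm x \<le> C * norm (T x - cscale \<mu> x))"
proof -
  have "(\<forall>w\<in>shifted L \<mu> ` ell2. ell2_norm (resolvent_op L \<mu> w) \<le> C * ell2_norm w)
      \<longleftrightarrow> (\<forall>x. norm x \<le> C * norm (T x - cscale \<mu> x))" if "inj_on (shifted L \<mu>) ell2" for C
    unfolding ell2_eq_range
    by (simp add: shifted_from_zl2 image_image resolvent_op_shifted[OF that] ell2_norm_from_zl2)
  then show ?thesis unfolding continuous_spectrum_def mem_Collect_eq by blast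
qed

lemma regular_inj_shifted: "regular T \<mu> \<Longrightarrow> inj_on (shifted L \<mu>) ell2"
  unfolding inj_shifted_iff
proof (intro allI impI)
  fix x assume "regular T \<mu>" and x: "T x = cscale \<mu> x"
  then obtain \<delta> where "0 < \<delta>" "\<delta> * norm x \<le> norm (T x - cscale \<mu> x)"
    unfolding regular_def by blast
  then show "x = 0" by (simp add: x mult_le_0_iff)
qed

lemma regular_not_in_spectrum:
  assumes "regular T \<mu>"
  shows "\<mu> \<notin> spectrum L"
proof -
  obtain \<delta> where \<delta>: "0 < \<delta>" "\<And>x. \<delta> * norm x \<le> norm (T x - cscale \<mu> x)" and s: "surj (\<lambda>x. T x - cscale \<mu> x)"
    using assms by (auto simp: regular_def)
  have "norm x \<le> 1 / \<delta> * norm (T x - cscale \<mu> x)" for x using \<delta>(2)[of x] \<delta>(1) by (simp add: field_simps)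
  then have "\<mu> \<notin> continuous_spectrum L" unfolding continuous_spectrum_iff by blast
  moreover have "ell2_dense (shifted L \<mu> ` ell2)"
    unfolding dense_shifted_iff
  proof (intro allI impI)
    fix f :: zl2 and e :: real assume "e > 0"
    obtain x where "f = T x - cscale \<mu> x" using s by (rule surjE)
    then show "\<exists>x. norm (T x - cscale \<mu> x - f) < e" using \<open>e > 0\<close> by (intro exI[of _ x]) simp
  qed
  ultimately show ?thesis using regular_inj_shifted[OF assms]
    by (auto simp: spectrum_def point_spectrum_def residual_spectrum_def)
qed

lemma resolvent_op_regular:
  assumes "regular T \<mu>"
  shows "resolvent_op L \<mu> (from_zl2 x) = from_zl2 (res T \<mu> x)"
  using resolvent_op_shifted[OF regular_inj_shifted[OF assms], of "res T \<mu> x"] res_right[OF T assms, of x] by simp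

lemma in_discrete_spectrum:
  assumes r: "0 < r" and reg: "\<And>\<mu>. \<mu> \<in> cball \<mu>0 r - {\<mu>0} \<Longrightarrow> regular T \<mu>" and eig: "\<mu>0 \<in> point_spectrum L"
    and B: "finite B"
      "\<And>x. \<exists>c. \<forall>i. contour_integral (circlepath \<mu>0 r) (\<lambda>\<mu>. ent (res T \<mu> x) i) = (\<Sum>u\<in>B. c u * u i)"
  shows "\<mu>0 \<in> discrete_spectrum L"
proof -
  have "\<mu>0 \<in> spectrum L" using eig by (simp add: spectrum_def)
  moreover have "\<mu> = \<mu>0" if "\<mu> \<in> spectrum L" "\<mu> \<in> cball \<mu>0 r" for \<mu>
    using regular_not_in_spectrum[OF reg[of \<mu>]] that by blast
  ultimately have iso: "spectrum L \<inter> cball \<mu>0 r = {\<mu>0}" using r by auto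
  have "\<mu>0 \<in> ball \<mu>0 r" using r by simp
  then have "ball \<mu>0 r \<inter> spectrum L = {\<mu>0}" using iso ball_subset_cball[of \<mu>0 r] by blast
  then have "\<mu>0 isolated_in spectrum L"
    using \<open>\<mu>0 \<in> spectrum L\<close> by (auto simp: isolated_in_def intro!: exI[of _ "ball \<mu>0 r"])
  moreover have "finite_dimensional (riesz_projection L \<mu>0 r ` ell2)"
  proof -
    \<comment> \<open>The spanning sequences are carried over to natural indices, with the value 0
      at index 0.\<close>
    define b where "b u m = (if m = 0 then 0 else u (pos m))" for u :: "int \<Rightarrow> complex" and m
    have "\<exists>c. riesz_projection L \<mu>0 r (from_zl2 x) = (\<lambda>m. \<Sum>v\<in>b ` B. c v * v m)" for x
    proof -
      obtain c where c: "contour_integral (circlepath \<mu>0 r) (\<lambda>\<mu>. ent (res T \<mu> x) i) = (\<Sum>u\<in>B. c u * u i)" for i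
        using B(2)[of x] by blast
      have "riesz_projection L \<mu>0 r (from_zl2 x) m = (\<Sum>u\<in>B. (- 1 / (2 * of_real pi * \<i>) * c u) * b u m)" for m
      proof -
        have "contour_integral (circlepath \<mu>0 r) (\<lambda>\<mu>. resolvent_op L \<mu> (from_zl2 x) m)
          = contour_integral (circlepath \<mu>0 r) (\<lambda>\<mu>. if m = 0 then 0 else ent (res T \<mu> x) (pos m))"
        proof (rule contour_integral_eq)
          fix \<mu> assume "\<mu> \<in> path_image (circlepath \<mu>0 r)"
          then have "\<mu> \<in> cball \<mu>0 r - {\<mu>0}" using r by auto
          from resolvent_op_regular[OF reg[OF this]]
          show "resolvent_op L \<mu> (from_zl2 x) m = (if m = 0 then 0 else ent (res T \<mu> x) (pos m))"
            by (simp add: from_zl2_def)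
        qed
        also have "\<dots> = (\<Sum>u\<in>B. c u * b u m)" by (cases "m = 0") (simp_all add: b_def c)
        finally show ?thesis by (simp add: riesz_projection_def sum_distrib_left mult.assoc sum_divide_distrib sum_negf)
      qed
      then show ?thesis
        using finite_image_sum[OF B(1), of "\<lambda>u. - 1 / (2 * of_real pi * \<i>) * c u" b] by (auto simp: fun_eq_iff)
    qed
    then show ?thesis
      unfolding finite_dimensional_def ell2_eq_range using B(1) by (intro exI[of _ "b ` B"]) auto
  qed
  ultimately show ?thesis
    using eig r iso by (auto simp: discrete_spectrum_def finite_algebraic_multiplicity_def)
qed

end

section \<open>The spectrum\<close>

context line_weights
begin

context
  fixes a :: real and L :: seq_op
  assumes a: "a \<noteq> 0" and L_eq: "L = LA a \<rho>"
begin

interpretation transferred_operator L "jacobi a \<rho>"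
  by unfold_locales (simp_all add: clinear_bounded_L L_eq LA_from_zl2[OF \<rho>_bounded])

lemma segment_not_residual: "\<mu> \<in> imag_segment (2 * \<bar>a\<bar> * r) \<Longrightarrow> \<mu> \<notin> residual_spectrum L"
  unfolding residual_spectrum_def dense_shifted_iff inj_shifted_iff imag_segment_def
  using dense_range[OF a] by blast

lemma segment_continuous_iff:
  assumes "\<mu> \<in> imag_segment (2 * \<bar>a\<bar> * r)"
  shows "\<mu> \<in> continuous_spectrum L \<longleftrightarrow> inj_on (shifted L \<mu>) ell2"
proof
  assume inj: "inj_on (shifted L \<mu>) ell2"
  obtain t where "\<mu> = \<i> * of_real t" "\<bar>t\<bar> \<le> 2 * \<bar>a\<bar> * r" using assms by (auto simp: imag_segment_def)
  then show "\<mu> \<in> continuous_spectrum L"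
    using inj segment_not_residual[OF assms] not_bounded_below[OF a]
    unfolding continuous_spectrum_iff residual_spectrum_def by blast
qed (simp add: continuous_spectrum_def)

lemma segment_subset_spectrum: "imag_segment (2 * \<bar>a\<bar> * r) \<subseteq> spectrum L"
  using segment_continuous_iff by (auto simp: spectrum_def point_spectrum_def)

text \<open>Zeros of the determinant are eigenvalues and all other points are regular, so off the
  segment the spectrum has neither continuous nor residual points.\<close>

lemma off_segment:
  assumes "\<mu> \<notin> imag_segment (2 * \<bar>a\<bar> * r)"
  shows "\<mu> \<notin> spectrum L \<or> \<mu> \<in> discrete_spectrum L"
proof -
  obtain T0 j k \<xi> \<eta> where "rank_two_perturbation (jacobi a \<rho>) T0 j k \<xi> \<eta> (- imag_segment (2 * \<bar>a\<bar> * r))"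
    using rank_two by blast
  then interpret R: rank_two_perturbation "jacobi a \<rho>" T0 j k \<xi> \<eta> "- imag_segment (2 * \<bar>a\<bar> * r)" .
  have \<mu>: "\<mu> \<in> - imag_segment (2 * \<bar>a\<bar> * r)" using assms by simp
  show ?thesis
  proof (cases "R.pdet \<mu> = 0")
    case True
    obtain s B where "0 < s" "\<forall>\<nu>\<in>cball \<mu> s - {\<mu>}. regular (jacobi a \<rho>) \<nu>" "finite B"
      "\<forall>x. \<exists>c. \<forall>i. contour_integral (circlepath \<mu> s) (\<lambda>\<mu>. ent (res (jacobi a \<rho>) \<mu> x) i) = (\<Sum>u\<in>B. c u * u i)"
      using R.isolated_finite_rank[OF \<mu> True] by blast
    then show ?thesis
      using in_discrete_spectrum[of s \<mu> B] R.eigenvector_if_det_eq_0[OF \<mu> True] point_spectrum_iff by blast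
  next
    case False
    then show ?thesis using regular_not_in_spectrum R.regular_if_det_neq_0[OF \<mu>] by blast
  qed
qed

lemma segment_not_discrete:
  assumes "\<mu> \<in> imag_segment (2 * \<bar>a\<bar> * r)"
  shows "\<mu> \<notin> discrete_spectrum L"
proof
  assume "\<mu> \<in> discrete_spectrum L"
  then obtain U where U: "open U" "U \<inter> spectrum L = {\<mu>}"
    by (auto simp: discrete_spectrum_def isolated_in_def)
  then obtain e where e: "e > 0" "ball \<mu> e \<subseteq> U" by (metis openE insertI1 IntD1)
  obtain t where t: "\<mu> = \<i> * of_real t" "\<bar>t\<bar> \<le> 2 * \<bar>a\<bar> * r" using assms by (auto simp: imag_segment_def)
  define R where "R = 2 * \<bar>a\<bar> * r"
  have R: "0 < R" using a r by (simp add: R_def)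
  define d where "d = min (e / 2) R"
  have d: "0 < d" "d < e" "d \<le> R" using e(1) R by (auto simp: d_def)
  define t' where "t' = (if 0 \<le> t then t - d else t + d)"
  have t': "\<bar>t'\<bar> \<le> R" "\<bar>t - t'\<bar> = d" using t(2) d by (auto simp: t'_def R_def)
  have "dist \<mu> (\<i> * of_real t') = \<bar>t - t'\<bar>"
    unfolding t(1) dist_norm right_diff_distrib[symmetric] of_real_diff[symmetric] norm_mult norm_of_real by simp
  then have "\<i> * of_real t' \<in> U" using e(2) d t'(2) by auto
  moreover have "\<i> * of_real t' \<in> spectrum L"
    using segment_subset_spectrum imag_segment_memI[OF t'(1)] by (auto simp: R_def)
  ultimately have "\<i> * of_real t' = \<mu>" using U(2) by blast
  then show False using t'(2) d(1) by (simp add: t(1))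
qed

lemma essential_spectrum_eq: "essential_spectrum L = imag_segment (2 * \<bar>a\<bar> * r)"
  using off_segment segment_not_discrete segment_subset_spectrum by (auto simp: essential_spectrum_def)

lemma continuous_spectrum_subset: "continuous_spectrum L \<subseteq> imag_segment (2 * \<bar>a\<bar> * r)"
proof
  fix \<mu> assume c: "\<mu> \<in> continuous_spectrum L"
  then have "\<mu> \<in> spectrum L" "\<mu> \<notin> point_spectrum L"
    by (auto simp: spectrum_def continuous_spectrum_def point_spectrum_def)
  then show "\<mu> \<in> imag_segment (2 * \<bar>a\<bar> * r)" using off_segment by (auto simp: discrete_spectrum_def)
qed

lemma residual_spectrum_eq: "residual_spectrum L = {}"
proof -
  have "\<mu> \<notin> residual_spectrum L" for \<mu>
  proof
    assume c: "\<mu> \<in> residual_spectrum L"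
    then have "\<mu> \<in> spectrum L" "\<mu> \<notin> point_spectrum L"
      by (auto simp: spectrum_def residual_spectrum_def point_spectrum_def)
    then have "\<mu> \<in> imag_segment (2 * \<bar>a\<bar> * r)" using off_segment by (auto simp: discrete_spectrum_def)
    then show False using c segment_not_residual by blast
  qed
  then show ?thesis by blast
qed

lemma continuous_spectrum_memI:
  assumes "\<mu> \<in> imag_segment (2 * \<bar>a\<bar> * r)" "\<mu> \<noteq> 0 \<or> (\<forall>n. \<rho> n \<noteq> 0)"
  shows "\<mu> \<in> continuous_spectrum L"
proof -
  obtain t where t: "\<mu> = \<i> * of_real t" "\<bar>t\<bar> \<le> 2 * \<bar>a\<bar> * r" using assms(1) by (auto simp: imag_segment_def)
  have "t \<noteq> 0 \<or> (\<forall>n. \<rho> n \<noteq> 0)" using assms(2) t(1) by auto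
  then show ?thesis
    unfolding segment_continuous_iff[OF assms(1)] inj_shifted_iff
    using no_embedded_eigenvalue[OF a t(2)] t(1) by blast
qed

lemma continuous_spectrum_eq:
  "(\<forall>n. \<rho> n \<noteq> 0) \<Longrightarrow> continuous_spectrum L = imag_segment (2 * \<bar>a\<bar> * r)"
  "\<rho> n = 0 \<Longrightarrow> continuous_spectrum L = imag_segment (2 * \<bar>a\<bar> * r) - {0}"
  using continuous_spectrum_subset continuous_spectrum_memI zero_eigenvalue(2)[of \<rho> n a] L_eq by auto

lemma spectrum_eq_if_all_negative:
  assumes "\<And>n. \<rho> n < 0"
  shows "spectrum L = imag_segment (2 * \<bar>a\<bar> * r)"
  using regular_not_in_spectrum regular_if_all_negative[OF assms] segment_subset_spectrum by blast

lemma point_spectrum_symmetric: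
  assumes "\<mu> \<in> point_spectrum L"
  shows "cnj \<mu> \<in> point_spectrum L" "- cnj \<mu> \<in> point_spectrum L"
proof -
  have sym: "- cnj \<nu> \<in> point_spectrum L" "- \<nu> \<in> point_spectrum L" if \<nu>: "\<nu> \<in> point_spectrum L" for \<nu>
  proof -
    obtain x where x: "x \<noteq> 0" "jacobi a \<rho> x = cscale \<nu> x" using \<nu> unfolding point_spectrum_iff by blast
    show "- cnj \<nu> \<in> point_spectrum L" "- \<nu> \<in> point_spectrum L"
      unfolding point_spectrum_iff by (rule jacobi_eigenvalue_symmetric[OF \<rho>_bounded x])+
  qed
  show "- cnj \<mu> \<in> point_spectrum L" by (rule sym(1)[OF assms])
  from sym(2)[OF this] show "cnj \<mu> \<in> point_spectrum L" by simp
qed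

end

end

lemma CB_eq: "CB b = imag_segment (2 * \<bar>b\<bar>)"
proof (intro set_eqI iffI)
  fix \<mu> assume "\<mu> \<in> CB b"
  then obtain \<theta> where \<mu>: "\<mu> = \<i> * of_real (2 * b * cos (2 * \<theta>))" by (auto simp: CB_def)
  have "\<bar>2 * b * cos (2 * \<theta>)\<bar> \<le> 2 * \<bar>b\<bar>" by (simp add: abs_mult mult_left_le)
  then show "\<mu> \<in> imag_segment (2 * \<bar>b\<bar>)" unfolding \<mu> by (rule imag_segment_memI)
next
  fix \<mu> assume "\<mu> \<in> imag_segment (2 * \<bar>b\<bar>)"
  then obtain t where t: "\<mu> = \<i> * of_real t" "\<bar>t\<bar> \<le> 2 * \<bar>b\<bar>" by (auto simp: imag_segment_def)
  \<comment> \<open>If b = 0, then t = 0 and the quotient is 0 by convention; \<theta> = pi/4 then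
    serves as well.\<close>
  define \<theta> where "\<theta> = arccos (t / (2 * b)) / 2"
  have "\<bar>t / (2 * b)\<bar> \<le> 1" using t(2) by (simp add: abs_divide abs_mult divide_le_eq)
  then have "- 1 \<le> t / (2 * b)" "t / (2 * b) \<le> 1" by linarith+
  then have "cos (2 * \<theta>) = t / (2 * b)" "0 \<le> \<theta>" "\<theta> \<le> pi / 2"
    unfolding \<theta>_def using arccos_bounded[of "t / (2 * b)"] by simp_all
  moreover have "2 * b * (t / (2 * b)) = t" using t(2) by (cases "b = 0") auto
  moreover from \<open>\<theta> \<le> pi / 2\<close> have "\<theta> < 2 * pi" using pi_gt_zero by linarith
  ultimately show "\<mu> \<in> CB b" unfolding CB_def t(1) by (intro CollectI exI[of _ \<theta>]) auto
qed

section \<open>From lattice points to the weights\<close>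

lemma lnorm_powi: "lnorm k powi (- 2) = 1 / ((real_of_int (fst k))\<^sup>2 + (real_of_int (snd k))\<^sup>2)"
  by (simp add: lnorm_def power_int_minus inverse_eq_divide)

lemma line_weights_rho:
  assumes cross: "fst p * snd kh - snd p * fst kh \<noteq> 0"
  shows "\<exists>c s2. line_weights (lnorm p powi (- 2)) c s2 (rho kh p)"
proof -
  define p1 p2 k1 k2 where "p1 = real_of_int (fst p)" and "p2 = real_of_int (snd p)"
    and "k1 = real_of_int (fst kh)" and "k2 = real_of_int (snd kh)"
  have x: "p1 * k2 - p2 * k1 \<noteq> 0"
    using cross unfolding p1_def p2_def k1_def k2_def by (simp flip: of_int_mult of_int_diff)
  define q where "q = p1\<^sup>2 + p2\<^sup>2"
  have q: "0 < q" unfolding q_def using x by (metis diff_0_right mult_zero_left sum_power2_gt_zero_iff)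
  \<comment> \<open>-c is the parameter n at which the line comes closest to the origin, and the
    cross product over q is, up to sign, the distance there in units of |p|.\<close>
  define c where "c = (k1 * p1 + k2 * p2) / q"
  define s2 where "s2 = 1 - ((p1 * k2 - p2 * k1) / q)\<^sup>2"
  have s2: "s2 < 1" using x q by (simp add: s2_def)
  have "line_weights (1 / q) c s2 (rho kh p)"
  proof
    fix n
    define P where "P = (real_of_int n + c)\<^sup>2 - s2"
    have P: "0 < P + 1" using s2 zero_le_power2[of "real_of_int n + c"] unfolding P_def by linarith
    have "(k1 + real_of_int n * p1)\<^sup>2 + (k2 + real_of_int n * p2)\<^sup>2 = q * (P + 1)"
    proof -
      \<comment> \<open>Lagrange's identity for \<open>p\<close> and kh + n p, whose cross product
        with \<open>p\<close> does not depend on n.\<close>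
      have "q * (q * (P + 1)) = (q * real_of_int n + (k1 * p1 + k2 * p2))\<^sup>2 + (p1 * k2 - p2 * k1)\<^sup>2"
        using q unfolding P_def s2_def c_def by (simp add: power2_eq_square field_simps)
      also have "\<dots> = q * ((k1 + real_of_int n * p1)\<^sup>2 + (k2 + real_of_int n * p2)\<^sup>2)"
        unfolding q_def by (simp add: power2_eq_square algebra_simps)
      finally show ?thesis using q by simp
    qed
    then have "rho kh p n = 1 / (q * (P + 1)) - 1 / q"
      unfolding rho_def lnorm_powi line_pt_def by (simp add: p1_def p2_def k1_def k2_def q_def)
    also have "\<dots> = - (1 / q) * P / (P + 1)"
    proof -
      have "1 / (q * y) - 1 / q = - (1 / q) * (y - 1) / y" if "0 < y" for y
        using q that by (simp add: field_simps)
      from this[OF P] show ?thesis by simp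
    qed
    finally show "rho kh p n = - (1 / q) * ((real_of_int n + c)\<^sup>2 - s2) / ((real_of_int n + c)\<^sup>2 - s2 + 1)"
      by (simp add: P_def)
  qed (use q s2 in auto)
  then show ?thesis unfolding lnorm_powi p1_def p2_def q_def by blast
qed

lemma rho_sign:
  assumes "line_pt kh p n \<noteq> (0, 0)" "p \<noteq> (0, 0)"
  shows "0 \<le> rho kh p n \<longleftrightarrow> lnorm (line_pt kh p n) \<le> lnorm p"
    and "rho kh p n = 0 \<longleftrightarrow> lnorm (line_pt kh p n) = lnorm p"
proof -
  define N :: "int \<times> int \<Rightarrow> real" where "N k = (real_of_int (fst k))\<^sup>2 + (real_of_int (snd k))\<^sup>2" for k
  have N: "0 < N k" if "k \<noteq> (0, 0)" for k using that by (cases k) (auto simp: N_def sum_power2_gt_zero_iff)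
  have "rho kh p n = inverse (N (line_pt kh p n)) - inverse (N p)"
    by (simp add: rho_def lnorm_powi N_def inverse_eq_divide)
  moreover have "lnorm k = sqrt (N k)" for k by (simp add: lnorm_def N_def)
  ultimately show "0 \<le> rho kh p n \<longleftrightarrow> lnorm (line_pt kh p n) \<le> lnorm p"
    "rho kh p n = 0 \<longleftrightarrow> lnorm (line_pt kh p n) = lnorm p"
    using N[OF assms(1)] N[OF assms(2)] by (simp_all add: inverse_le_iff_le)
qed

theorem mainTheorem3:
  fixes p kh :: "int \<times> int" and \<Gamma> :: complex and a b :: real and L :: seq_op
  assumes "p \<noteq> (0, 0)" and "kh \<noteq> (0, 0)"
    and "a = 1 / 2 * cmod \<Gamma> * real_of_int (fst p * snd kh - snd p * fst kh)"
    and "a \<noteq> 0"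
    and "b = - a * lnorm p powi (-2)"
    and "L = LA a (rho kh p)"
  shows "(Sigma_line kh p \<inter> closed_disk p = {} \<longrightarrow>
            spectrum L = continuous_spectrum L \<and> continuous_spectrum L = CB b)
       \<and> (Sigma_line kh p \<inter> closed_disk p \<noteq> {} \<longrightarrow>
            essential_spectrum L = CB b
          \<and> ((\<forall>k\<in>Sigma_line kh p. lnorm k \<noteq> lnorm p) \<longrightarrow> continuous_spectrum L = CB b)
          \<and> ((\<exists>k\<in>Sigma_line kh p. lnorm k = lnorm p) \<longrightarrow> continuous_spectrum L = CB b - {0})
          \<and> residual_spectrum L = {}
          \<and> (\<forall>\<mu>\<in>point_spectrum L. cnj \<mu> \<in> point_spectrum L \<and> - cnj \<mu> \<in> point_spectrum L))"
proof -
  have cross: "fst p * snd kh - snd p * fst kh \<noteq> 0"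
    using assms(3,4) by (metis mult_zero_right of_int_0)
  define r where "r = lnorm p powi (- 2)"
  obtain c s2 where "line_weights r c s2 (rho kh p)" using line_weights_rho[OF cross] by (auto simp: r_def)
  then interpret line_weights r c s2 "rho kh p" .
  have CB: "CB b = imag_segment (2 * \<bar>a\<bar> * r)"
    unfolding CB_eq assms(5) r_def[symmetric] using r by (simp add: abs_mult mult.assoc)
  \<comment> \<open>As \<open>p\<close> and \<open>kh\<close> are linearly independent, the line
    misses the origin. So each \<rho> is a difference of genuine reciprocals, and
    \<open>Sigma_line\<close> is the whole line.\<close>
  have line: "line_pt kh p n \<noteq> (0, 0)" for n
  proof
    assume "line_pt kh p n = (0, 0)"
    then have "fst kh = - n * fst p" "snd kh = - n * snd p" by (auto simp: line_pt_def)
    then show False using cross by simp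
  qed
  have Sigma: "Sigma_line kh p = range (line_pt kh p)" unfolding Sigma_line_def by (rule Diff_triv) (auto simp: line[symmetric])
  note sign = rho_sign[OF line assms(1)]
  have disk: "Sigma_line kh p \<inter> closed_disk p = {} \<longleftrightarrow> (\<forall>n. rho kh p n < 0)"
    unfolding Sigma closed_disk_def using line by (auto simp: sign(1) simp flip: not_le)
  have circle: "(\<exists>k\<in>Sigma_line kh p. lnorm k = lnorm p) \<longleftrightarrow> (\<exists>n. rho kh p n = 0)"
    unfolding Sigma by (simp add: sign(2))
  note facts = continuous_spectrum_eq[OF assms(4,6)] essential_spectrum_eq[OF assms(4,6)]
    residual_spectrum_eq[OF assms(4,6)] point_spectrum_symmetric[OF assms(4,6)]
    spectrum_eq_if_all_negative[OF assms(4,6)]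
  show ?thesis
    unfolding disk CB
  proof (intro conjI impI ballI)
    assume neg: "\<forall>n. rho kh p n < 0"
    then have c: "continuous_spectrum L = imag_segment (2 * \<bar>a\<bar> * r)" by (intro facts(1)) (metis less_irrefl)
    then show "continuous_spectrum L = imag_segment (2 * \<bar>a\<bar> * r)" .
    show "spectrum L = continuous_spectrum L" unfolding c using neg by (intro facts) auto
  next
    assume "\<forall>k\<in>Sigma_line kh p. lnorm k \<noteq> lnorm p"
    then have "\<forall>n. rho kh p n \<noteq> 0" using circle by blast
    then show "continuous_spectrum L = imag_segment (2 * \<bar>a\<bar> * r)" by (rule facts(1))
  next
    assume "\<exists>k\<in>Sigma_line kh p. lnorm k = lnorm p"
    then obtain n where "rho kh p n = 0" using circle by blast
    then show "continuous_spectrum L = imag_segment (2 * \<bar>a\<bar> * r) - {0}" by (rule facts(2))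
  qed (use facts in auto)
qed

end
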